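(* Let $K$ be a semitopological semihypergroup and let $H\subseteq K$ be a sub-semihypergroup. Then the following properties are equivalent. (1) $H$ admits a topological left-invariant mean (TLIM). (2) There exists a topological left $H$-invariant mean $m\in\mathcal{M}(K)$ such that $m(\chi_H)=1$. Moreover, if $H$ is of Type L, then properties (1) and (2) are equivalent to the following: (3) There exists a topological left $H$-invariant mean $m\in\mathcal{M}(K)$ such that $m(\chi_H)>0$.
   Context: All topologies are Hausdorff. For a locally compact Hausdorff space $X$: $M(X)$ is the space of regular complex Borel measures on $X$ with total variation norm; $M^+(X)$ and $P(X)$ are its subsets of finite non-negative measures and of probability measures; $p_x$ is the Dirac measure at $x$; $C_c^+(X)$ is the set of non-negative compactly supported continuous functions on $X$. The cone topology on $M^+(X)$ is the weakest topology making $\mu\mapsto\int_X f\,d\mu$ continuous for every $f\in C_c^+(X)\cup\{1_X\}$, where $1_X$ is the characteristic function of $X$. $\mathfrak{C}(X)$ is the set of compact subsets of $X$ with the Michael topology, generated by the sub-basis of sets $\{C\in\mathfrak{C}(X): C\cap U\neq\emptyset,\ C\subset V\}$, with $U,V$ open in $X$. Semitopological semihypergroup: a pair $(K,* )$ where (A1) $K$ is a locally compact Hausdorff space and $*$ is a binary operation on $M(K)$ making $(M(K),* )$ an associative algebra (so $*$ is bilinear); (A2$'$) $*$ is positive (it maps $M^+(K)\times M^+(K)$ into $M^+(K)$) and separately continuous on $M^+(K)\times M^+(K)$ for the cone topology; (A3) for all $x,y\in K$, $p_x*p_y$ is a probability measure with compact support; (A4$'$) the map $(x,y)\mapsto \operatorname{supp}(p_x*p_y)$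 from $K\times K$ to $\mathfrak{C}(K)$ is separately continuous. With the total variation norm, $M(K)$ is an associative Banach algebra. For $A,B\subseteq K$, $A*B:=\bigcup_{x\in A,\,y\in B}\operatorname{supp}(p_x*p_y)$. A sub-semihypergroup of $K$ is a closed subset $H\subseteq K$ with $H*H\subseteq H$. It is itself regarded as a semitopological semihypergroup with the convolution inherited from $K$: for $\sigma,\tau\in M(H)$, $\sigma*\tau\in M(H)$ is determined by $\int_H f\,d(\sigma*\tau)=\int_H\int_H f(x*y)\,d\sigma(x)\,d\tau(y)$ for bounded continuous $f$ on $H$, where $f(x*y):=\int_H f\,d(p_x*p_y)$ for $x,y\in H$. Type L: for $x\in K$ and $E\subseteq K$ Borel, put $\tilde{x}E:=\{y\in K:(p_x*p_y)(E)>0\}$ and $x^{-1}E:=\{y\in K:(p_x*p_y)(E)=1\}$. $E$ is of Type L if $\tilde{x}E=x^{-1}E$ for each $x\in E$. Translates and means: for $\mu\in P(K)$ and $\phi\in M(K)^*$, define $L_\mu\phi\in M(K)^*$ by $L_\mu\phi(\nu)=\phi(\mu*\nu)$ for $\nu\in M(K)$. A mean is a functional $m\in M(K)^{**}$ with $\|m\|=1$ that is positive, i.e. $m(\phi)\ge 0$ whenever $\phi\in M(K)^*$ satisfies $\phi\ge0$ (meaning $\phi(\nu)\ge 0$ for all $\nu\in M^+(K)$). The set of all means on $M(K)^*$ is denoted $\mathcal{M}(K)$. A mean $m\in\mathcal{M}(K)$ is a topological left-invariant mean (TLIM) of $K$ if $m(L_\nu\phi)=m(\phi)$ for all $\nu\in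 P(K)$, $\phi\in M(K)^*$; the same definition applied to the semihypergroup $H$ (with $M(H)$, $P(H)$) defines a TLIM of $H$. A mean $m\in\mathcal{M}(K)$ is topological left $H$-invariant if $m(L_\nu\phi)=m(\phi)$ for every $\nu\in P(K)$ with $\operatorname{supp}(\nu)\subseteq H$ and every $\phi\in M(K)^*$. A bounded Borel function $f$ on $K$ is identified with the functional $\mu\mapsto\int_K f\,d\mu$ in $M(K)^*$; in particular the characteristic function $\chi_H$ is the functional $\mu\mapsto\mu(H)$. *)

theory Defs
  imports "HOL-Analysis.Analysis" "HOL-Library.Complex_Order"
begin

text \<open>
  Spaces are carried by abstract topologies, so that a closed subset \<open>H\<close> of \<open>X\<close> is treated by the
  same definitions, applied to \<open>subtopology X H\<close>. The order on complex numbers is that of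
  Complex_Order: \<open>0 \<le> z\<close> and \<open>0 < z\<close> include that \<open>z\<close> is real.
\<close>

definition borel_sets :: "'a topology \<Rightarrow> 'a set set" where
  "borel_sets X = sigma_sets (topspace X) {U. openin X U}"

definition total_variation :: "'a topology \<Rightarrow> ('a set \<Rightarrow> complex) \<Rightarrow> 'a set \<Rightarrow> ennreal" where
  "total_variation X \<mu> E =
     (SUP A \<in> {A :: nat \<Rightarrow> 'a set. range A \<subseteq> borel_sets X \<and> disjoint_family A \<and> (\<Union>i. A i) = E}.
        \<Sum>i. ennreal (cmod (\<mu> (A i))))"

text \<open>Measures are set functions, normalised to \<open>0\<close> off the Borel sets, so that equality of
  measures is equality of functions and the vector space operations are pointwise.\<close>

definition regular_measures :: "'a topology \<Rightarrow> ('a set \<Rightarrow> complex) set" where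
  "regular_measures X = {\<mu>.
     (\<forall>E. E \<notin> borel_sets X \<longrightarrow> \<mu> E = 0) \<and>
     (\<forall>A :: nat \<Rightarrow> 'a set. range A \<subseteq> borel_sets X \<longrightarrow> disjoint_family A \<longrightarrow>
        (\<lambda>i. \<mu> (A i)) sums \<mu> (\<Union>i. A i)) \<and>
     (\<forall>E \<in> borel_sets X. \<forall>e::real. e > 0 \<longrightarrow>
        (\<exists>C U. compactin X C \<and> openin X U \<and> C \<subseteq> E \<and> E \<subseteq> U \<and>
               total_variation X \<mu> (U - C) < ennreal e))}"

definition tv_norm :: "'a topology \<Rightarrow> ('a set \<Rightarrow> complex) \<Rightarrow> real" where
  "tv_norm X \<mu> = enn2real (total_variation X \<mu> (topspace X))"

definition pos_measures :: "'a topology \<Rightarrow> ('a set \<Rightarrow> complex) set" where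
  "pos_measures X = {\<mu> \<in> regular_measures X. \<forall>E \<in> borel_sets X. 0 \<le> \<mu> E}"

definition prob_measures :: "'a topology \<Rightarrow> ('a set \<Rightarrow> complex) set" where
  "prob_measures X = {\<mu> \<in> pos_measures X. \<mu> (topspace X) = 1}"

definition dirac :: "'a topology \<Rightarrow> 'a \<Rightarrow> 'a set \<Rightarrow> complex" where
  "dirac X x = (\<lambda>E. if E \<in> borel_sets X \<and> x \<in> E then 1 else 0)"

definition msupp :: "'a topology \<Rightarrow> ('a set \<Rightarrow> complex) \<Rightarrow> 'a set" where
  "msupp X \<mu> = {x \<in> topspace X. \<forall>U. openin X U \<and> x \<in> U \<longrightarrow> total_variation X \<mu> U \<noteq> 0}"

text \<open>The positive part \<open>\<nu>\<^sup>+ E = sup {\<nu> F | F \<subseteq> E}\<close> of a finite signed measure \<open>\<nu>\<close>; the coercion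
  \<open>ennreal\<close> sends negative values to \<open>0\<close>, which is harmless as \<open>F = {}\<close> contributes \<open>0\<close>.\<close>

definition pos_part :: "'a topology \<Rightarrow> ('a set \<Rightarrow> real) \<Rightarrow> 'a measure" where
  "pos_part X \<nu> = measure_of (topspace X) (borel_sets X)
     (\<lambda>E. SUP F \<in> {F \<in> borel_sets X. F \<subseteq> E}. ennreal (\<nu> F))"

text \<open>Integration against a complex measure, by Jordan decomposition of its real and imaginary
  parts.\<close>

definition cintegral :: "'a topology \<Rightarrow> ('a set \<Rightarrow> complex) \<Rightarrow> ('a \<Rightarrow> complex) \<Rightarrow> complex" where
  "cintegral X \<mu> f =
     (integral\<^sup>L (pos_part X (\<lambda>E. Re (\<mu> E))) f - integral\<^sup>L (pos_part X (\<lambda>E. - Re (\<mu> E))) f) +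
     \<i> * (integral\<^sup>L (pos_part X (\<lambda>E. Im (\<mu> E))) f - integral\<^sup>L (pos_part X (\<lambda>E. - Im (\<mu> E))) f)"

definition Cc_pos :: "'a topology \<Rightarrow> ('a \<Rightarrow> real) set" where
  "Cc_pos X = {f. continuous_map X euclideanreal f \<and> (\<forall>x \<in> topspace X. 0 \<le> f x) \<and>
     compactin X (X closure_of {x \<in> topspace X. f x \<noteq> 0})}"

definition cone_topology :: "'a topology \<Rightarrow> ('a set \<Rightarrow> complex) topology" where
  "cone_topology X = topology_generated_by
     {{\<mu> \<in> pos_measures X. cintegral X \<mu> (\<lambda>x. complex_of_real (f x)) \<in> W} | f W.
        f \<in> Cc_pos X \<union> {\<lambda>_. 1} \<and> open W}"

text \<open>The whole space is added to the sub-basis because \<open>topology_generated_by\<close> does not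
  include the empty intersection, and no other sub-basic set contains the empty compact set.\<close>

definition michael_topology :: "'a topology \<Rightarrow> 'a set topology" where
  "michael_topology X = topology_generated_by
     (insert {C. compactin X C}
        {{C. compactin X C \<and> C \<inter> U \<noteq> {} \<and> C \<subseteq> V} | U V. openin X U \<and> openin X V})"

type_synonym 'a convolution =
  "('a set \<Rightarrow> complex) \<Rightarrow> ('a set \<Rightarrow> complex) \<Rightarrow> ('a set \<Rightarrow> complex)"

definition assoc_algebra :: "('b \<Rightarrow> complex) set \<Rightarrow>
    (('b \<Rightarrow> complex) \<Rightarrow> ('b \<Rightarrow> complex) \<Rightarrow> ('b \<Rightarrow> complex)) \<Rightarrow> bool" where
  "assoc_algebra V m \<longleftrightarrow>
     (\<forall>u \<in> V. \<forall>v \<in> V. m u v \<in> V) \<and>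
     (\<forall>u \<in> V. \<forall>v \<in> V. \<forall>w \<in> V. m (m u v) w = m u (m v w)) \<and>
     (\<forall>u \<in> V. \<forall>v \<in> V. \<forall>w \<in> V. m (\<lambda>s. u s + v s) w = (\<lambda>s. m u w s + m v w s)) \<and>
     (\<forall>u \<in> V. \<forall>v \<in> V. \<forall>w \<in> V. m w (\<lambda>s. u s + v s) = (\<lambda>s. m w u s + m w v s)) \<and>
     (\<forall>c. \<forall>u \<in> V. \<forall>v \<in> V. m (\<lambda>s. c * u s) v = (\<lambda>s. c * m u v s)) \<and>
     (\<forall>c. \<forall>u \<in> V. \<forall>v \<in> V. m u (\<lambda>s. c * v s) = (\<lambda>s. c * m u v s))"

definition semitopological_semihypergroup :: "'a topology \<Rightarrow> 'a convolution \<Rightarrow> bool" where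
  "semitopological_semihypergroup X conv \<longleftrightarrow>
     locally_compact_space X \<and> Hausdorff_space X \<and>
     assoc_algebra (regular_measures X) conv \<and>
     (\<forall>\<mu> \<in> pos_measures X. \<forall>\<nu> \<in> pos_measures X. conv \<mu> \<nu> \<in> pos_measures X) \<and>
     (\<forall>\<mu> \<in> pos_measures X.
        continuous_map (cone_topology X) (cone_topology X) (\<lambda>\<nu>. conv \<mu> \<nu>) \<and>
        continuous_map (cone_topology X) (cone_topology X) (\<lambda>\<nu>. conv \<nu> \<mu>)) \<and>
     (\<forall>x \<in> topspace X. \<forall>y \<in> topspace X.
        conv (dirac X x) (dirac X y) \<in> prob_measures X \<and>
        compactin X (msupp X (conv (dirac X x) (dirac X y)))) \<and>
     (\<forall>x \<in> topspace X.
        continuous_map X (michael_topology X) (\<lambda>y. msupp X (conv (dirac X x) (dirac X y))) \<and>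
        continuous_map X (michael_topology X) (\<lambda>y. msupp X (conv (dirac X y) (dirac X x))))"

definition set_conv :: "'a topology \<Rightarrow> 'a convolution \<Rightarrow> 'a set \<Rightarrow> 'a set \<Rightarrow> 'a set" where
  "set_conv X conv A B = (\<Union>x \<in> A. \<Union>y \<in> B. msupp X (conv (dirac X x) (dirac X y)))"

definition sub_semihypergroup :: "'a topology \<Rightarrow> 'a convolution \<Rightarrow> 'a set \<Rightarrow> bool" where
  "sub_semihypergroup X conv H \<longleftrightarrow> closedin X H \<and> set_conv X conv H H \<subseteq> H"

text \<open>The convolution on \<open>M(H)\<close> inherited from \<open>X\<close>. The innermost integral is \<open>f(x*y)\<close>, the
  integral over \<open>H\<close> of \<open>f\<close> against \<open>p\<^sub>x * p\<^sub>y\<close>.\<close>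

definition sub_conv :: "'a topology \<Rightarrow> 'a convolution \<Rightarrow> 'a set \<Rightarrow> 'a convolution" where
  "sub_conv X conv H \<sigma> \<tau> = (THE \<rho>. \<rho> \<in> regular_measures (subtopology X H) \<and>
     (\<forall>f :: 'a \<Rightarrow> complex.
        continuous_map (subtopology X H) euclidean f \<and> bounded (f ` topspace (subtopology X H)) \<longrightarrow>
        cintegral (subtopology X H) \<rho> f =
          cintegral (subtopology X H) \<tau> (\<lambda>y. cintegral (subtopology X H) \<sigma> (\<lambda>x.
            cintegral X (conv (dirac X x) (dirac X y)) (\<lambda>z. indicator H z * f z)))))"

definition type_L :: "'a topology \<Rightarrow> 'a convolution \<Rightarrow> 'a set \<Rightarrow> bool" where
  "type_L X conv E \<longleftrightarrow> E \<in> borel_sets X \<and>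
     (\<forall>x \<in> E. {y \<in> topspace X. 0 < conv (dirac X x) (dirac X y) E} =
              {y \<in> topspace X. conv (dirac X x) (dirac X y) E = 1})"

text \<open>The dual of a normed space \<open>(V, N)\<close> of complex functions with pointwise operations. Functionals
  are normalised to \<open>0\<close> off \<open>V\<close>; the dual is again a space of complex functions with pointwise
  operations, so the construction iterates.\<close>

definition cdual :: "('b \<Rightarrow> complex) set \<Rightarrow> (('b \<Rightarrow> complex) \<Rightarrow> real) \<Rightarrow>
    (('b \<Rightarrow> complex) \<Rightarrow> complex) set" where
  "cdual V N = {\<phi>.
     (\<forall>v. v \<notin> V \<longrightarrow> \<phi> v = 0) \<and>
     (\<forall>u \<in> V. \<forall>v \<in> V. \<phi> (\<lambda>s. u s + v s) = \<phi> u + \<phi> v) \<and>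
     (\<forall>c. \<forall>v \<in> V. \<phi> (\<lambda>s. c * v s) = c * \<phi> v) \<and>
     (\<exists>B. \<forall>v \<in> V. cmod (\<phi> v) \<le> B * N v)}"

definition dual_norm :: "('b \<Rightarrow> complex) set \<Rightarrow> (('b \<Rightarrow> complex) \<Rightarrow> real) \<Rightarrow>
    (('b \<Rightarrow> complex) \<Rightarrow> complex) \<Rightarrow> real" where
  "dual_norm V N \<phi> = (SUP v \<in> {v \<in> V. N v \<le> 1}. cmod (\<phi> v))"

definition M_dual :: "'a topology \<Rightarrow> (('a set \<Rightarrow> complex) \<Rightarrow> complex) set" where
  "M_dual X = cdual (regular_measures X) (tv_norm X)"

definition M_dual_norm :: "'a topology \<Rightarrow> (('a set \<Rightarrow> complex) \<Rightarrow> complex) \<Rightarrow> real" where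
  "M_dual_norm X = dual_norm (regular_measures X) (tv_norm X)"

definition M_bidual :: "'a topology \<Rightarrow> ((('a set \<Rightarrow> complex) \<Rightarrow> complex) \<Rightarrow> complex) set" where
  "M_bidual X = cdual (M_dual X) (M_dual_norm X)"

definition M_bidual_norm :: "'a topology \<Rightarrow> ((('a set \<Rightarrow> complex) \<Rightarrow> complex) \<Rightarrow> complex) \<Rightarrow> real"
  where "M_bidual_norm X = dual_norm (M_dual X) (M_dual_norm X)"

definition means_on :: "'a topology \<Rightarrow> ((('a set \<Rightarrow> complex) \<Rightarrow> complex) \<Rightarrow> complex) set" where
  "means_on X = {m \<in> M_bidual X. M_bidual_norm X m = 1 \<and>
     (\<forall>\<phi> \<in> M_dual X. (\<forall>\<nu> \<in> pos_measures X. 0 \<le> \<phi> \<nu>) \<longrightarrow> 0 \<le> m \<phi>)}"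

definition left_translate :: "'a topology \<Rightarrow> 'a convolution \<Rightarrow> ('a set \<Rightarrow> complex) \<Rightarrow>
    (('a set \<Rightarrow> complex) \<Rightarrow> complex) \<Rightarrow> ('a set \<Rightarrow> complex) \<Rightarrow> complex" where
  "left_translate X conv \<mu> \<phi> = (\<lambda>\<nu>. if \<nu> \<in> regular_measures X then \<phi> (conv \<mu> \<nu>) else 0)"

definition TLIM :: "'a topology \<Rightarrow> 'a convolution \<Rightarrow>
    ((('a set \<Rightarrow> complex) \<Rightarrow> complex) \<Rightarrow> complex) \<Rightarrow> bool" where
  "TLIM X conv m \<longleftrightarrow> m \<in> means_on X \<and>
     (\<forall>\<nu> \<in> prob_measures X. \<forall>\<phi> \<in> M_dual X. m (left_translate X conv \<nu> \<phi>) = m \<phi>)"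

definition top_left_invariant_under :: "'a topology \<Rightarrow> 'a convolution \<Rightarrow> 'a set \<Rightarrow>
    ((('a set \<Rightarrow> complex) \<Rightarrow> complex) \<Rightarrow> complex) \<Rightarrow> bool" where
  "top_left_invariant_under X conv H m \<longleftrightarrow> m \<in> means_on X \<and>
     (\<forall>\<nu> \<in> prob_measures X. msupp X \<nu> \<subseteq> H \<longrightarrow>
        (\<forall>\<phi> \<in> M_dual X. m (left_translate X conv \<nu> \<phi>) = m \<phi>))"

definition char_functional :: "'a topology \<Rightarrow> 'a set \<Rightarrow> ('a set \<Rightarrow> complex) \<Rightarrow> complex" where
  "char_functional X E = (\<lambda>\<mu>. if \<mu> \<in> regular_measures X then \<mu> E else 0)"

end

theory Submission
  imports Defs
begin

text \<open>
  Measures on \<open>H\<close> are identified with the measures on \<open>K\<close> concentrated on \<open>H\<close>; this identification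
  carries the convolution inherited by \<open>H\<close> to that of \<open>K\<close>, because \<open>\<integral> f d(\<mu> * \<nu>) = \<integral>\<integral> f(x * y) d\<mu>(x) d\<nu>(y)\<close>
  for bounded continuous \<open>f\<close>. That formula holds for Dirac measures, whose positive combinations are dense
  in the cone topology, and extends by separate continuity.

  A mean on \<open>H\<close> extends to \<open>K\<close> by \<open>m \<phi> = m\<^sub>H (\<phi> restricted to M(H))\<close>. Conversely, if \<open>m\<close> is
  \<open>H\<close>-invariant with \<open>m \<chi>\<^sub>H > 0\<close>, then \<open>\<psi> \<mapsto> m (\<nu> \<mapsto> \<psi> (\<nu> restricted to H)) / m \<chi>\<^sub>H\<close> is a TLIM of \<open>H\<close>: the
  error in its invariance is dominated by a multiple of \<open>L\<^sub>\<mu> \<chi>\<^sub>H - \<chi>\<^sub>H \<ge> 0\<close>, where \<open>m\<close> vanishes.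
\<close>

section \<open>Total variation\<close>

text \<open>The obstacle is that the axioms describe the convolution only on Dirac measures and,
  through separate continuity, on the positive cone. The two integrations are carried out one
  variable at a time; for a positive left factor the continuity argument also shows that the inner
  integral is continuous, and hence integrable, in the remaining variable. Complex measures are
  reached by Jordan decomposition: identities that are linear in a measure, and boundedness of
  linear functionals, are checked on positive measures only. For the same reason norms on M(X) and
  its dual are traded for comparisons with the total mass of positive measures.

  The double integral is unavoidable because the convolution of \<open>H\<close> is specified only
  by its integrals of bounded continuous functions. Translation by a measure on \<open>H\<close> can
  be compared in \<open>H\<close> and in \<open>K\<close> only after the two convolutions have been
  identified.\<close>

lemma sigma_algebra_borel_sets: "sigma_algebra (topspace X) (borel_sets X)"
  unfolding borel_sets_def by (rule sigma_algebra_sigma_sets) (auto dest: openin_subset)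

lemma borel_sets_openin: "openin X U \<Longrightarrow> U \<in> borel_sets X"
  unfolding borel_sets_def by auto

lemma borel_sets_subset: "E \<in> borel_sets X \<Longrightarrow> E \<subseteq> topspace X"
  unfolding borel_sets_def by (rule sigma_sets_into_sp) (auto dest: openin_subset)

lemma borel_sets_empty [simp]: "{} \<in> borel_sets X"
  by (simp add: borel_sets_openin)

lemma borel_sets_topspace [simp]: "topspace X \<in> borel_sets X"
  by (simp add: borel_sets_openin)

lemma borel_sets_Un: "E \<in> borel_sets X \<Longrightarrow> F \<in> borel_sets X \<Longrightarrow> E \<union> F \<in> borel_sets X"
  by (meson ring_of_sets.Un algebra.axioms sigma_algebra.axioms(1) sigma_algebra_borel_sets)

lemma borel_sets_Int: "E \<in> borel_sets X \<Longrightarrow> F \<in> borel_sets X \<Longrightarrow> E \<inter> F \<in> borel_sets X"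
  by (meson semiring_of_sets.Int ring_of_sets.axioms algebra.axioms sigma_algebra.axioms(1) sigma_algebra_borel_sets)

lemma borel_sets_Diff: "E \<in> borel_sets X \<Longrightarrow> F \<in> borel_sets X \<Longrightarrow> E - F \<in> borel_sets X"
  by (meson ring_of_sets.Diff algebra.axioms sigma_algebra.axioms(1) sigma_algebra_borel_sets)

lemma borel_sets_UN: "range A \<subseteq> borel_sets X \<Longrightarrow> (\<Union>i::nat. A i) \<in> borel_sets X"
  by (meson sigma_algebra.countable_nat_UN sigma_algebra_borel_sets)

lemma borel_sets_closedin: "closedin X C \<Longrightarrow> C \<in> borel_sets X"
  by (metis borel_sets_Diff borel_sets_openin borel_sets_topspace closedin_def double_diff order_refl)

lemma borel_sets_compactin: "Hausdorff_space X \<Longrightarrow> compactin X C \<Longrightarrow> C \<in> borel_sets X"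
  by (simp add: borel_sets_closedin compactin_imp_closedin)

lemmas borel_sets_intros = borel_sets_Un borel_sets_Int borel_sets_Diff

section \<open>Total variation of set functions\<close>

lemma total_variation_upper:
  assumes "range A \<subseteq> borel_sets X" "disjoint_family A" "(\<Union>i. A i) = E"
  shows "(\<Sum>i. ennreal (cmod (\<mu> (A i)))) \<le> total_variation X \<mu> E"
  unfolding total_variation_def by (rule SUP_upper) (use assms in auto)

lemma total_variation_least:
  assumes "\<And>A :: nat \<Rightarrow> 'a set. range A \<subseteq> borel_sets X \<Longrightarrow> disjoint_family A \<Longrightarrow> (\<Union>i. A i) = E \<Longrightarrow>
    (\<Sum>i. ennreal (cmod (\<mu> (A i)))) \<le> c"
  shows "total_variation X \<mu> E \<le> c"
  unfolding total_variation_def by (rule SUP_least) (use assms in auto)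

lemma total_variation_dominated:
  assumes "\<And>A. A \<in> borel_sets X \<Longrightarrow> A \<subseteq> E \<Longrightarrow> cmod (\<mu> A) \<le> cmod (\<nu> A)"
  shows "total_variation X \<mu> E \<le> total_variation X \<nu> E"
proof (rule total_variation_least)
  fix A :: "nat \<Rightarrow> 'a set" assume A: "range A \<subseteq> borel_sets X" "disjoint_family A" "(\<Union>i. A i) = E"
  have "(\<Sum>i. ennreal (cmod (\<mu> (A i)))) \<le> (\<Sum>i. ennreal (cmod (\<nu> (A i))))"
    using A by (intro suminf_le ennreal_leI assms) auto
  also have "\<dots> \<le> total_variation X \<nu> E" by (rule total_variation_upper[OF A])
  finally show "(\<Sum>i. ennreal (cmod (\<mu> (A i)))) \<le> total_variation X \<nu> E" .
qed

lemma total_variation_add: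
  "total_variation X (\<lambda>s. \<mu> s + \<nu> s) E \<le> total_variation X \<mu> E + total_variation X \<nu> E"
proof (rule total_variation_least)
  fix A :: "nat \<Rightarrow> 'a set" assume A: "range A \<subseteq> borel_sets X" "disjoint_family A" "(\<Union>i. A i) = E"
  have "(\<Sum>i. ennreal (cmod (\<mu> (A i) + \<nu> (A i)))) \<le> (\<Sum>i. ennreal (cmod (\<mu> (A i))) + ennreal (cmod (\<nu> (A i))))"
    by (intro suminf_le) (auto simp flip: ennreal_plus intro!: ennreal_leI norm_triangle_ineq)
  also have "\<dots> = (\<Sum>i. ennreal (cmod (\<mu> (A i)))) + (\<Sum>i. ennreal (cmod (\<nu> (A i))))"
    by (intro suminf_add[symmetric]) auto
  also have "\<dots> \<le> total_variation X \<mu> E + total_variation X \<nu> E"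
    by (intro add_mono total_variation_upper[OF A])
  finally show "(\<Sum>i. ennreal (cmod (\<mu> (A i) + \<nu> (A i)))) \<le> total_variation X \<mu> E + total_variation X \<nu> E" .
qed

lemma total_variation_scale:
  "total_variation X (\<lambda>s. c * \<mu> s) E \<le> ennreal (cmod c) * total_variation X \<mu> E"
proof (rule total_variation_least)
  fix A :: "nat \<Rightarrow> 'a set" assume A: "range A \<subseteq> borel_sets X" "disjoint_family A" "(\<Union>i. A i) = E"
  have "(\<Sum>i. ennreal (cmod (c * \<mu> (A i)))) = ennreal (cmod c) * (\<Sum>i. ennreal (cmod (\<mu> (A i))))"
    by (simp add: norm_mult ennreal_mult)
  also have "\<dots> \<le> ennreal (cmod c) * total_variation X \<mu> E"
    by (intro mult_left_mono total_variation_upper[OF A]) simp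
  finally show "(\<Sum>i. ennreal (cmod (c * \<mu> (A i)))) \<le> ennreal (cmod c) * total_variation X \<mu> E" .
qed

text \<open>A partition of E becomes a partition of F when F - E is put in front of it, and the
  additional term can only increase the sum. This argument works for every set function.\<close>

lemma total_variation_mono:
  assumes "E \<in> borel_sets X" "F \<in> borel_sets X" "E \<subseteq> F"
  shows "total_variation X \<mu> E \<le> total_variation X \<mu> F"
proof (rule total_variation_least)
  fix A :: "nat \<Rightarrow> 'a set" assume A: "range A \<subseteq> borel_sets X" "disjoint_family A" "(\<Union>i. A i) = E"
  define B where "B = (\<lambda>i. case i of 0 \<Rightarrow> F - E | Suc j \<Rightarrow> A j)"
  have B: "range B \<subseteq> borel_sets X" "disjoint_family B" "(\<Union>i. B i) = F"
  proof -
    show "range B \<subseteq> borel_sets X"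
      using range_subsetD[OF A(1)] assms unfolding B_def by (auto simp: borel_sets_Diff split: nat.splits)
    show "disjoint_family B"
      using A(2,3) unfolding disjoint_family_on_def B_def by (auto split: nat.splits)
    have "(\<Union>i. B i) = B 0 \<union> (\<Union>i. B (Suc i))"
      by (metis UN_insert UN_extend_simps(10) UNIV_nat_eq)
    then show "(\<Union>i. B i) = F" using A(3) assms(3) by (auto simp: B_def)
  qed
  have "(\<Sum>i. ennreal (cmod (\<mu> (A i)))) = (\<Sum>i. ennreal (cmod (\<mu> (B (i + 1)))))"
    by (simp add: B_def)
  also have "\<dots> \<le> (\<Sum>i. ennreal (cmod (\<mu> (B i))))"
    by (subst suminf_offset[of "\<lambda>i. ennreal (cmod (\<mu> (B i)))" 1]) auto
  also have "\<dots> \<le> total_variation X \<mu> F" by (rule total_variation_upper[OF B])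
  finally show "(\<Sum>i. ennreal (cmod (\<mu> (A i)))) \<le> total_variation X \<mu> F" .
qed

lemma cmod_le_total_variation:
  assumes "E \<in> borel_sets X"
  shows "ennreal (cmod (\<mu> E)) \<le> total_variation X \<mu> E"
proof -
  define B where "B = (\<lambda>i::nat. if i = 0 then E else {})"
  have B: "range B \<subseteq> borel_sets X" "disjoint_family B" "(\<Union>i. B i) = E"
    using assms unfolding B_def disjoint_family_on_def by (auto split: if_splits)
  have "ennreal (cmod (\<mu> E)) = sum (\<lambda>i. ennreal (cmod (\<mu> (B i)))) {0}" by (simp add: B_def)
  also have "\<dots> \<le> (\<Sum>i. ennreal (cmod (\<mu> (B i))))" by (rule sum_le_suminf) auto
  also have "\<dots> \<le> total_variation X \<mu> E" by (rule total_variation_upper[OF B])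
  finally show ?thesis .
qed

text \<open>Isolated from \<open>regular_measures\<close> because subadditivity of the total
  variation and the formula for the positive part rest on this clause alone, and because it is
  established first whenever a set function is shown to be a regular measure.\<close>

definition countably_additive_on :: "'a topology \<Rightarrow> ('a set \<Rightarrow> complex) \<Rightarrow> bool" where
  "countably_additive_on X \<mu> \<longleftrightarrow> (\<forall>A :: nat \<Rightarrow> 'a set. range A \<subseteq> borel_sets X \<longrightarrow> disjoint_family A \<longrightarrow>
        (\<lambda>i. \<mu> (A i)) sums \<mu> (\<Union>i. A i))"

lemma regular_measures_iff: "\<mu> \<in> regular_measures X \<longleftrightarrow>
     (\<forall>E. E \<notin> borel_sets X \<longrightarrow> \<mu> E = 0) \<and> countably_additive_on X \<mu> \<and>
     (\<forall>E \<in> borel_sets X. \<forall>e::real. e > 0 \<longrightarrow>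
        (\<exists>C U. compactin X C \<and> openin X U \<and> C \<subseteq> E \<and> E \<subseteq> U \<and>
               total_variation X \<mu> (U - C) < ennreal e))"
  unfolding regular_measures_def countably_additive_on_def mem_Collect_eq ..

lemma regular_measuresD:
  assumes "\<mu> \<in> regular_measures X"
  shows regular_measures_off: "\<And>E. E \<notin> borel_sets X \<Longrightarrow> \<mu> E = 0"
    and regular_measures_ca: "countably_additive_on X \<mu>"
    and regular_measures_sums: "\<And>A::nat \<Rightarrow> _. range A \<subseteq> borel_sets X \<Longrightarrow> disjoint_family A \<Longrightarrow>
        (\<lambda>i. \<mu> (A i)) sums \<mu> (\<Union>i. A i)"
    and regular_measures_regular: "\<And>E e. E \<in> borel_sets X \<Longrightarrow> 0 < e \<Longrightarrow>
        \<exists>C U. compactin X C \<and> openin X U \<and> C \<subseteq> E \<and> E \<subseteq> U \<and> total_variation X \<mu> (U - C) < ennreal e"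
  using assms unfolding regular_measures_iff by (auto simp: countably_additive_on_def)

text \<open>The empty sets form a disjoint family, and a constant series converges only if its terms
  vanish.\<close>

lemma countably_additive_empty:
  assumes "countably_additive_on X \<mu>" shows "\<mu> {} = 0"
proof -
  have "(\<lambda>i::nat. \<mu> {}) sums \<mu> (\<Union>i::nat. {})"
    using assms unfolding countably_additive_on_def disjoint_family_on_def
    by (elim allE[of _ "\<lambda>_. {}"]) auto
  then show ?thesis by (simp add: sums_iff summable_const_iff)
qed

lemma countably_additive_Un:
  assumes "countably_additive_on X \<mu>" "E \<in> borel_sets X" "F \<in> borel_sets X" "E \<inter> F = {}"
  shows "\<mu> (E \<union> F) = \<mu> E + \<mu> F"
proof -
  have "(\<lambda>i. \<mu> (binaryset E F i)) sums \<mu> (\<Union>i. binaryset E F i)"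
  proof -
    have "range (binaryset E F) \<subseteq> borel_sets X" using assms(2,3) by (simp add: range_binaryset_eq)
    moreover have "disjoint_family (binaryset E F)"
      using assms(4) by (auto simp: disjoint_family_on_def binaryset_def)
    ultimately show ?thesis using assms(1) unfolding countably_additive_on_def by blast
  qed
  moreover have "(\<lambda>i. \<mu> (binaryset E F i)) sums (\<mu> E + \<mu> F)"
    by (rule binaryset_sums[where f = \<mu>, OF countably_additive_empty[OF assms(1)]])
  ultimately show ?thesis by (metis UN_binaryset_eq sums_unique2)
qed

lemma countably_additive_Diff:
  assumes "countably_additive_on X \<mu>" "E \<in> borel_sets X" "F \<in> borel_sets X" "F \<subseteq> E"
  shows "\<mu> (E - F) = \<mu> E - \<mu> F"
proof -
  have "\<mu> ((E - F) \<union> F) = \<mu> (E - F) + \<mu> F"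
    using assms by (intro countably_additive_Un borel_sets_Diff) auto
  moreover have "(E - F) \<union> F = E" using assms(4) by blast
  ultimately show ?thesis by simp
qed

text \<open>Each piece of a partition of the union is cut along E: the parts inside E partition E,
  the parts outside partition F - E.\<close>

lemma total_variation_Un:
  assumes "countably_additive_on X \<mu>" and E: "E \<in> borel_sets X" and F: "F \<in> borel_sets X"
  shows "total_variation X \<mu> (E \<union> F) \<le> total_variation X \<mu> E + total_variation X \<mu> F"
proof (rule total_variation_least)
  fix A :: "nat \<Rightarrow> 'a set" assume A: "range A \<subseteq> borel_sets X" "disjoint_family A" "(\<Union>i. A i) = E \<union> F"
  have *: "cmod (\<mu> (A i)) \<le> cmod (\<mu> (A i \<inter> E)) + cmod (\<mu> (A i - E))" for i
  proof -
    have "A i \<in> borel_sets X" using A(1) by auto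
    then have "\<mu> (A i \<inter> E \<union> (A i - E)) = \<mu> (A i \<inter> E) + \<mu> (A i - E)"
      using E by (intro countably_additive_Un[OF assms(1)] borel_sets_intros) auto
    then show ?thesis by (simp add: Int_Diff_Un norm_triangle_ineq)
  qed
  have "(\<Sum>i. ennreal (cmod (\<mu> (A i)))) \<le> (\<Sum>i. ennreal (cmod (\<mu> (A i \<inter> E))) + ennreal (cmod (\<mu> (A i - E))))"
    by (intro suminf_le) (auto simp flip: ennreal_plus intro!: ennreal_leI *)
  also have "\<dots> = (\<Sum>i. ennreal (cmod (\<mu> (A i \<inter> E)))) + (\<Sum>i. ennreal (cmod (\<mu> (A i - E))))"
    by (intro suminf_add[symmetric]) auto
  also have "\<dots> \<le> total_variation X \<mu> E + total_variation X \<mu> (F - E)"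
    using A E by (intro add_mono total_variation_upper)
      (auto simp: disjoint_family_on_def intro!: borel_sets_intros)
  also have "\<dots> \<le> total_variation X \<mu> E + total_variation X \<mu> F"
    by (intro add_mono order_refl total_variation_mono borel_sets_intros E F) auto
  finally show "(\<Sum>i. ennreal (cmod (\<mu> (A i)))) \<le> total_variation X \<mu> E + total_variation X \<mu> F" .
qed

lemma total_variation_empty:
  assumes "countably_additive_on X \<mu>" shows "total_variation X \<mu> {} = 0"
proof -
  have "total_variation X \<mu> {} \<le> 0"
    by (rule total_variation_least) (simp add: countably_additive_empty[OF assms])
  then show ?thesis by simp
qed

text \<open>Serves to pass from points to compact sets, once for finite variation and once for
  vanishing variation. Both properties survive finite unions by subadditivity.\<close>

lemma compactin_open_cover_property:
  assumes C: "compactin X C" and loc: "\<And>x. x \<in> C \<Longrightarrow> \<exists>U. openin X U \<and> x \<in> U \<and> P U"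
    and P: "P {}" "\<And>U V. openin X U \<Longrightarrow> openin X V \<Longrightarrow> P U \<Longrightarrow> P V \<Longrightarrow> P (U \<union> V)"
  obtains W where "openin X W" "C \<subseteq> W" "P W"
proof -
  let ?\<U> = "{U. openin X U \<and> P U}"
  have "\<And>U. U \<in> ?\<U> \<Longrightarrow> openin X U" "C \<subseteq> \<Union>?\<U>" using loc by blast+
  then obtain \<F> where \<F>: "finite \<F>" "\<F> \<subseteq> ?\<U>" "C \<subseteq> \<Union>\<F>"
    using C unfolding compactin_def by meson
  have "openin X (\<Union>\<F>) \<and> P (\<Union>\<F>)"
    using \<F>(1,2) by (induction) (auto simp: P)
  with \<F>(3) that show thesis by blast
qed

text \<open>Points have finite variation and hence, by outer regularity, open neighbourhoods of finite
  variation; inner regularity leaves only a compact set to be covered.\<close>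

lemma total_variation_finite:
  assumes \<mu>: "\<mu> \<in> regular_measures X" and X: "Hausdorff_space X"
  shows "total_variation X \<mu> (topspace X) < \<infinity>"
proof -
  note ca = regular_measures_ca[OF \<mu>]
  have point: "\<exists>U. openin X U \<and> x \<in> U \<and> total_variation X \<mu> U < \<infinity>" if x: "x \<in> topspace X" for x
  proof -
    have xb: "{x} \<in> borel_sets X"
      using x X by (simp add: borel_sets_compactin)
    then obtain C U where CU: "compactin X C" "openin X U" "C \<subseteq> {x}" "{x} \<subseteq> U"
       "total_variation X \<mu> (U - C) < ennreal 1"
      using regular_measures_regular[OF \<mu>, of "{x}" 1] by auto
    have Ub: "U \<in> borel_sets X" "C \<in> borel_sets X" using CU X by (auto intro: borel_sets_openin borel_sets_compactin)
    have "total_variation X \<mu> {x} \<le> ennreal (cmod (\<mu> {x}))"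
    proof (rule total_variation_least)
      fix A :: "nat \<Rightarrow> 'a set" assume A: "range A \<subseteq> borel_sets X" "disjoint_family A" "(\<Union>i. A i) = {x}"
      then obtain k where k: "x \<in> A k" by auto
      have "A i \<subseteq> {x}" for i using A(3) by auto
      moreover have "x \<notin> A i" if "i \<noteq> k" for i
        using disjoint_family_onD[OF A(2), of i k] k that by auto
      ultimately have "A i = (if i = k then {x} else {})" for i
        using k by (cases "i = k") (simp, blast, simp, blast)
      then have "(\<Sum>i. ennreal (cmod (\<mu> (A i)))) = (\<Sum>i. if i = k then ennreal (cmod (\<mu> {x})) else 0)"
        by (intro suminf_cong) (simp add: countably_additive_empty[OF ca])
      also have "\<dots> = ennreal (cmod (\<mu> {x}))" by (subst suminf_finite[of "{k}"]) auto
      finally show "(\<Sum>i. ennreal (cmod (\<mu> (A i)))) \<le> ennreal (cmod (\<mu> {x}))" by simp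
    qed
    moreover have "total_variation X \<mu> U \<le> total_variation X \<mu> (U - C) + total_variation X \<mu> {x}"
    proof -
      \<comment> \<open>C is either empty or {x}; in both cases U - C together with {x} covers
        U.\<close>
      have "total_variation X \<mu> U \<le> total_variation X \<mu> (U - C \<union> {x})"
        using CU Ub xb by (intro total_variation_mono borel_sets_intros) auto
      also have "\<dots> \<le> total_variation X \<mu> (U - C) + total_variation X \<mu> {x}"
        using Ub xb by (intro total_variation_Un[OF ca] borel_sets_intros)
      finally show ?thesis .
    qed
    ultimately have "total_variation X \<mu> U < \<infinity>"
    proof -
      have "total_variation X \<mu> {x} < \<infinity>" "total_variation X \<mu> (U - C) < \<infinity>"
        using \<open>total_variation X \<mu> {x} \<le> _\<close> CU(5) by (auto intro: le_less_trans less_trans)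
      with \<open>total_variation X \<mu> U \<le> _\<close> show ?thesis
        by (auto intro: le_less_trans)
    qed
    with CU show ?thesis by auto
  qed
  obtain C V where C: "compactin X C" "C \<subseteq> topspace X" "openin X V" "topspace X \<subseteq> V"
     "total_variation X \<mu> (V - C) < ennreal 1"
    using regular_measures_regular[OF \<mu>, of "topspace X" 1] by auto
  have V: "V = topspace X" using C openin_subset by blast
  obtain W where W: "openin X W" "C \<subseteq> W" "total_variation X \<mu> W < \<infinity>"
  proof (rule compactin_open_cover_property[OF C(1), where P = "\<lambda>U. total_variation X \<mu> U < \<infinity>"])
    show "\<exists>U. openin X U \<and> x \<in> U \<and> total_variation X \<mu> U < \<infinity>" if "x \<in> C" for x
      using point C(2) that by blast
    show "total_variation X \<mu> (U \<union> V) < \<infinity>"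
      if "openin X U" "openin X V" "total_variation X \<mu> U < \<infinity>" "total_variation X \<mu> V < \<infinity>" for U V
      using total_variation_Un[OF ca borel_sets_openin[OF that(1)] borel_sets_openin[OF that(2)]] that
      by (auto intro: le_less_trans)
  qed (simp_all add: total_variation_empty[OF ca] that)
  have Cb: "C \<in> borel_sets X" using C X by (auto intro: borel_sets_compactin)
  have Wb: "W \<in> borel_sets X" by (rule borel_sets_openin[OF W(1)])
  have "total_variation X \<mu> (topspace X) \<le> total_variation X \<mu> ((V - C) \<union> W)"
    using W V Cb Wb by (intro total_variation_mono) (auto intro!: borel_sets_intros)
  also have "\<dots> \<le> total_variation X \<mu> (V - C) + total_variation X \<mu> W"
    using V Cb Wb by (intro total_variation_Un[OF ca]) (auto intro!: borel_sets_intros)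
  also have "\<dots> < \<infinity>"
    using C(5) W(3) by (auto intro: less_trans)
  finally show ?thesis .
qed

section \<open>Jordan decomposition\<close>

text \<open>\<open>cintegral\<close> involves four positive parts. Since Re (-\<i> z) = Im z, all of
  them are \<open>re_pos\<close> of a multiple of \<mu> by 1, -1, -\<i> or \<i>, so one construction
  is enough.\<close>

definition re_pos :: "'a topology \<Rightarrow> ('a set \<Rightarrow> complex) \<Rightarrow> 'a measure" where
  "re_pos X \<mu> = pos_part X (\<lambda>E. Re (\<mu> E))"

lemma space_re_pos [simp]: "space (re_pos X \<mu>) = topspace X"
  and sets_re_pos [simp]: "sets (re_pos X \<mu>) = borel_sets X"
proof -
  have "borel_sets X \<subseteq> Pow (topspace X)" using borel_sets_subset by blast
  then show "space (re_pos X \<mu>) = topspace X" "sets (re_pos X \<mu>) = borel_sets X"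
    unfolding re_pos_def pos_part_def
    by (simp_all add: space_measure_of sets_measure_of
        sigma_algebra.sigma_sets_eq[OF sigma_algebra_borel_sets])
qed

text \<open>Negative terms are truncated to 0 by \<open>ennreal\<close>, which can only raise the
  sum on the right.\<close>

lemma ennreal_le_suminf:
  assumes "a sums s"
  shows "ennreal s \<le> (\<Sum>i. ennreal (a i))"
proof (rule LIMSEQ_le_const2)
  show "(\<lambda>n. ennreal (\<Sum>i<n. a i)) \<longlonglongrightarrow> ennreal s"
    using assms by (auto simp: sums_def)
  have "ennreal (\<Sum>i<n. a i) \<le> (\<Sum>i. ennreal (a i))" for n
  proof -
    have "ennreal (\<Sum>i<n. a i) \<le> ennreal (\<Sum>i<n. max 0 (a i))"
      by (intro ennreal_leI sum_mono) auto
    also have "\<dots> = (\<Sum>i<n. ennreal (max 0 (a i)))" by (rule sum_ennreal[symmetric]) auto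
    also have "\<dots> = (\<Sum>i<n. ennreal (a i))" by (simp add: ennreal_max_0)
    also have "\<dots> \<le> (\<Sum>i. ennreal (a i))" by (rule sum_le_suminf) auto
    finally show ?thesis .
  qed
  then show "\<exists>N. \<forall>n\<ge>N. ennreal (\<Sum>i<n. a i) \<le> (\<Sum>i. ennreal (a i))" by blast
qed

text \<open>\<open>measure_of\<close> returns the null measure unless the given set function is
  countably additive, so this has to be proved for the supremum. One inequality joins subsets of
  disjoint sets, the other cuts a single subset along the partition.\<close>

lemma emeasure_re_pos:
  assumes \<mu>: "countably_additive_on X \<mu>" and E: "E \<in> borel_sets X"
  shows "emeasure (re_pos X \<mu>) E = (SUP F \<in> {F \<in> borel_sets X. F \<subseteq> E}. ennreal (Re (\<mu> F)))"
proof -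
  let ?l = "\<lambda>E. SUP F \<in> {F \<in> borel_sets X. F \<subseteq> E}. ennreal (Re (\<mu> F))"
  have upper: "ennreal (Re (\<mu> F)) \<le> ?l E" if "F \<in> borel_sets X" "F \<subseteq> E" for E F
    by (rule SUP_upper) (use that in auto)
  have mono: "?l E \<le> ?l F" if "E \<subseteq> F" for E F
    by (rule SUP_subset_mono) (use that in auto)
  have superadd: "?l E + ?l F \<le> ?l (E \<union> F)" if EF: "E \<inter> F = {}" for E F
  proof -
    have "ennreal (Re (\<mu> A)) + ennreal (Re (\<mu> B)) \<le> ?l (E \<union> F)"
      if A: "A \<in> borel_sets X" "A \<subseteq> E" and B: "B \<in> borel_sets X" "B \<subseteq> F" for A B
    proof (cases "0 \<le> Re (\<mu> A) \<and> 0 \<le> Re (\<mu> B)")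
      case True
      then have "ennreal (Re (\<mu> A)) + ennreal (Re (\<mu> B)) = ennreal (Re (\<mu> (A \<union> B)))"
      proof -
        have "A \<inter> B = {}" using A B EF by blast
        then show ?thesis
          using countably_additive_Un[OF \<mu> A(1) B(1)] True by (simp flip: ennreal_plus)
      qed
      also have "\<dots> \<le> ?l (E \<union> F)" using A B by (intro upper borel_sets_Un) auto
      finally show ?thesis .
    next
      \<comment> \<open>A negative value counts as 0, and the other set alone gives the
        bound.\<close>
      case False
      moreover have "ennreal (Re (\<mu> A)) \<le> ?l (E \<union> F)" "ennreal (Re (\<mu> B)) \<le> ?l (E \<union> F)"
        using A B by (auto intro!: upper)
      ultimately show ?thesis by (auto simp: ennreal_neg)
    qed
    then have le: "(SUP A \<in> {A \<in> borel_sets X. A \<subseteq> E}. SUP B \<in> {B \<in> borel_sets X. B \<subseteq> F}.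
        ennreal (Re (\<mu> A)) + ennreal (Re (\<mu> B))) \<le> ?l (E \<union> F)"
      by (intro SUP_least) blast
    have ne: "{A \<in> borel_sets X. A \<subseteq> G} \<noteq> {}" for G using borel_sets_empty by blast
    have sum: "(SUP A \<in> {A \<in> borel_sets X. A \<subseteq> E}. SUP B \<in> {B \<in> borel_sets X. B \<subseteq> F}.
        ennreal (Re (\<mu> A)) + ennreal (Re (\<mu> B))) = ?l E + ?l F"
    proof -
      have "(SUP A \<in> {A \<in> borel_sets X. A \<subseteq> E}. SUP B \<in> {B \<in> borel_sets X. B \<subseteq> F}.
          ennreal (Re (\<mu> A)) + ennreal (Re (\<mu> B))) =
        (SUP A \<in> {A \<in> borel_sets X. A \<subseteq> E}. ennreal (Re (\<mu> A)) + ?l F)"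
        by (intro SUP_cong refl ennreal_SUP_add_right[symmetric] ne)
      also have "\<dots> = ?l E + ?l F" by (rule ennreal_SUP_add_left[OF ne])
      finally show ?thesis .
    qed
    show ?thesis using le unfolding sum .
  qed
  show ?thesis
    unfolding re_pos_def pos_part_def
  proof (rule emeasure_measure_of_sigma)
    show "sigma_algebra (topspace X) (borel_sets X)" by (rule sigma_algebra_borel_sets)
    show "E \<in> borel_sets X" by fact
    have "?l {} = 0" by (simp add: countably_additive_empty[OF \<mu>])
    then show "positive (borel_sets X) ?l" by (simp add: positive_def)
    show "countably_additive (borel_sets X) ?l"
    proof (rule countably_additiveI)
      fix A :: "nat \<Rightarrow> 'a set"
      assume A: "range A \<subseteq> borel_sets X" "disjoint_family A" "\<Union>(range A) \<in> borel_sets X"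
      show "(\<Sum>i. ?l (A i)) = ?l (\<Union>(range A))"
      proof (rule antisym)
        have "(\<Sum>i<n. ?l (A i)) \<le> ?l (\<Union>i<n. A i)" for n
        proof (induction n)
          case (Suc n)
          have "(\<Sum>i<Suc n. ?l (A i)) \<le> ?l (\<Union>i<n. A i) + ?l (A n)"
            using Suc by (simp add: add_right_mono)
          also have "\<dots> \<le> ?l ((\<Union>i<n. A i) \<union> A n)"
          proof (rule superadd)
            have "A i \<inter> A n = {}" if "i < n" for i
              using disjoint_family_onD[OF A(2), of i n] that by auto
            then show "(\<Union>i<n. A i) \<inter> A n = {}" by blast
          qed
          also have "\<dots> = ?l (\<Union>i<Suc n. A i)" by (simp add: lessThan_Suc Un_commute)
          finally show ?case .
        qed simp
        also have "?l (\<Union>i<n. A i) \<le> ?l (\<Union>(range A))" for n by (rule mono) auto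
        finally show "(\<Sum>i. ?l (A i)) \<le> ?l (\<Union>(range A))"
          by (intro suminf_le_const) auto
        show "?l (\<Union>(range A)) \<le> (\<Sum>i. ?l (A i))"
        proof (rule SUP_least, clarify)
          fix F assume F: "F \<in> borel_sets X" "F \<subseteq> \<Union>(range A)"
          have "(\<lambda>i. \<mu> (F \<inter> A i)) sums \<mu> (\<Union>i. F \<inter> A i)"
            using \<mu> A F unfolding countably_additive_on_def
            by (elim allE[of _ "\<lambda>i. F \<inter> A i"]) (auto simp: disjoint_family_on_def borel_sets_Int range_subsetD)
          moreover have "(\<Union>i. F \<inter> A i) = F" using F by auto
          ultimately have "(\<lambda>i. Re (\<mu> (F \<inter> A i))) sums Re (\<mu> F)" by (simp add: sums_Re)
          then have "ennreal (Re (\<mu> F)) \<le> (\<Sum>i. ennreal (Re (\<mu> (F \<inter> A i))))"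
            by (rule ennreal_le_suminf)
          also have "\<dots> \<le> (\<Sum>i. ?l (A i))"
            using A F by (intro suminf_le upper) (auto simp: borel_sets_Int range_subsetD)
          finally show "ennreal (Re (\<mu> F)) \<le> (\<Sum>i. ?l (A i))" .
        qed
      qed
    qed
  qed
qed

lemma emeasure_re_pos_le:
  assumes "countably_additive_on X \<mu>" "E \<in> borel_sets X"
  shows "emeasure (re_pos X \<mu>) E \<le> total_variation X \<mu> E"
  unfolding emeasure_re_pos[OF assms]
proof (rule SUP_least, clarify)
  fix F assume F: "F \<in> borel_sets X" "F \<subseteq> E"
  have "ennreal (Re (\<mu> F)) \<le> ennreal (cmod (\<mu> F))" by (intro ennreal_leI complex_Re_le_cmod)
  also have "\<dots> \<le> total_variation X \<mu> F" by (rule cmod_le_total_variation[OF F(1)])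
  also have "\<dots> \<le> total_variation X \<mu> E" by (rule total_variation_mono[OF F(1) assms(2) F(2)])
  finally show "ennreal (Re (\<mu> F)) \<le> total_variation X \<mu> E" .
qed

section \<open>Linear structure of M(X) and its positive cone\<close>

lemma countably_additive_scale:
  "countably_additive_on X \<mu> \<Longrightarrow> countably_additive_on X (\<lambda>s. c * \<mu> s)"
  unfolding countably_additive_on_def by (simp add: sums_mult)

lemma countably_additive_add:
  "countably_additive_on X \<mu> \<Longrightarrow> countably_additive_on X \<nu> \<Longrightarrow> countably_additive_on X (\<lambda>s. \<mu> s + \<nu> s)"
  unfolding countably_additive_on_def by (simp add: sums_add)

lemma regular_measures_zero [simp]: "(\<lambda>_. 0) \<in> regular_measures X"
  unfolding regular_measures_iff countably_additive_on_def
proof (intro conjI allI impI ballI)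
  fix E e assume E: "E \<in> borel_sets X" and "0 < (e::real)"
  have "total_variation X (\<lambda>_. 0) (topspace X - {}) \<le> 0" by (rule total_variation_least) simp
  with \<open>0 < e\<close> have "total_variation X (\<lambda>_. 0) (topspace X - {}) < ennreal e"
    by (metis ennreal_0 ennreal_lessI le_zero_eq)
  then show "\<exists>C U. compactin X C \<and> openin X U \<and> C \<subseteq> E \<and> E \<subseteq> U \<and> total_variation X (\<lambda>_. 0) (U - C) < ennreal e"
    using borel_sets_subset[OF E] by (intro exI[of _ "{}"] exI[of _ "topspace X"]) auto
qed auto

lemma regular_measures_scale:
  assumes \<mu>: "\<mu> \<in> regular_measures X"
  shows "(\<lambda>s. c * \<mu> s) \<in> regular_measures X"
  unfolding regular_measures_iff
proof (intro conjI allI impI ballI)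
  show "countably_additive_on X (\<lambda>s. c * \<mu> s)"
    by (rule countably_additive_scale[OF regular_measures_ca[OF \<mu>]])
  fix E e assume E: "E \<in> borel_sets X" and e: "0 < (e::real)"
  \<comment> \<open>The added 1 allows c = 0 and makes the resulting inequality strict.\<close>
  then obtain C U where CU: "compactin X C" "openin X U" "C \<subseteq> E" "E \<subseteq> U"
     "total_variation X \<mu> (U - C) < ennreal (e / (cmod c + 1))"
    using regular_measures_regular[OF \<mu> E, of "e / (cmod c + 1)"] by (auto simp: add_nonneg_pos)
  have "total_variation X (\<lambda>s. c * \<mu> s) (U - C) \<le> ennreal (cmod c) * total_variation X \<mu> (U - C)"
    by (rule total_variation_scale)
  also have "\<dots> \<le> ennreal (cmod c) * ennreal (e / (cmod c + 1))"
    using CU by (intro mult_left_mono) auto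
  also have "\<dots> = ennreal (cmod c * (e / (cmod c + 1)))" using e
    by (intro ennreal_mult[symmetric]) auto
  also have "\<dots> < ennreal e"
  proof (rule ennreal_lessI[OF e])
    have "0 < cmod c + 1" by (simp add: add_nonneg_pos)
    then show "cmod c * (e / (cmod c + 1)) < e" using e by (simp add: field_simps)
  qed
  finally show "\<exists>C U. compactin X C \<and> openin X U \<and> C \<subseteq> E \<and> E \<subseteq> U \<and>
      total_variation X (\<lambda>s. c * \<mu> s) (U - C) < ennreal e"
    using CU by blast
qed (simp add: regular_measures_off[OF \<mu>])

lemma regular_measures_add:
  assumes \<mu>: "\<mu> \<in> regular_measures X" and \<nu>: "\<nu> \<in> regular_measures X" and X: "Hausdorff_space X"
  shows "(\<lambda>s. \<mu> s + \<nu> s) \<in> regular_measures X"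
  unfolding regular_measures_iff
proof (intro conjI allI impI ballI)
  show "countably_additive_on X (\<lambda>s. \<mu> s + \<nu> s)"
    by (intro countably_additive_add regular_measures_ca \<mu> \<nu>)
  fix E e assume E: "E \<in> borel_sets X" and e: "0 < (e::real)"
  obtain C U where CU: "compactin X C" "openin X U" "C \<subseteq> E" "E \<subseteq> U"
     "total_variation X \<mu> (U - C) < ennreal (e / 2)"
    using regular_measures_regular[OF \<mu> E, of "e / 2"] e by auto
  obtain D V where DV: "compactin X D" "openin X V" "D \<subseteq> E" "E \<subseteq> V"
     "total_variation X \<nu> (V - D) < ennreal (e / 2)"
    using regular_measures_regular[OF \<nu> E, of "e / 2"] e by auto
  let ?W = "(U \<inter> V) - (C \<union> D)"
  have b: "C \<in> borel_sets X" "D \<in> borel_sets X" "U \<in> borel_sets X" "V \<in> borel_sets X"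
    using CU DV X by (auto intro: borel_sets_compactin borel_sets_openin)
  have "total_variation X (\<lambda>s. \<mu> s + \<nu> s) ?W \<le> total_variation X \<mu> ?W + total_variation X \<nu> ?W"
    by (rule total_variation_add)
  also have "\<dots> \<le> total_variation X \<mu> (U - C) + total_variation X \<nu> (V - D)"
    by (intro add_mono total_variation_mono borel_sets_intros b) auto
  also have "\<dots> < ennreal (e / 2) + ennreal (e / 2)"
    using CU DV by (intro add_strict_mono)
  also have "\<dots> = ennreal e" using e by (subst ennreal_plus[symmetric]) auto
  finally show "\<exists>C U. compactin X C \<and> openin X U \<and> C \<subseteq> E \<and> E \<subseteq> U \<and>
      total_variation X (\<lambda>s. \<mu> s + \<nu> s) (U - C) < ennreal e"
    using CU DV by (intro exI[of _ "C \<union> D"] exI[of _ "U \<inter> V"]) (auto intro: compactin_Un)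
qed (simp add: regular_measures_off[OF \<mu>] regular_measures_off[OF \<nu>])

lemma pos_measures_regular: "\<mu> \<in> pos_measures X \<Longrightarrow> \<mu> \<in> regular_measures X"
  by (simp add: pos_measures_def)

lemma pos_measures_nonneg: "\<mu> \<in> pos_measures X \<Longrightarrow> 0 \<le> \<mu> E"
  by (cases "E \<in> borel_sets X") (auto simp: pos_measures_def regular_measures_off)

lemma pos_measures_of_real:
  "\<mu> \<in> pos_measures X \<Longrightarrow> \<mu> E = complex_of_real (Re (\<mu> E))"
  using pos_measures_nonneg[of \<mu> X E] by (simp add: complex_eq_iff less_eq_complex_def)

lemma pos_measures_Re_nonneg: "\<mu> \<in> pos_measures X \<Longrightarrow> 0 \<le> Re (\<mu> E)"
  using pos_measures_nonneg[of \<mu> X E] by (simp add: less_eq_complex_def)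

lemma pos_measures_mono:
  assumes "\<mu> \<in> pos_measures X" "E \<in> borel_sets X" "F \<in> borel_sets X" "E \<subseteq> F"
  shows "Re (\<mu> E) \<le> Re (\<mu> F)"
  using countably_additive_Diff[OF regular_measures_ca[OF pos_measures_regular[OF assms(1)]] assms(3,2,4)]
    pos_measures_Re_nonneg[OF assms(1), of "F - E"] by simp

lemma pos_measures_zero [simp]: "(\<lambda>_. 0) \<in> pos_measures X"
  by (simp add: pos_measures_def)

lemma pos_measures_add:
  "\<mu> \<in> pos_measures X \<Longrightarrow> \<nu> \<in> pos_measures X \<Longrightarrow> Hausdorff_space X \<Longrightarrow> (\<lambda>s. \<mu> s + \<nu> s) \<in> pos_measures X"
  by (auto simp: pos_measures_def regular_measures_add)

lemma pos_measures_scale: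
  "\<mu> \<in> pos_measures X \<Longrightarrow> 0 \<le> c \<Longrightarrow> (\<lambda>s. c * \<mu> s) \<in> pos_measures X"
  by (auto simp: pos_measures_def regular_measures_scale)

lemma total_variation_pos:
  assumes \<mu>: "\<mu> \<in> pos_measures X"
  shows "total_variation X \<mu> E \<le> ennreal (Re (\<mu> E))"
proof (rule total_variation_least)
  fix A :: "nat \<Rightarrow> 'a set" assume A: "range A \<subseteq> borel_sets X" "disjoint_family A" "(\<Union>i. A i) = E"
  have "(\<lambda>i. Re (\<mu> (A i))) sums Re (\<mu> E)"
    using regular_measures_sums[OF pos_measures_regular[OF \<mu>] A(1,2)] A(3) by (simp add: sums_Re)
  moreover have "cmod (\<mu> (A i)) = Re (\<mu> (A i))" for i
    by (subst pos_measures_of_real[OF \<mu>]) (simp add: pos_measures_Re_nonneg[OF \<mu>])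
  ultimately have "(\<Sum>i. ennreal (cmod (\<mu> (A i)))) = ennreal (Re (\<mu> E))"
    by (simp only: suminf_ennreal_eq[OF pos_measures_Re_nonneg[OF \<mu>]])
  then show "(\<Sum>i. ennreal (cmod (\<mu> (A i)))) \<le> ennreal (Re (\<mu> E))" by (rule eq_refl)
qed

lemma measure_re_pos_pos:
  assumes \<mu>: "\<mu> \<in> pos_measures X" and E: "E \<in> borel_sets X"
  shows "emeasure (re_pos X \<mu>) E = ennreal (Re (\<mu> E))"
    and "emeasure (re_pos X (\<lambda>s. - \<mu> s)) E = 0"
proof -
  have ca: "countably_additive_on X \<mu>" "countably_additive_on X (\<lambda>s. - \<mu> s)"
    using regular_measures_ca[OF pos_measures_regular[OF \<mu>]] countably_additive_scale[of X \<mu> "-1"] by auto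
  show "emeasure (re_pos X \<mu>) E = ennreal (Re (\<mu> E))"
    unfolding emeasure_re_pos[OF ca(1) E]
  proof (rule antisym)
    show "(SUP F\<in>{F \<in> borel_sets X. F \<subseteq> E}. ennreal (Re (\<mu> F))) \<le> ennreal (Re (\<mu> E))"
      using E pos_measures_mono[OF \<mu>] by (auto intro!: SUP_least ennreal_leI)
    show "ennreal (Re (\<mu> E)) \<le> (SUP F\<in>{F \<in> borel_sets X. F \<subseteq> E}. ennreal (Re (\<mu> F)))"
      by (rule SUP_upper) (use E in auto)
  qed
  show "emeasure (re_pos X (\<lambda>s. - \<mu> s)) E = 0"
    unfolding emeasure_re_pos[OF ca(2) E]
    using pos_measures_Re_nonneg[OF \<mu>] by (auto simp: ennreal_neg intro!: antisym SUP_least)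
qed

text \<open>Only one of the four parts of the Jordan decomposition, the positive part of Re \<mu>,
  turned from an abstract \<open>measure\<close> into an element of M(X). The other three come from
  the multiples of \<mu> by -1, -\<i> and \<i>.\<close>

definition jordan :: "'a topology \<Rightarrow> ('a set \<Rightarrow> complex) \<Rightarrow> 'a set \<Rightarrow> complex" where
  "jordan X \<mu> = (\<lambda>E. if E \<in> borel_sets X then complex_of_real (measure (re_pos X \<mu>) E) else 0)"

lemma tv_norm_nonneg: "0 \<le> tv_norm X \<mu>"
  by (simp add: tv_norm_def)

lemma tv_norm_scale_unit:
  assumes "Hausdorff_space X" "\<mu> \<in> regular_measures X" "cmod c = 1"
  shows "tv_norm X (\<lambda>s. c * \<mu> s) \<le> tv_norm X \<mu>"
  using total_variation_scale[of X c \<mu> "topspace X"] assms(3) total_variation_finite[OF assms(2,1)]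
  by (simp add: tv_norm_def enn2real_mono)

lemma tv_norm_zero: "tv_norm X (\<lambda>_. 0) = 0"
proof -
  have "total_variation X (\<lambda>_. 0) (topspace X) \<le> 0" by (rule total_variation_least) simp
  then show ?thesis by (simp add: tv_norm_def)
qed

context
  fixes X :: "'a topology" and \<mu> :: "'a set \<Rightarrow> complex"
  assumes X: "Hausdorff_space X" and \<mu>: "\<mu> \<in> regular_measures X"
begin

lemma total_variation_eq_tv_norm: "total_variation X \<mu> (topspace X) = ennreal (tv_norm X \<mu>)"
  unfolding tv_norm_def using total_variation_finite[OF \<mu> X] by simp

lemma finite_measure_re_pos: "finite_measure (re_pos X \<mu>)"
  using emeasure_re_pos_le[OF regular_measures_ca[OF \<mu>], of "topspace X"] total_variation_finite[OF \<mu> X]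
  by (intro finite_measureI) (auto simp: top_unique)

lemma measure_re_pos_le: "measure (re_pos X \<mu>) (topspace X) \<le> tv_norm X \<mu>"
proof -
  interpret finite_measure "re_pos X \<mu>" by (rule finite_measure_re_pos)
  show ?thesis
    using emeasure_re_pos_le[OF regular_measures_ca[OF \<mu>], of "topspace X"]
    by (simp add: total_variation_eq_tv_norm emeasure_eq_measure ennreal_le_iff tv_norm_nonneg)
qed

lemma cmod_le_tv_norm: "cmod (\<mu> (topspace X)) \<le> tv_norm X \<mu>"
  using cmod_le_total_variation[of "topspace X" X \<mu>]
  by (simp add: total_variation_eq_tv_norm ennreal_le_iff tv_norm_nonneg)

text \<open>Regularity is inherited from \<mu> because the positive part is dominated by the total
  variation.\<close>

lemma jordan_pos: "jordan X \<mu> \<in> pos_measures X"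
proof -
  interpret finite_measure "re_pos X \<mu>" by (rule finite_measure_re_pos)
  have ca: "countably_additive_on X (jordan X \<mu>)"
    unfolding countably_additive_on_def
  proof (intro allI impI)
    fix A :: "nat \<Rightarrow> 'a set" assume A: "range A \<subseteq> borel_sets X" "disjoint_family A"
    have "(\<lambda>i. measure (re_pos X \<mu>) (A i)) sums measure (re_pos X \<mu>) (\<Union>i. A i)"
      using A by (intro finite_measure_UNION) auto
    then show "(\<lambda>i. jordan X \<mu> (A i)) sums jordan X \<mu> (\<Union>i. A i)"
      using A borel_sets_UN[OF A(1)] by (simp add: jordan_def range_subsetD sums_of_real_iff)
  qed
  have "jordan X \<mu> \<in> regular_measures X"
    unfolding regular_measures_iff
  proof (intro conjI ca allI impI ballI)
    fix E e assume E: "E \<in> borel_sets X" and e: "0 < (e::real)"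
    obtain C U where CU: "compactin X C" "openin X U" "C \<subseteq> E" "E \<subseteq> U"
      "total_variation X \<mu> (U - C) < ennreal e"
      using regular_measures_regular[OF \<mu> E e] by auto
    have b: "U - C \<in> borel_sets X"
      by (intro borel_sets_Diff borel_sets_compactin borel_sets_openin CU X)
    have "total_variation X (jordan X \<mu>) (U - C) \<le> emeasure (re_pos X \<mu>) (U - C)"
    proof (rule total_variation_least)
      fix A :: "nat \<Rightarrow> 'a set" assume A: "range A \<subseteq> borel_sets X" "disjoint_family A" "(\<Union>i. A i) = U - C"
      have "(\<Sum>i. ennreal (cmod (jordan X \<mu> (A i)))) = (\<Sum>i. emeasure (re_pos X \<mu>) (A i))"
        using A by (simp add: jordan_def range_subsetD emeasure_eq_measure)
      also have "\<dots> = emeasure (re_pos X \<mu>) (U - C)"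
        using A by (subst suminf_emeasure) auto
      finally show "(\<Sum>i. ennreal (cmod (jordan X \<mu> (A i)))) \<le> emeasure (re_pos X \<mu>) (U - C)" by simp
    qed
    also have "\<dots> \<le> total_variation X \<mu> (U - C)"
      by (rule emeasure_re_pos_le[OF regular_measures_ca[OF \<mu>] b])
    finally show "\<exists>C U. compactin X C \<and> openin X U \<and> C \<subseteq> E \<and> E \<subseteq> U \<and>
        total_variation X (jordan X \<mu>) (U - C) < ennreal e"
      using CU by (meson le_less_trans)
  qed (simp add: jordan_def)
  moreover have "0 \<le> jordan X \<mu> E" for E by (simp add: jordan_def less_eq_complex_def)
  ultimately show ?thesis by (simp add: pos_measures_def)
qed

lemma jordan_le: "Re (jordan X \<mu> (topspace X)) \<le> tv_norm X \<mu>"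
  using measure_re_pos_le by (simp add: jordan_def)

end

lemma regular_measures_uminus: "\<mu> \<in> regular_measures X \<Longrightarrow> (\<lambda>s. - \<mu> s) \<in> regular_measures X"
  using regular_measures_scale[of \<mu> X "-1"] by simp

text \<open>Complements inside E take the place of a Hahn decomposition: for F \<subseteq> E, Re
  (\<mu> F) is Re (\<mu> E) - Re (\<mu> (E - F)), which is at most Re (\<mu> E) plus the negative
  part of E. The supremum over F gives one inequality, and the same argument for the negative of
  \<mu> gives the other.\<close>

lemma measure_re_pos_diff:
  assumes X: "Hausdorff_space X" and \<mu>: "\<mu> \<in> regular_measures X" and E: "E \<in> borel_sets X"
  shows "Re (\<mu> E) = measure (re_pos X \<mu>) E - measure (re_pos X (\<lambda>s. - \<mu> s)) E"
proof -
  have le: "Re (\<mu> E) \<ge> measure (re_pos X \<mu>) E - measure (re_pos X (\<lambda>s. - \<mu> s)) E"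
    if \<mu>: "\<mu> \<in> regular_measures X" for \<mu>
  proof -
    note \<mu>' = regular_measures_uminus[OF \<mu>]
    interpret p: finite_measure "re_pos X \<mu>" by (rule finite_measure_re_pos[OF X \<mu>])
    interpret n: finite_measure "re_pos X (\<lambda>s. - \<mu> s)" by (rule finite_measure_re_pos[OF X \<mu>'])
    have sup: "- Re (\<mu> F) \<le> measure (re_pos X (\<lambda>s. - \<mu> s)) E" if "F \<in> borel_sets X" "F \<subseteq> E" for F
    proof -
      have "ennreal (- Re (\<mu> F)) \<le> emeasure (re_pos X (\<lambda>s. - \<mu> s)) E"
        unfolding emeasure_re_pos[OF regular_measures_ca[OF \<mu>'] E]
        by (rule SUP_upper2[of F]) (use that in auto)
      then show ?thesis by (simp add: n.emeasure_eq_measure)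
    qed
    have "0 \<le> Re (\<mu> E) + measure (re_pos X (\<lambda>s. - \<mu> s)) E" using sup[of E] E by simp
    moreover have "emeasure (re_pos X \<mu>) E \<le> ennreal (Re (\<mu> E) + measure (re_pos X (\<lambda>s. - \<mu> s)) E)"
      unfolding emeasure_re_pos[OF regular_measures_ca[OF \<mu>] E]
    proof (rule SUP_least, clarify, rule ennreal_leI)
      fix F assume F: "F \<in> borel_sets X" "F \<subseteq> E"
      have "\<mu> (E - F) = \<mu> E - \<mu> F"
        using countably_additive_Diff[OF regular_measures_ca[OF \<mu>] E F(1) F(2)] .
      with sup[of "E - F"] E F show "Re (\<mu> F) \<le> Re (\<mu> E) + measure (re_pos X (\<lambda>s. - \<mu> s)) E"
        by (auto simp: borel_sets_Diff)
    qed
    ultimately show ?thesis by (simp add: p.emeasure_eq_measure)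
  qed
  show ?thesis using le[OF \<mu>] le[OF regular_measures_uminus[OF \<mu>]] by simp
qed

text \<open>Differences are written with the factor -1 so that the rules for sums and multiples of
  \<open>clinear_on\<close> rewrite the right-hand side directly.\<close>

lemma jordan_decomposition:
  assumes X: "Hausdorff_space X" and \<mu>: "\<mu> \<in> regular_measures X"
  shows "\<mu> E = (jordan X \<mu> E + (-1) * jordan X (\<lambda>s. (-1) * \<mu> s) E) +
    \<i> * (jordan X (\<lambda>s. - \<i> * \<mu> s) E + (-1) * jordan X (\<lambda>s. \<i> * \<mu> s) E)"
proof (cases "E \<in> borel_sets X")
  case True
  have "Re (\<mu> E) = measure (re_pos X \<mu>) E - measure (re_pos X (\<lambda>s. - \<mu> s)) E"
    by (rule measure_re_pos_diff[OF X \<mu> True])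
  moreover have "Re (- \<i> * \<mu> E) = measure (re_pos X (\<lambda>s. - \<i> * \<mu> s)) E - measure (re_pos X (\<lambda>s. - (- \<i> * \<mu> s))) E"
    by (rule measure_re_pos_diff[OF X regular_measures_scale[OF \<mu>] True])
  ultimately show ?thesis using True by (simp add: jordan_def complex_eq_iff)
qed (simp add: jordan_def regular_measures_off[OF \<mu>])

text \<open>Linearity on a mere set of functions, because M(X) and its dual are not types. It is
  used at both levels: for functionals on M(X) and for functionals on the dual of M(X).\<close>

definition clinear_on :: "('b \<Rightarrow> complex) set \<Rightarrow> (('b \<Rightarrow> complex) \<Rightarrow> complex) \<Rightarrow> bool" where
  "clinear_on V \<phi> \<longleftrightarrow> (\<forall>u \<in> V. \<forall>v \<in> V. \<phi> (\<lambda>s. u s + v s) = \<phi> u + \<phi> v) \<and>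
     (\<forall>c. \<forall>v \<in> V. \<phi> (\<lambda>s. c * v s) = c * \<phi> v)"

lemma clinear_onI:
  assumes "\<And>u v. u \<in> V \<Longrightarrow> v \<in> V \<Longrightarrow> \<phi> (\<lambda>s. u s + v s) = \<phi> u + \<phi> v"
    "\<And>c v. v \<in> V \<Longrightarrow> \<phi> (\<lambda>s. c * v s) = c * \<phi> v"
  shows "clinear_on V \<phi>"
  using assms unfolding clinear_on_def by blast

lemma clinear_on_add: "clinear_on V \<phi> \<Longrightarrow> u \<in> V \<Longrightarrow> v \<in> V \<Longrightarrow> \<phi> (\<lambda>s. u s + v s) = \<phi> u + \<phi> v"
  and clinear_on_scale: "clinear_on V \<phi> \<Longrightarrow> v \<in> V \<Longrightarrow> \<phi> (\<lambda>s. c * v s) = c * \<phi> v"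
  unfolding clinear_on_def by blast+

lemma clinear_on_jordan:
  assumes X: "Hausdorff_space X" and \<phi>: "clinear_on (regular_measures X) \<phi>" and \<mu>: "\<mu> \<in> regular_measures X"
  shows "\<phi> \<mu> = (\<phi> (jordan X \<mu>) - \<phi> (jordan X (\<lambda>s. (-1) * \<mu> s))) +
     \<i> * (\<phi> (jordan X (\<lambda>s. - \<i> * \<mu> s)) - \<phi> (jordan X (\<lambda>s. \<i> * \<mu> s)))"
proof -
  have j: "jordan X (\<lambda>s. c * \<mu> s) \<in> regular_measures X" for c
    by (intro pos_measures_regular jordan_pos X regular_measures_scale \<mu>)
  note j1 = j[of 1, simplified]
  have "\<phi> \<mu> = \<phi> (\<lambda>E. (jordan X \<mu> E + (-1) * jordan X (\<lambda>s. (-1) * \<mu> s) E) +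
    \<i> * (jordan X (\<lambda>s. - \<i> * \<mu> s) E + (-1) * jordan X (\<lambda>s. \<i> * \<mu> s) E))"
    by (rule arg_cong[where f=\<phi>]) (rule ext, rule jordan_decomposition[OF X \<mu>])
  also have "\<dots> = (\<phi> (jordan X \<mu>) + (-1) * \<phi> (jordan X (\<lambda>s. (-1) * \<mu> s))) +
     \<i> * (\<phi> (jordan X (\<lambda>s. - \<i> * \<mu> s)) + (-1) * \<phi> (jordan X (\<lambda>s. \<i> * \<mu> s)))"
    by (simp only: clinear_on_add[OF \<phi>] clinear_on_scale[OF \<phi>] j j1 regular_measures_add regular_measures_scale X)
  finally show ?thesis by simp
qed

text \<open>The transfer principle from the positive cone, where the continuity axioms apply, to all
  of M(X).\<close>

lemma clinear_on_eqI:
  assumes X: "Hausdorff_space X" and \<phi>: "clinear_on (regular_measures X) \<phi>" and \<psi>: "clinear_on (regular_measures X) \<psi>"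
    and eq: "\<And>\<nu>. \<nu> \<in> pos_measures X \<Longrightarrow> \<phi> \<nu> = \<psi> \<nu>" and \<mu>: "\<mu> \<in> regular_measures X"
  shows "\<phi> \<mu> = \<psi> \<mu>"
proof -
  have j: "jordan X (\<lambda>s. c * \<mu> s) \<in> pos_measures X" for c
    by (intro jordan_pos X regular_measures_scale \<mu>)
  note j1 = j[of 1, simplified]
  show ?thesis
    unfolding clinear_on_jordan[OF X \<phi> \<mu>] clinear_on_jordan[OF X \<psi> \<mu>]
    by (simp only: eq j j1)
qed

text \<open>The factor 4 counts the Jordan parts, each of mass at most the norm of \<mu>. Only the
  existence of a bound will matter.\<close>

lemma clinear_on_bound:
  assumes X: "Hausdorff_space X" and \<phi>: "clinear_on (regular_measures X) \<phi>"
    and bd: "\<And>\<nu>. \<nu> \<in> pos_measures X \<Longrightarrow> cmod (\<phi> \<nu>) \<le> B * Re (\<nu> (topspace X))" and \<mu>: "\<mu> \<in> regular_measures X"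
  shows "cmod (\<phi> \<mu>) \<le> 4 * \<bar>B\<bar> * tv_norm X \<mu>"
proof -
  have j: "cmod (\<phi> (jordan X (\<lambda>s. c * \<mu> s))) \<le> \<bar>B\<bar> * tv_norm X \<mu>" if "cmod c = 1" for c
  proof -
    note r = regular_measures_scale[OF \<mu>, of c]
    have "cmod (\<phi> (jordan X (\<lambda>s. c * \<mu> s))) \<le> B * Re (jordan X (\<lambda>s. c * \<mu> s) (topspace X))"
      by (rule bd[OF jordan_pos[OF X r]])
    also have "\<dots> \<le> \<bar>B\<bar> * Re (jordan X (\<lambda>s. c * \<mu> s) (topspace X))"
      by (intro mult_right_mono pos_measures_Re_nonneg[OF jordan_pos[OF X r]]) auto
    also have "\<dots> \<le> \<bar>B\<bar> * tv_norm X \<mu>"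
      using jordan_le[OF X r] tv_norm_scale_unit[OF X \<mu> that] by (intro mult_left_mono) auto
    finally show ?thesis .
  qed
  have "cmod (\<phi> \<mu>) \<le> (cmod (\<phi> (jordan X \<mu>)) + cmod (\<phi> (jordan X (\<lambda>s. (-1) * \<mu> s)))) +
     (cmod (\<phi> (jordan X (\<lambda>s. - \<i> * \<mu> s))) + cmod (\<phi> (jordan X (\<lambda>s. \<i> * \<mu> s))))"
    unfolding clinear_on_jordan[OF X \<phi> \<mu>]
    by (intro order_trans[OF norm_triangle_ineq] add_mono norm_triangle_ineq4)
       (simp add: norm_mult norm_triangle_ineq4)
  also have "\<dots> \<le> 4 * (\<bar>B\<bar> * tv_norm X \<mu>)"
    using j[of 1] j[of "-1"] j[of "-\<i>"] j[of "\<i>"] by simp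
  finally show ?thesis by simp
qed

section \<open>Integration\<close>

lemma norm_integral_le_integral:
  fixes f :: "'a \<Rightarrow> complex" and g :: "'a \<Rightarrow> real"
  assumes "integrable M f" "integrable M g" "\<And>x. x \<in> space M \<Longrightarrow> cmod (f x) \<le> g x"
  shows "cmod (integral\<^sup>L M f) \<le> integral\<^sup>L M g"
proof -
  have "cmod (integral\<^sup>L M f) \<le> (\<integral>x. cmod (f x) \<partial>M)" by (rule integral_norm_bound)
  also have "\<dots> \<le> integral\<^sup>L M g" by (intro integral_mono integrable_norm assms)
  finally show ?thesis .
qed

text \<open>Carries the Borel sigma-algebra alone, so that one notion of measurability serves all
  measures \<open>re_pos X \<mu>\<close>.\<close>

definition borel_space :: "'a topology \<Rightarrow> 'a measure" where
  "borel_space X = sigma (topspace X) (borel_sets X)"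

definition bounded_borel :: "'a topology \<Rightarrow> ('a \<Rightarrow> complex) set" where
  "bounded_borel X = {f \<in> borel_measurable (borel_space X). \<exists>B. \<forall>x \<in> topspace X. cmod (f x) \<le> B}"

lemma space_borel_space [simp]: "space (borel_space X) = topspace X"
  and sets_borel_space [simp]: "sets (borel_space X) = borel_sets X"
proof -
  have "borel_sets X \<subseteq> Pow (topspace X)" using borel_sets_subset by blast
  then show "space (borel_space X) = topspace X" "sets (borel_space X) = borel_sets X"
    unfolding borel_space_def
    by (simp_all add: space_measure_of sets_measure_of
        sigma_algebra.sigma_sets_eq[OF sigma_algebra_borel_sets])
qed

lemma measurable_re_pos [simp]: "borel_measurable (re_pos X \<mu>) = borel_measurable (borel_space X)"
  by (rule measurable_cong_sets) auto

section \<open>Bounded Borel functions\<close>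

lemma bounded_borelD:
  assumes "f \<in> bounded_borel X"
  shows bounded_borel_measurable: "f \<in> borel_measurable (borel_space X)"
    and bounded_borel_bound: "\<exists>B. \<forall>x \<in> topspace X. cmod (f x) \<le> B"
  using assms by (auto simp: bounded_borel_def)

lemma bounded_borelI:
  "f \<in> borel_measurable (borel_space X) \<Longrightarrow> (\<And>x. x \<in> topspace X \<Longrightarrow> cmod (f x) \<le> B) \<Longrightarrow> f \<in> bounded_borel X"
  by (auto simp: bounded_borel_def)

lemma continuous_map_measurable:
  fixes f :: "'a \<Rightarrow> 'b :: topological_space"
  assumes "continuous_map X euclidean f"
  shows "f \<in> borel_measurable (borel_space X)"
proof (rule borel_measurableI)
  fix S :: "'b set" assume "open S"
  then have "openin X {x \<in> topspace X. f x \<in> S}"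
    using assms by (simp add: continuous_map_def)
  moreover have "{x \<in> topspace X. f x \<in> S} = f -` S \<inter> space (borel_space X)" by auto
  ultimately show "f -` S \<inter> space (borel_space X) \<in> sets (borel_space X)"
    by (simp add: borel_sets_openin)
qed

lemma bounded_borel_continuous:
  "continuous_map X euclidean f \<Longrightarrow> (\<And>x. x \<in> topspace X \<Longrightarrow> cmod (f x) \<le> B) \<Longrightarrow> f \<in> bounded_borel X"
  by (intro bounded_borelI continuous_map_measurable)

lemma bounded_borel_add:
  assumes "f \<in> bounded_borel X" "g \<in> bounded_borel X" shows "(\<lambda>x. f x + g x) \<in> bounded_borel X"
proof -
  obtain B C where "\<forall>x \<in> topspace X. cmod (f x) \<le> B" "\<forall>x \<in> topspace X. cmod (g x) \<le> C"
    using bounded_borel_bound[OF assms(1)] bounded_borel_bound[OF assms(2)] by blast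
  moreover note [measurable] = bounded_borel_measurable[OF assms(1)] bounded_borel_measurable[OF assms(2)]
  ultimately show ?thesis
    by (intro bounded_borelI[of _ _ "B + C"]) (auto intro: norm_triangle_mono)
qed

lemma bounded_borel_mult:
  assumes "f \<in> bounded_borel X" "g \<in> bounded_borel X" shows "(\<lambda>x. f x * g x) \<in> bounded_borel X"
proof -
  obtain B C where "\<forall>x \<in> topspace X. cmod (f x) \<le> B" "\<forall>x \<in> topspace X. cmod (g x) \<le> C"
    using bounded_borel_bound[OF assms(1)] bounded_borel_bound[OF assms(2)] by blast
  moreover note [measurable] = bounded_borel_measurable[OF assms(1)] bounded_borel_measurable[OF assms(2)]
  ultimately show ?thesis
    by (intro bounded_borelI[of _ _ "B * C"]) (auto simp: norm_mult intro!: mult_mono')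
qed

lemma bounded_borel_const [simp]: "(\<lambda>_. c) \<in> bounded_borel X"
  by (rule bounded_borelI[of _ _ "cmod c"]) auto

lemma bounded_borel_diff:
  assumes "f \<in> bounded_borel X" "g \<in> bounded_borel X" shows "(\<lambda>x. f x - g x) \<in> bounded_borel X"
  using bounded_borel_add[OF assms(1) bounded_borel_mult[OF bounded_borel_const assms(2), of "-1"]] by simp

lemma bounded_borel_indicator: "E \<in> borel_sets X \<Longrightarrow> indicator E \<in> bounded_borel X"
  by (rule bounded_borelI[of _ _ 1]) (auto simp: indicator_def intro!: borel_measurable_indicator)

lemma bounded_borel_integrable:
  assumes f: "f \<in> bounded_borel X" and N: "finite_measure N" "sets N = borel_sets X"
  shows "integrable N f"
proof -
  obtain B where B: "\<forall>x \<in> topspace X. cmod (f x) \<le> B"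
    using f by (meson bounded_borel_bound)
  have "space N = topspace X" using sets_eq_imp_space_eq[of N "borel_space X"] N by simp
  moreover have "f \<in> borel_measurable N"
    using bounded_borel_measurable[OF f] measurable_cong_sets[of N "borel_space X" borel borel] N by auto
  ultimately show ?thesis
    using B by (intro finite_measure.integrable_const_bound[OF N(1), of _ B]) auto
qed

lemma bounded_borel_integrable_re_pos:
  assumes "f \<in> bounded_borel X" "Hausdorff_space X" "\<mu> \<in> regular_measures X"
  shows "integrable (re_pos X \<mu>) f"
  using assms by (intro bounded_borel_integrable[where X = X] finite_measure_re_pos) auto

text \<open>Integrals of finitely many functions are approximated by Riemann sums, uniformly in the
  measure; this turns identities between integrals into finite computations.\<close>

lemma partition_approx:
  assumes fin: "finite \<F>" and sub: "\<F> \<subseteq> bounded_borel X" and \<delta>: "0 < (\<delta>::real)"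
  obtains P y where "finite P" "P \<subseteq> borel_sets X" "disjoint P" "\<Union>P = topspace X"
    "\<And>A. A \<in> P \<Longrightarrow> y A \<in> A" "\<And>f A x. f \<in> \<F> \<Longrightarrow> A \<in> P \<Longrightarrow> x \<in> A \<Longrightarrow> cmod (f x - f (y A)) \<le> \<delta>"
proof -
  \<comment> \<open>Rounding to a grid of mesh \<delta> / 2 in both coordinates: points with the
    same rounded value differ by at most \<delta> / 2 in each coordinate, hence by at most \<delta>
    in modulus.\<close>
  define Q where "Q = (\<lambda>f (x::'a). (\<lfloor>Re (f x) / (\<delta> / 2)\<rfloor>, \<lfloor>Im (f x) / (\<delta> / 2)\<rfloor>))"
  define cell where "cell = (\<lambda>x. {z \<in> topspace X. \<forall>f\<in>\<F>. Q f z = Q f x})"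
  define P where "P = cell ` topspace X"
  have Qclose: "cmod (f x - f z) \<le> \<delta>" if "Q f x = Q f z" for f x z
  proof -
    have *: "\<bar>a - b\<bar> \<le> \<delta> / 2" if "\<lfloor>a / (\<delta> / 2)\<rfloor> = \<lfloor>b / (\<delta> / 2)\<rfloor>" for a b :: real
    proof -
      have "\<bar>a / (\<delta> / 2) - b / (\<delta> / 2)\<bar> \<le> 1" using that by linarith
      moreover have "a / (\<delta> / 2) - b / (\<delta> / 2) = (a - b) / (\<delta> / 2)" by (rule diff_divide_distrib[symmetric])
      ultimately have "\<bar>a - b\<bar> / (\<delta> / 2) \<le> 1" using \<delta> by (simp only: abs_divide)
      then show ?thesis using \<delta> by (subst (asm) divide_le_eq) auto
    qed
    have "\<lfloor>Re (f x) / (\<delta> / 2)\<rfloor> = \<lfloor>Re (f z) / (\<delta> / 2)\<rfloor>" "\<lfloor>Im (f x) / (\<delta> / 2)\<rfloor> = \<lfloor>Im (f z) / (\<delta> / 2)\<rfloor>"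
      using that by (simp_all only: Q_def prod.inject)
    note *[OF this(1)] *[OF this(2)]
    then show ?thesis using cmod_le[of "f x - f z"] by simp
  qed
  have finQ: "finite (Q f ` topspace X)" if f: "f \<in> \<F>" for f
  proof -
    obtain B where B: "\<And>x. x \<in> topspace X \<Longrightarrow> cmod (f x) \<le> B"
      using f sub bounded_borel_bound by (metis subsetD)
    have *: "\<lfloor>a / (\<delta> / 2)\<rfloor> \<in> {\<lfloor>- B / (\<delta> / 2)\<rfloor>..\<lfloor>B / (\<delta> / 2)\<rfloor>}" if "\<bar>a\<bar> \<le> B" for a
    proof -
      have "- B / (\<delta> / 2) \<le> a / (\<delta> / 2)" "a / (\<delta> / 2) \<le> B / (\<delta> / 2)"
        using that \<delta> by (intro divide_right_mono; simp)+
      then show ?thesis by (simp only: atLeastAtMost_iff floor_mono)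
    qed
    have "Q f ` topspace X \<subseteq> {\<lfloor>- B / (\<delta> / 2)\<rfloor>..\<lfloor>B / (\<delta> / 2)\<rfloor>} \<times> {\<lfloor>- B / (\<delta> / 2)\<rfloor>..\<lfloor>B / (\<delta> / 2)\<rfloor>}"
      unfolding Q_def using abs_Re_le_cmod abs_Im_le_cmod B by (blast intro: * order_trans)
    then show ?thesis by (rule finite_subset) simp
  qed
  have meas: "{z \<in> topspace X. Q f z = q} \<in> borel_sets X" if f: "f \<in> \<F>" for f q
  proof -
    have [measurable]: "f \<in> borel_measurable (borel_space X)"
      using f sub bounded_borel_measurable by blast
    have "{z \<in> space (borel_space X). \<lfloor>Re (f z) / (\<delta> / 2)\<rfloor> = fst q \<and> \<lfloor>Im (f z) / (\<delta> / 2)\<rfloor> = snd q} \<in> sets (borel_space X)"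
      by measurable
    then show ?thesis by (simp add: Q_def prod_eq_iff)
  qed
  have cellb: "cell x \<in> borel_sets X" for x
  proof -
    interpret sigma_algebra "topspace X" "borel_sets X" by (rule sigma_algebra_borel_sets)
    show ?thesis unfolding cell_def
      by (rule sets_Collect_finite_All[OF meas fin])
  qed
  \<comment> \<open>A cell is determined by the rounded value of each function. The functions are
    bounded and finite in number, so only finitely many combinations occur.\<close>
  have "P \<subseteq> (\<lambda>q. {z \<in> topspace X. \<forall>f\<in>\<F>. Q f z = q f}) ` (\<Pi>\<^sub>E f\<in>\<F>. Q f ` topspace X)"
  proof
    fix A assume "A \<in> P"
    then obtain x where x: "x \<in> topspace X" "A = cell x" by (auto simp: P_def)
    show "A \<in> (\<lambda>q. {z \<in> topspace X. \<forall>f\<in>\<F>. Q f z = q f}) ` (\<Pi>\<^sub>E f\<in>\<F>. Q f ` topspace X)"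
      by (rule image_eqI[of _ _ "restrict (\<lambda>f. Q f x) \<F>"]) (use x in \<open>auto simp: cell_def\<close>)
  qed
  then have finP: "finite P" by (rule finite_subset) (intro finite_imageI finite_PiE fin finQ)
  define y where "y = (\<lambda>A. SOME x::'a. x \<in> A)"
  have ne: "A \<noteq> {}" if "A \<in> P" for A using that by (auto simp: P_def cell_def)
  have y: "y A \<in> A" if "A \<in> P" for A using ne[OF that] by (simp add: y_def some_in_eq)
  show thesis
  proof
    show "disjoint P" by (auto simp: disjoint_def P_def cell_def)
    show "\<Union>P = topspace X" by (auto simp: P_def cell_def)
    fix f A x assume "f \<in> \<F>" "A \<in> P" "x \<in> A"
    moreover have "y A \<in> A" using y \<open>A \<in> P\<close> .
    ultimately have "Q f x = Q f (y A)" by (auto simp: P_def cell_def)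
    then show "cmod (f x - f (y A)) \<le> \<delta>" by (rule Qclose)
  qed (use finP cellb y in \<open>auto simp: P_def\<close>)
qed

lemma integral_partition_approx:
  assumes P: "finite P" "P \<subseteq> borel_sets X" "disjoint P" "\<Union>P = topspace X"
    and f: "f \<in> bounded_borel X"
    and close: "\<And>A x. A \<in> P \<Longrightarrow> x \<in> A \<Longrightarrow> cmod (f x - f (y A)) \<le> \<delta>"
    and N: "finite_measure N" "sets N = borel_sets X"
  shows "cmod (integral\<^sup>L N f - (\<Sum>A\<in>P. complex_of_real (measure N A) * f (y A))) \<le> \<delta> * measure N (topspace X)"
proof -
  interpret finite_measure N by (rule N(1))
  have sp: "space N = topspace X" using sets_eq_imp_space_eq[of N "borel_space X"] N by simp
  have int: "integrable N f" by (rule bounded_borel_integrable[OF f N])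
  have ind: "integrable N (\<lambda>x. indicator A x *\<^sub>R f (y A))" if "A \<in> P" for A
    using that P N by (intro integrable_scaleR_left integrable_real_indicator) (auto simp: less_top[symmetric])
  define g where "g = (\<lambda>x. \<Sum>A\<in>P. indicator A x *\<^sub>R f (y A))"
  have g: "integrable N g" unfolding g_def using ind by (rule Bochner_Integration.integrable_sum)
  have Ig: "integral\<^sup>L N g = (\<Sum>A\<in>P. complex_of_real (measure N A) * f (y A))"
  proof -
    have "integral\<^sup>L N g = (\<Sum>A\<in>P. integral\<^sup>L N (\<lambda>x. indicator A x *\<^sub>R f (y A)))"
      unfolding g_def using ind by (rule Bochner_Integration.integral_sum)
    also have "\<dots> = (\<Sum>A\<in>P. measure N A *\<^sub>R f (y A))"
    proof (rule sum.cong[OF refl])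
      fix A assume A: "A \<in> P"
      then have "A \<in> sets N" "A \<subseteq> space N" using P N sp by auto
      then show "(\<integral>x. indicator A x *\<^sub>R f (y A) \<partial>N) = measure N A *\<^sub>R f (y A)"
        by (subst integral_scaleR_left) (auto simp: Int_absorb2 less_top[symmetric] intro!: integrable_real_indicator)
    qed
    finally show ?thesis by (simp add: scaleR_conv_of_real)
  qed
  have pt: "cmod (f x - g x) \<le> \<delta>" if x: "x \<in> topspace X" for x
  proof -
    obtain A where A: "A \<in> P" "x \<in> A" using x P(4) by auto
    have "g x = (\<Sum>B\<in>P. if B = A then f (y A) else 0)"
      unfolding g_def using A P(3) by (intro sum.cong) (auto simp: indicator_def disjoint_def)
    also have "\<dots> = f (y A)" using A P(1) by simp
    finally show ?thesis using close[OF A] by simp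
  qed
  have "cmod (integral\<^sup>L N f - integral\<^sup>L N g) = cmod (\<integral>x. f x - g x \<partial>N)"
    using int g by simp
  also have "\<dots> \<le> (\<integral>x. \<delta> \<partial>N)"
    using int g pt by (intro norm_integral_le_integral) (auto simp: sp)
  finally show ?thesis by (simp add: Ig sp mult.commute)
qed

text \<open>The Riemann sum is linear in \<mu>, so the sums of the four Jordan parts recombine to
  that of \<mu>. Each part contributes an error of at most \<delta> times the norm, whence the
  4.\<close>

lemma cintegral_partition_approx:
  assumes X: "Hausdorff_space X" and \<mu>: "\<mu> \<in> regular_measures X"
    and P: "finite P" "P \<subseteq> borel_sets X" "disjoint P" "\<Union>P = topspace X"
    and f: "f \<in> bounded_borel X"
    and close: "\<And>A x. A \<in> P \<Longrightarrow> x \<in> A \<Longrightarrow> cmod (f x - f (y A)) \<le> \<delta>" and \<delta>: "0 \<le> \<delta>"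
  shows "cmod (cintegral X \<mu> f - (\<Sum>A\<in>P. \<mu> A * f (y A))) \<le> \<delta> * (4 * tv_norm X \<mu>)"
proof -
  define I where "I = (\<lambda>c. integral\<^sup>L (re_pos X (\<lambda>s. c * \<mu> s)) f)"
  define S where "S = (\<lambda>c. \<Sum>A\<in>P. complex_of_real (measure (re_pos X (\<lambda>s. c * \<mu> s)) A) * f (y A))"
  have r: "(\<lambda>s. c * \<mu> s) \<in> regular_measures X" for c by (rule regular_measures_scale[OF \<mu>])
  have IS: "cmod (I c - S c) \<le> \<delta> * tv_norm X \<mu>" if c: "cmod c = 1" for c
  proof -
    have "cmod (I c - S c) \<le> \<delta> * measure (re_pos X (\<lambda>s. c * \<mu> s)) (topspace X)"
      unfolding I_def S_def
      by (rule integral_partition_approx[OF P f close finite_measure_re_pos[OF X r]]) auto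
    also have "\<dots> \<le> \<delta> * tv_norm X \<mu>"
      using measure_re_pos_le[OF X r, of c] tv_norm_scale_unit[OF X \<mu> c] by (intro mult_left_mono \<delta>) auto
    finally show ?thesis .
  qed
  have "cintegral X \<mu> f = (I 1 - I (-1)) + \<i> * (I (-\<i>) - I \<i>)"
    by (simp add: cintegral_def I_def re_pos_def)
  moreover have "(\<Sum>A\<in>P. \<mu> A * f (y A)) = (S 1 - S (-1)) + \<i> * (S (-\<i>) - S \<i>)"
  proof -
    have "\<mu> A = complex_of_real (measure (re_pos X (\<lambda>s. 1 * \<mu> s)) A) - complex_of_real (measure (re_pos X (\<lambda>s. (-1) * \<mu> s)) A)
      + \<i> * (complex_of_real (measure (re_pos X (\<lambda>s. - \<i> * \<mu> s)) A) - complex_of_real (measure (re_pos X (\<lambda>s. \<i> * \<mu> s)) A))"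
      if "A \<in> P" for A
      using jordan_decomposition[OF X \<mu>, of A] that P by (auto simp: jordan_def)
    then have "(\<Sum>A\<in>P. \<mu> A * f (y A)) = (\<Sum>A\<in>P. (complex_of_real (measure (re_pos X (\<lambda>s. 1 * \<mu> s)) A) - complex_of_real (measure (re_pos X (\<lambda>s. (-1) * \<mu> s)) A)
      + \<i> * (complex_of_real (measure (re_pos X (\<lambda>s. - \<i> * \<mu> s)) A) - complex_of_real (measure (re_pos X (\<lambda>s. \<i> * \<mu> s)) A))) * f (y A))"
      by (intro sum.cong refl arg_cong2[where f = "(*)"]) 
    then show ?thesis
      unfolding S_def by (simp add: algebra_simps sum.distrib sum_subtractf sum_distrib_left)
  qed
  ultimately have "cintegral X \<mu> f - (\<Sum>A\<in>P. \<mu> A * f (y A)) =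
    ((I 1 - S 1) - (I (-1) - S (-1))) + \<i> * ((I (-\<i>) - S (-\<i>)) - (I \<i> - S \<i>))"
    by (simp add: right_diff_distrib)
  also have "cmod \<dots> \<le> (cmod (I 1 - S 1) + cmod (I (-1) - S (-1))) + (cmod (I (-\<i>) - S (-\<i>)) + cmod (I \<i> - S \<i>))"
    by (intro order_trans[OF norm_triangle_ineq] add_mono norm_triangle_ineq4)
       (simp add: norm_mult norm_triangle_ineq4)
  also have "\<dots> \<le> 4 * (\<delta> * tv_norm X \<mu>)"
    using IS[of 1] IS[of "-1"] IS[of "-\<i>"] IS[of "\<i>"] by simp
  finally show ?thesis by (simp add: mult_ac)
qed

text \<open>Closes the approximation arguments, whose errors are \<delta> times a constant chosen
  before \<delta>. The value of \<delta> used in the proof bounds z by half of its own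
  modulus.\<close>

lemma eq_zero_if_small:
  fixes z :: complex
  assumes "\<And>\<delta>. 0 < \<delta> \<Longrightarrow> cmod z \<le> \<delta> * C"
  shows "z = 0"
proof (rule ccontr)
  assume "z \<noteq> 0"
  then have z: "0 < cmod z" by simp
  have "cmod z \<le> (cmod z / (2 * (\<bar>C\<bar> + 1))) * C" by (rule assms) (use z in auto)
  also have "\<dots> \<le> (cmod z / (2 * (\<bar>C\<bar> + 1))) * (\<bar>C\<bar> + 1)" by (rule mult_left_mono) auto
  also have "\<dots> = cmod z / 2" by (simp add: field_simps)
  finally show False using z by simp
qed

text \<open>The positive part is not additive in \<mu>, so linearity cannot be read off the
  definition of the integral. It holds exactly for Riemann sums and passes to the limit.\<close>

lemma cintegral_clinear:
  assumes X: "Hausdorff_space X" and f: "f \<in> bounded_borel X"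
  shows "clinear_on (regular_measures X) (\<lambda>\<mu>. cintegral X \<mu> f)"
proof (rule clinear_onI)
  fix \<mu> \<nu> :: "'a set \<Rightarrow> complex" assume \<mu>: "\<mu> \<in> regular_measures X" and \<nu>: "\<nu> \<in> regular_measures X"
  have "cintegral X (\<lambda>s. \<mu> s + \<nu> s) f - (cintegral X \<mu> f + cintegral X \<nu> f) = 0"
  proof (rule eq_zero_if_small)
    fix \<delta> :: real assume \<delta>: "0 < \<delta>"
    obtain P y where P: "finite P" "P \<subseteq> borel_sets X" "disjoint P" "\<Union>P = topspace X"
      and "\<And>A x. A \<in> P \<Longrightarrow> x \<in> A \<Longrightarrow> cmod (f x - f (y A)) \<le> \<delta>"
      using partition_approx[of "{f}" X \<delta>] f \<delta> by (metis empty_subsetI finite.simps insertI1 insert_subset)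
    note apx = cintegral_partition_approx[where y = y, OF X _ P f this(5) less_imp_le[OF \<delta>]]
    let ?S = "\<lambda>\<mu>. \<Sum>A\<in>P. \<mu> A * f (y A)"
    have "?S (\<lambda>s. \<mu> s + \<nu> s) = ?S \<mu> + ?S \<nu>" by (simp add: distrib_right sum.distrib)
    then have "cmod (cintegral X (\<lambda>s. \<mu> s + \<nu> s) f - (cintegral X \<mu> f + cintegral X \<nu> f)) =
      cmod ((cintegral X (\<lambda>s. \<mu> s + \<nu> s) f - ?S (\<lambda>s. \<mu> s + \<nu> s)) - ((cintegral X \<mu> f - ?S \<mu>) + (cintegral X \<nu> f - ?S \<nu>)))"
      by (simp add: algebra_simps)
    also have "\<dots> \<le> \<delta> * (4 * tv_norm X (\<lambda>s. \<mu> s + \<nu> s)) + (\<delta> * (4 * tv_norm X \<mu>) + \<delta> * (4 * tv_norm X \<nu>))"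
      by (intro order_trans[OF norm_triangle_ineq4] add_mono order_trans[OF norm_triangle_ineq] apx \<mu> \<nu> regular_measures_add X)
    also have "\<dots> = \<delta> * (4 * tv_norm X (\<lambda>s. \<mu> s + \<nu> s) + 4 * tv_norm X \<mu> + 4 * tv_norm X \<nu>)"
      by (simp add: algebra_simps)
    finally show "cmod (cintegral X (\<lambda>s. \<mu> s + \<nu> s) f - (cintegral X \<mu> f + cintegral X \<nu> f)) \<le>
       \<delta> * (4 * tv_norm X (\<lambda>s. \<mu> s + \<nu> s) + 4 * tv_norm X \<mu> + 4 * tv_norm X \<nu>)" .
  qed
  then show "cintegral X (\<lambda>s. \<mu> s + \<nu> s) f = cintegral X \<mu> f + cintegral X \<nu> f" by simp
next
  fix c :: complex and \<mu> :: "'a set \<Rightarrow> complex" assume \<mu>: "\<mu> \<in> regular_measures X"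
  have "cintegral X (\<lambda>s. c * \<mu> s) f - c * cintegral X \<mu> f = 0"
  proof (rule eq_zero_if_small)
    fix \<delta> :: real assume \<delta>: "0 < \<delta>"
    obtain P y where P: "finite P" "P \<subseteq> borel_sets X" "disjoint P" "\<Union>P = topspace X"
      and "\<And>A x. A \<in> P \<Longrightarrow> x \<in> A \<Longrightarrow> cmod (f x - f (y A)) \<le> \<delta>"
      using partition_approx[of "{f}" X \<delta>] f \<delta> by (metis empty_subsetI finite.simps insertI1 insert_subset)
    note apx = cintegral_partition_approx[where y = y, OF X _ P f this(5) less_imp_le[OF \<delta>]]
    let ?S = "\<lambda>\<mu>. \<Sum>A\<in>P. \<mu> A * f (y A)"
    have "?S (\<lambda>s. c * \<mu> s) = c * ?S \<mu>" by (simp add: sum_distrib_left mult.assoc)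
    then have "cmod (cintegral X (\<lambda>s. c * \<mu> s) f - c * cintegral X \<mu> f) =
      cmod ((cintegral X (\<lambda>s. c * \<mu> s) f - ?S (\<lambda>s. c * \<mu> s)) - c * (cintegral X \<mu> f - ?S \<mu>))"
      by (simp add: algebra_simps)
    also have "\<dots> \<le> \<delta> * (4 * tv_norm X (\<lambda>s. c * \<mu> s)) + cmod c * (\<delta> * (4 * tv_norm X \<mu>))"
    proof (rule order_trans[OF norm_triangle_ineq4 add_mono])
      show "cmod (cintegral X (\<lambda>s. c * \<mu> s) f - ?S (\<lambda>s. c * \<mu> s)) \<le> \<delta> * (4 * tv_norm X (\<lambda>s. c * \<mu> s))"
        by (intro apx regular_measures_scale \<mu>)
      show "cmod (c * (cintegral X \<mu> f - ?S \<mu>)) \<le> cmod c * (\<delta> * (4 * tv_norm X \<mu>))"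
        unfolding norm_mult by (intro mult_left_mono apx \<mu> norm_ge_zero)
    qed
    also have "\<dots> = \<delta> * (4 * tv_norm X (\<lambda>s. c * \<mu> s) + cmod c * (4 * tv_norm X \<mu>))"
      by (simp add: algebra_simps)
    finally show "cmod (cintegral X (\<lambda>s. c * \<mu> s) f - c * cintegral X \<mu> f) \<le>
      \<delta> * (4 * tv_norm X (\<lambda>s. c * \<mu> s) + cmod c * (4 * tv_norm X \<mu>))" .
  qed
  then show "cintegral X (\<lambda>s. c * \<mu> s) f = c * cintegral X \<mu> f" by simp
qed

section \<open>Dependence of the integral on the integrand\<close>

lemma integrable_pos_part:
  assumes X: "Hausdorff_space X" and \<mu>: "\<mu> \<in> regular_measures X" and f: "f \<in> bounded_borel X"
  shows "integrable (pos_part X (\<lambda>E. Re (\<mu> E))) f" "integrable (pos_part X (\<lambda>E. - Re (\<mu> E))) f"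
    "integrable (pos_part X (\<lambda>E. Im (\<mu> E))) f" "integrable (pos_part X (\<lambda>E. - Im (\<mu> E))) f"
  using bounded_borel_integrable_re_pos[OF f X regular_measures_scale[OF \<mu>], of 1]
    bounded_borel_integrable_re_pos[OF f X regular_measures_scale[OF \<mu>], of "-1"]
    bounded_borel_integrable_re_pos[OF f X regular_measures_scale[OF \<mu>], of "-\<i>"]
    bounded_borel_integrable_re_pos[OF f X regular_measures_scale[OF \<mu>], of "\<i>"]
  by (simp_all add: re_pos_def)

lemma cintegral_add:
  "Hausdorff_space X \<Longrightarrow> \<mu> \<in> regular_measures X \<Longrightarrow> f \<in> bounded_borel X \<Longrightarrow> g \<in> bounded_borel X \<Longrightarrow>
    cintegral X \<mu> (\<lambda>x. f x + g x) = cintegral X \<mu> f + cintegral X \<mu> g"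
  by (simp add: cintegral_def integrable_pos_part algebra_simps)

lemma cintegral_diff:
  "Hausdorff_space X \<Longrightarrow> \<mu> \<in> regular_measures X \<Longrightarrow> f \<in> bounded_borel X \<Longrightarrow> g \<in> bounded_borel X \<Longrightarrow>
    cintegral X \<mu> (\<lambda>x. f x - g x) = cintegral X \<mu> f - cintegral X \<mu> g"
  by (simp add: cintegral_def integrable_pos_part algebra_simps)

lemma cintegral_cmult:
  "Hausdorff_space X \<Longrightarrow> \<mu> \<in> regular_measures X \<Longrightarrow> f \<in> bounded_borel X \<Longrightarrow>
    cintegral X \<mu> (\<lambda>x. c * f x) = c * cintegral X \<mu> f"
  by (simp add: cintegral_def integrable_pos_part algebra_simps)

lemma cintegral_cong:
  assumes "\<And>x. x \<in> topspace X \<Longrightarrow> f x = g x"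
  shows "cintegral X \<mu> f = cintegral X \<mu> g"
proof -
  have "integral\<^sup>L (re_pos X \<nu>) f = integral\<^sup>L (re_pos X \<nu>) g" for \<nu>
    by (rule Bochner_Integration.integral_cong) (auto simp: assms)
  from this[of \<mu>] this[of "\<lambda>s. - \<mu> s"] this[of "\<lambda>s. - \<i> * \<mu> s"] this[of "\<lambda>s. \<i> * \<mu> s"]
  show ?thesis by (simp add: cintegral_def re_pos_def)
qed

text \<open>Of the four Jordan parts of a positive measure, three have mass 0.\<close>

lemma cintegral_pos:
  assumes X: "Hausdorff_space X" and \<mu>: "\<mu> \<in> pos_measures X" and f: "f \<in> bounded_borel X"
  shows "cintegral X \<mu> f = integral\<^sup>L (re_pos X \<mu>) f"
proof -
  have Im: "Im (\<mu> E) = 0" for E using pos_measures_nonneg[OF \<mu>, of E] by (simp add: less_eq_complex_def)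
  have z: "integral\<^sup>L (re_pos X \<nu>) f = 0"
    if "\<nu> \<in> regular_measures X" "emeasure (re_pos X \<nu>) (topspace X) = 0" for \<nu>
  proof -
    have "AE x in re_pos X \<nu>. f x = 0"
      by (rule AE_I[of _ _ "topspace X"]) (use that in auto)
    then show ?thesis by (rule integral_eq_zero_AE)
  qed
  note r = pos_measures_regular[OF \<mu>]
  have "integral\<^sup>L (re_pos X (\<lambda>s. - \<mu> s)) f = 0"
    by (rule z[OF regular_measures_uminus[OF r] measure_re_pos_pos(2)[OF \<mu>]]) simp
  moreover have "integral\<^sup>L (re_pos X (\<lambda>s. 0)) f = 0"
    by (rule z[OF regular_measures_zero]) (simp add: measure_re_pos_pos(1))
  ultimately show ?thesis by (simp add: cintegral_def re_pos_def Im)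
qed

lemma finite_measure_re_pos': "Hausdorff_space X \<Longrightarrow> \<mu> \<in> pos_measures X \<Longrightarrow> finite_measure (re_pos X \<mu>)"
  by (rule finite_measure_re_pos[OF _ pos_measures_regular])

lemma measure_re_pos_pos':
  "\<mu> \<in> pos_measures X \<Longrightarrow> E \<in> borel_sets X \<Longrightarrow> measure (re_pos X \<mu>) E = Re (\<mu> E)"
  by (simp add: measure_def measure_re_pos_pos(1) pos_measures_Re_nonneg)

lemma cintegral_dominated:
  assumes X: "Hausdorff_space X" and \<mu>: "\<mu> \<in> pos_measures X" and f: "f \<in> bounded_borel X"
    and g: "(\<lambda>x. complex_of_real (g x)) \<in> bounded_borel X" and le: "\<And>x. x \<in> topspace X \<Longrightarrow> cmod (f x) \<le> g x"
  shows "cmod (cintegral X \<mu> f) \<le> Re (cintegral X \<mu> (\<lambda>x. complex_of_real (g x)))"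
proof -
  have "integrable (re_pos X \<mu>) (\<lambda>x. Re (complex_of_real (g x)))"
    by (rule integrable_Re[OF bounded_borel_integrable_re_pos[OF g X pos_measures_regular[OF \<mu>]]])
  then have "cmod (integral\<^sup>L (re_pos X \<mu>) f) \<le> (\<integral>x. g x \<partial>re_pos X \<mu>)"
    by (intro norm_integral_le_integral bounded_borel_integrable_re_pos f X pos_measures_regular \<mu>) (auto simp: le)
  then show ?thesis by (simp add: cintegral_pos[OF X \<mu>] f g)
qed

lemma cintegral_indicator:
  assumes X: "Hausdorff_space X" and \<mu>: "\<mu> \<in> pos_measures X" and E: "E \<in> borel_sets X"
  shows "cintegral X \<mu> (indicator E) = \<mu> E"
proof -
  interpret finite_measure "re_pos X \<mu>" by (rule finite_measure_re_pos'[OF X \<mu>])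
  have "cintegral X \<mu> (indicator E) = integral\<^sup>L (re_pos X \<mu>) (\<lambda>x. complex_of_real (indicator E x))"
    using bounded_borel_indicator[OF E] by (simp add: cintegral_pos[OF X \<mu>] of_real_indicator)
  also have "\<dots> = complex_of_real (measure (re_pos X \<mu>) E)"
    using borel_sets_subset[OF E] by (simp add: Int_absorb2)
  finally show ?thesis
    using pos_measures_of_real[OF \<mu>, of E] by (simp add: measure_re_pos_pos'[OF \<mu> E])
qed

lemma cintegral_const:
  assumes X: "Hausdorff_space X" and \<mu>: "\<mu> \<in> pos_measures X"
  shows "cintegral X \<mu> (\<lambda>_. c) = c * \<mu> (topspace X)"
proof -
  have "cintegral X \<mu> (\<lambda>_. c) = cintegral X \<mu> (\<lambda>x. c * indicator (topspace X) x)"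
    by (rule cintegral_cong) simp
  also have "\<dots> = c * cintegral X \<mu> (indicator (topspace X))"
    by (intro cintegral_cmult[OF X pos_measures_regular[OF \<mu>]] bounded_borel_indicator) simp
  finally show ?thesis by (simp add: cintegral_indicator[OF X \<mu>])
qed

lemma cintegral_bound:
  assumes X: "Hausdorff_space X" and \<mu>: "\<mu> \<in> pos_measures X" and f: "f \<in> bounded_borel X"
    and le: "\<And>x. x \<in> topspace X \<Longrightarrow> cmod (f x) \<le> B"
  shows "cmod (cintegral X \<mu> f) \<le> B * Re (\<mu> (topspace X))"
  using cintegral_dominated[OF X \<mu> f, of "\<lambda>_. B"] le by (simp add: cintegral_const[OF X \<mu>])

section \<open>Dirac measures\<close>

lemma dirac_prob:
  assumes X: "Hausdorff_space X" and x: "x \<in> topspace X"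
  shows "dirac X x \<in> prob_measures X"
proof -
  have ca: "countably_additive_on X (dirac X x)"
    unfolding countably_additive_on_def
  proof (intro allI impI)
    fix A :: "nat \<Rightarrow> 'a set" assume A: "range A \<subseteq> borel_sets X" "disjoint_family A"
    have b: "A i \<in> borel_sets X" for i using A by auto
    show "(\<lambda>i. dirac X x (A i)) sums dirac X x (\<Union>i. A i)"
    proof (cases "x \<in> (\<Union>i. A i)")
      case True
      then obtain k where k: "x \<in> A k" by auto
      have "x \<notin> A i" if "i \<noteq> k" for i using disjoint_family_onD[OF A(2), of i k] k that by auto
      then have "dirac X x (A i) = (if i = k then 1 else 0)" for i
        using k b by (auto simp: dirac_def)
      then show ?thesis
        using True borel_sets_UN[OF A(1)] sums_single[of k "\<lambda>_. 1 :: complex"] by (simp add: dirac_def)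
    qed (auto simp: dirac_def)
  qed
  have "dirac X x \<in> regular_measures X"
    unfolding regular_measures_iff
  proof (intro conjI ca allI impI ballI)
    fix E e assume E: "E \<in> borel_sets X" and e: "0 < (e::real)"
    have tv0: "total_variation X (dirac X x) F < ennreal e" if "x \<notin> F" for F
    proof -
      have "total_variation X (dirac X x) F \<le> 0"
        by (rule total_variation_least) (use that in \<open>auto simp: dirac_def\<close>)
      with e show ?thesis by (metis ennreal_0 ennreal_lessI le_zero_eq)
    qed
    show "\<exists>C U. compactin X C \<and> openin X U \<and> C \<subseteq> E \<and> E \<subseteq> U \<and> total_variation X (dirac X x) (U - C) < ennreal e"
    proof (cases "x \<in> E")
      case True
      then show ?thesis
        using x borel_sets_subset[OF E] by (intro exI[of _ "{x}"] exI[of _ "topspace X"]) (auto intro!: tv0)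
    next
      case False
      then show ?thesis
        using x X borel_sets_subset[OF E]
        by (intro exI[of _ "{}"] exI[of _ "topspace X - {x}"])
           (auto intro!: tv0 closedin_Hausdorff_singleton openin_diff)
    qed
  qed (simp add: dirac_def)
  then show ?thesis
    using x by (auto simp: prob_measures_def pos_measures_def dirac_def less_eq_complex_def)
qed

lemma prob_measures_pos: "\<mu> \<in> prob_measures X \<Longrightarrow> \<mu> \<in> pos_measures X"
  by (simp add: prob_measures_def)

lemma cintegral_dirac:
  assumes X: "Hausdorff_space X" and x: "x \<in> topspace X" and f: "f \<in> bounded_borel X"
  shows "cintegral X (dirac X x) f = f x"
proof -
  have d: "dirac X x \<in> pos_measures X" by (intro prob_measures_pos dirac_prob X x)
  interpret finite_measure "re_pos X (dirac X x)" by (rule finite_measure_re_pos'[OF X d])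
  have xb: "{x} \<in> borel_sets X" using x X by (simp add: borel_sets_compactin)
  then have b: "topspace X - {x} \<in> borel_sets X" by (intro borel_sets_Diff) auto
  have "AE z in re_pos X (dirac X x). f z = f x"
    by (rule AE_I[of _ _ "topspace X - {x}"]) (use b measure_re_pos_pos(1)[OF d b] in \<open>auto simp: dirac_def\<close>)
  then have "integral\<^sup>L (re_pos X (dirac X x)) f = integral\<^sup>L (re_pos X (dirac X x)) (\<lambda>_. f x)"
    using f by (intro integral_cong_AE) (auto dest: bounded_borel_measurable)
  also have "\<dots> = cintegral X (dirac X x) (\<lambda>_. f x)"
    by (simp only: cintegral_pos[OF X d bounded_borel_const])
  also have "\<dots> = f x" using x by (simp only: cintegral_const[OF X d]) (simp add: dirac_def)
  finally show ?thesis by (simp add: cintegral_pos[OF X d f])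
qed

section \<open>The cone topology and convolution as a double integral\<close>

text \<open>Continuity on an abstract topology is turned into limits along \<open>atin\<close>,
  where the rules for \<open>tendsto\<close> are available.\<close>

lemma continuous_map_tendsto:
  "continuous_map X euclidean f \<Longrightarrow> a \<in> topspace X \<Longrightarrow> (f \<longlongrightarrow> f a) (atin X a)"
  by (simp add: continuous_map_atin)

lemma continuous_map_from_tendsto:
  "(\<And>a. a \<in> topspace X \<Longrightarrow> (f \<longlongrightarrow> f a) (atin X a)) \<Longrightarrow> continuous_map X euclidean f"
  by (simp add: continuous_map_atin)

lemma eventually_atin_topspace: "eventually (\<lambda>x. x \<in> topspace X) (atin X a)"
  unfolding eventually_atin by (metis DiffD1 openin_topspace)

lemma continuous_map_of_real [continuous_intros]:
  "continuous_map X euclideanreal f \<Longrightarrow> continuous_map X euclidean (\<lambda>x. complex_of_real (f x))"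
  by (simp add: continuous_map_atin tendsto_of_real)

lemma continuous_map_Re_Im:
  assumes "continuous_map X euclidean f"
  shows continuous_map_Re: "continuous_map X euclideanreal (\<lambda>x. Re (f x))"
    and continuous_map_Im: "continuous_map X euclideanreal (\<lambda>x. Im (f x))"
  using assms by (simp_all add: continuous_map_atin tendsto_Re tendsto_Im)

lemma continuous_map_cmult [continuous_intros]:
  fixes f g :: "'a \<Rightarrow> complex"
  shows "continuous_map X euclidean f \<Longrightarrow> continuous_map X euclidean g \<Longrightarrow>
    continuous_map X euclidean (\<lambda>x. f x * g x)"
  by (simp add: continuous_map_atin tendsto_mult)

lemma bounded_borel_cong:
  assumes "\<And>x. x \<in> topspace X \<Longrightarrow> f x = g x"
  shows "f \<in> bounded_borel X \<longleftrightarrow> g \<in> bounded_borel X"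
proof -
  have "f \<in> borel_measurable (borel_space X) \<longleftrightarrow> g \<in> borel_measurable (borel_space X)"
    by (rule measurable_cong) (simp add: assms)
  then show ?thesis by (auto simp: bounded_borel_def assms)
qed

section \<open>Compactly supported functions and cutoffs\<close>

lemma Cc_posD:
  assumes "g \<in> Cc_pos X"
  shows Cc_pos_continuous: "continuous_map X euclideanreal g"
    and Cc_pos_nonneg: "x \<in> topspace X \<Longrightarrow> 0 \<le> g x"
    and Cc_pos_compact: "compactin X (X closure_of {x \<in> topspace X. g x \<noteq> 0})"
  using assms by (auto simp: Cc_pos_def)

lemma Cc_pos_bounded:
  assumes g: "g \<in> Cc_pos X"
  obtains B where "0 \<le> B" "\<And>x. x \<in> topspace X \<Longrightarrow> g x \<le> B"
proof -
  let ?S = "X closure_of {x \<in> topspace X. g x \<noteq> 0}"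
  have "compactin euclideanreal (g ` ?S)"
    by (rule image_compactin[OF Cc_pos_compact[OF g] Cc_pos_continuous[OF g]])
  then have "bounded (g ` ?S)" by (simp add: compact_imp_bounded)
  then obtain B where B: "\<And>x. x \<in> ?S \<Longrightarrow> \<bar>g x\<bar> \<le> B" by (auto simp: bounded_iff)
  have "g x \<le> max 0 B" if x: "x \<in> topspace X" for x
  proof (cases "g x = 0")
    case False
    then have "x \<in> ?S" using x closure_of_subset[of "{x \<in> topspace X. g x \<noteq> 0}" X] by auto
    from B[OF this] show ?thesis by linarith
  qed simp
  then show ?thesis using that[of "max 0 B"] by simp
qed

lemma Cc_pos_mult:
  assumes g: "g \<in> Cc_pos X" and h: "continuous_map X euclideanreal h" "\<And>x. x \<in> topspace X \<Longrightarrow> 0 \<le> h x"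
  shows "(\<lambda>x. h x * g x) \<in> Cc_pos X"
proof -
  have "compactin X (X closure_of {x \<in> topspace X. h x * g x \<noteq> 0})"
    by (rule closed_compactin[OF Cc_pos_compact[OF g]]) (auto intro!: closure_of_mono)
  then show ?thesis
    using g h by (auto simp: Cc_pos_def intro!: continuous_intros)
qed

text \<open>A Urysohn function separating C from the complement of V \<inter> U, where V is a
  neighbourhood of C inside a compact closed set L. The set L makes the support compact.\<close>

lemma Cc_pos_cutoff:
  assumes X: "Hausdorff_space X" "locally_compact_space X"
    and C: "compactin X C" and U: "openin X U" and CU: "C \<subseteq> U"
  obtains g where "g \<in> Cc_pos X" "\<And>x. x \<in> topspace X \<Longrightarrow> 0 \<le> g x \<and> g x \<le> 1"
    "\<And>x. x \<in> C \<Longrightarrow> g x = 1" "\<And>x. x \<in> topspace X - U \<Longrightarrow> g x = 0"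
proof -
  obtain V L where VL: "openin X V" "compactin X L" "closedin X L" "C \<subseteq> V" "V \<subseteq> L"
    using iffD1[OF locally_compact_space_compact_closed_compact[OF disjI1[OF X(1)]] X(2)] C by meson
  let ?W = "V \<inter> U"
  have W: "openin X ?W" using VL U by auto
  have cr: "completely_regular_space X"
    using X by (simp add: locally_compact_regular_imp_completely_regular_space)
  have "closedin X (topspace X - ?W)" "disjnt C (topspace X - ?W)" using W VL CU by (auto simp: disjnt_def)
  then obtain g where g: "continuous_map X (top_of_set {0..1::real}) g" "g ` (topspace X - ?W) \<subseteq> {0}" "g ` C \<subseteq> {1}"
    using Urysohn_completely_regular_compact_closed[OF zero_le_one cr C] by metis
  have range: "0 \<le> g x \<and> g x \<le> 1" if "x \<in> topspace X" for x
    using g(1) that by (auto simp: continuous_map_in_subtopology Pi_iff)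
  have "{x \<in> topspace X. g x \<noteq> 0} \<subseteq> L" using g(2) VL by auto
  then have "compactin X (X closure_of {x \<in> topspace X. g x \<noteq> 0})"
    by (intro closed_compactin[OF VL(2)] closure_of_minimal VL(3)) auto
  then have "g \<in> Cc_pos X"
    using g(1) range by (auto simp: Cc_pos_def continuous_map_in_subtopology)
  with g range show thesis using that[of g] by auto
qed

lemma bounded_borel_Cc_pos:
  assumes g: "g \<in> Cc_pos X"
  shows "(\<lambda>x. complex_of_real (g x)) \<in> bounded_borel X"
proof -
  obtain B where "\<And>x. x \<in> topspace X \<Longrightarrow> g x \<le> B" using Cc_pos_bounded[OF g] by metis
  then show ?thesis
    using Cc_pos_nonneg[OF g]
    by (intro bounded_borel_continuous[of _ _ B] continuous_map_of_real Cc_pos_continuous g) auto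
qed

lemma bounded_borel_cone_test:
  assumes "g \<in> Cc_pos X \<union> {\<lambda>_. 1}"
  shows "(\<lambda>x. complex_of_real (g x)) \<in> bounded_borel X"
proof (cases "g \<in> Cc_pos X")
  case False
  then have "g = (\<lambda>_. 1)" using assms by simp
  then show ?thesis by (simp only: bounded_borel_const)
qed (rule bounded_borel_Cc_pos)

section \<open>Functionals continuous for the cone topology\<close>

lemma topspace_cone_topology [simp]: "topspace (cone_topology X) = pos_measures X"
  unfolding cone_topology_def topology_generated_by_topspace
  by (auto intro!: exI[of _ "\<lambda>_. 1"] exI[of _ UNIV])

lemma cone_topology_continuous:
  assumes "g \<in> Cc_pos X \<union> {\<lambda>_. 1}"
  shows "continuous_map (cone_topology X) euclidean (\<lambda>\<mu>. cintegral X \<mu> (\<lambda>x. complex_of_real (g x)))"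
  unfolding continuous_map_def
proof (intro conjI allI impI)
  fix W :: "complex set" assume "openin euclidean W"
  then show "openin (cone_topology X) {\<mu> \<in> topspace (cone_topology X). cintegral X \<mu> (\<lambda>x. complex_of_real (g x)) \<in> W}"
    unfolding topspace_cone_topology unfolding cone_topology_def
    using assms by (intro topology_generated_by_Basis) auto
qed auto

text \<open>The cone topology tests only non-negative real functions. Splitting f into the positive
  and negative parts of its real and imaginary parts writes the product as a combination of four
  such functions, and g supplies the compact support.\<close>

lemma cone_topology_continuous_mult:
  assumes X: "Hausdorff_space X" and f: "continuous_map X euclidean f" and g: "g \<in> Cc_pos X"
    and fb: "\<And>x. x \<in> topspace X \<Longrightarrow> cmod (f x) \<le> B"
  shows "continuous_map (cone_topology X) euclidean (\<lambda>\<mu>. cintegral X \<mu> (\<lambda>x. f x * complex_of_real (g x)))"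
proof -
  define r where "r = (\<lambda>h x. max 0 (h x) * g x)"
  define R where "R = (\<lambda>h \<mu>. cintegral X \<mu> (\<lambda>x. complex_of_real (r h x)))"
  let ?h1 = "\<lambda>x. Re (f x)" and ?h2 = "\<lambda>x. - Re (f x)" and ?h3 = "\<lambda>x. Im (f x)" and ?h4 = "\<lambda>x. - Im (f x)"
  have r: "r h \<in> Cc_pos X" if "h \<in> {?h1, ?h2, ?h3, ?h4}" for h
    unfolding r_def using that continuous_map_Re[OF f] continuous_map_Im[OF f]
    by (intro Cc_pos_mult[OF g]) (auto intro!: continuous_intros)
  have Rc: "continuous_map (cone_topology X) euclidean (R h)" if "h \<in> {?h1, ?h2, ?h3, ?h4}" for h
    unfolding R_def using r[OF that] by (intro cone_topology_continuous) auto
  have "cintegral X \<mu> (\<lambda>x. f x * complex_of_real (g x)) = (R ?h1 \<mu> - R ?h2 \<mu>) + \<i> * (R ?h3 \<mu> - R ?h4 \<mu>)"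
    if \<mu>: "\<mu> \<in> pos_measures X" for \<mu>
  proof -
    let ?r = "\<lambda>h x. complex_of_real (r h x)"
    have "(\<lambda>x. f x * complex_of_real (g x)) = (\<lambda>x. (?r ?h1 x - ?r ?h2 x) + \<i> * (?r ?h3 x - ?r ?h4 x))"
      by (auto simp: fun_eq_iff complex_eq_iff r_def max_def algebra_simps)
    moreover have "?r h \<in> bounded_borel X" if "h \<in> {?h1, ?h2, ?h3, ?h4}" for h
      by (rule bounded_borel_Cc_pos[OF r[OF that]])
    ultimately show ?thesis
      using pos_measures_regular[OF \<mu>] X unfolding R_def
      by (simp add: cintegral_add cintegral_diff cintegral_cmult[where c = \<i>] bounded_borel_diff bounded_borel_mult)
  qed
  moreover have "continuous_map (cone_topology X) euclidean (\<lambda>\<mu>. (R ?h1 \<mu> - R ?h2 \<mu>) + \<i> * (R ?h3 \<mu> - R ?h4 \<mu>))"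
    by (intro continuous_intros continuous_map_diff Rc) auto
  ultimately show ?thesis
    by (elim continuous_map_eq) auto
qed

text \<open>Convergence of the total masses keeps mass from escaping to infinity, so the cone topology
  controls all bounded continuous functions and not just those vanishing at infinity.\<close>

lemma cone_topology_continuous_bounded:
  assumes X: "Hausdorff_space X" "locally_compact_space X" and f: "continuous_map X euclidean f"
    and fb: "\<And>x. x \<in> topspace X \<Longrightarrow> cmod (f x) \<le> B"
  shows "continuous_map (cone_topology X) euclidean (\<lambda>\<mu>. cintegral X \<mu> f)"
proof (rule continuous_map_from_tendsto)
  fix \<nu> assume "\<nu> \<in> topspace (cone_topology X)"
  then have \<nu>: "\<nu> \<in> pos_measures X" by simp
  let ?F = "atin (cone_topology X) \<nu>"
  show "((\<lambda>\<mu>. cintegral X \<mu> f) \<longlongrightarrow> cintegral X \<nu> f) ?F"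
  proof (rule tendstoI)
    fix e :: real assume e: "0 < e"
    \<comment> \<open>Leaves an error of at most e / 4 for the tail of each of the two measures, and
      another e / 4 for the part under the cutoff. The added 1 avoids division by 0.\<close>
    define d where "d = e / (4 * (\<bar>B\<bar> + 1))"
    have d: "0 < d" using e by (simp add: d_def)
    have Bd: "\<bar>B\<bar> * d \<le> e / 4"
    proof -
      have "\<bar>B\<bar> * d \<le> (\<bar>B\<bar> + 1) * d" using d by (intro mult_right_mono) auto
      also have "\<dots> = e / 4" by (simp add: d_def field_simps)
      finally show ?thesis .
    qed
    obtain C U where CU: "compactin X C" "openin X U" "C \<subseteq> topspace X" "topspace X \<subseteq> U"
        "total_variation X \<nu> (U - C) < ennreal d"
      using regular_measures_regular[OF pos_measures_regular[OF \<nu>] borel_sets_topspace d] by auto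
    have Cb: "topspace X - C \<in> borel_sets X"
      by (rule borel_sets_Diff[OF borel_sets_topspace borel_sets_compactin[OF X(1) CU(1)]])
    have U: "U = topspace X" using CU openin_subset by blast
    have mC: "Re (\<nu> (topspace X - C)) < d"
    proof -
      have "ennreal (cmod (\<nu> (topspace X - C))) < ennreal d"
        using cmod_le_total_variation[OF Cb, of \<nu>] CU(5) unfolding U by (rule le_less_trans)
      then show ?thesis using d complex_Re_le_cmod[of "\<nu> (topspace X - C)"] by (simp add: ennreal_less_iff)
    qed
    obtain g where g: "g \<in> Cc_pos X" and g01: "\<And>x. x \<in> topspace X \<Longrightarrow> 0 \<le> g x \<and> g x \<le> 1"
      and g1: "\<And>x. x \<in> C \<Longrightarrow> g x = 1"
      using Cc_pos_cutoff[OF X CU(1) openin_topspace CU(3)] by metis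
    \<comment> \<open>\<open>T\<close> is the mass missed by the cutoff g and \<open>G\<close> the
      integral of the cut-off function. \<open>T\<close> is continuous because both 1 and g are test
      functions, and \<bar>B\<bar> times \<open>T\<close> bounds the error made by replacing f with
      f g.\<close>
    define T where "T = (\<lambda>\<mu>. Re (cintegral X \<mu> (\<lambda>x. complex_of_real (1 - g x))))"
    define G where "G = (\<lambda>\<mu>. cintegral X \<mu> (\<lambda>x. f x * complex_of_real (g x)))"
    note gb = bounded_borel_Cc_pos[OF g]
    have fb': "f \<in> bounded_borel X" by (rule bounded_borel_continuous[OF f fb])
    have tb: "(\<lambda>x. complex_of_real (1 - g x)) \<in> bounded_borel X"
      using bounded_borel_diff[OF bounded_borel_const[of 1] gb] by simp
    have Tc: "(T \<longlongrightarrow> T \<nu>) ?F"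
    proof -
      have "T \<mu> = Re (cintegral X \<mu> (\<lambda>x. complex_of_real 1) - cintegral X \<mu> (\<lambda>x. complex_of_real (g x)))"
        if "\<mu> \<in> pos_measures X" for \<mu>
        unfolding T_def using cintegral_diff[OF X(1) pos_measures_regular[OF that] bounded_borel_const[of 1] gb] by simp
      moreover have "continuous_map (cone_topology X) euclideanreal
          (\<lambda>\<mu>. Re (cintegral X \<mu> (\<lambda>x. complex_of_real 1) - cintegral X \<mu> (\<lambda>x. complex_of_real (g x))))"
        by (intro continuous_map_Re continuous_map_diff cone_topology_continuous) (use g in auto)
      ultimately have "continuous_map (cone_topology X) euclideanreal T"
        by (elim continuous_map_eq) auto
      then show ?thesis using \<nu> by (intro continuous_map_tendsto) auto
    qed
    have Gc: "(G \<longlongrightarrow> G \<nu>) ?F"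
      unfolding G_def using \<nu> by (intro continuous_map_tendsto cone_topology_continuous_mult[OF X(1) f g fb]) auto
    have T\<nu>: "T \<nu> < d"
    proof -
      have "T \<nu> \<le> cmod (cintegral X \<nu> (\<lambda>x. complex_of_real (1 - g x)))"
        unfolding T_def by (rule complex_Re_le_cmod)
      also have "\<dots> \<le> Re (cintegral X \<nu> (\<lambda>x. complex_of_real (indicator (topspace X - C) x)))"
      proof (rule cintegral_dominated[OF X(1) \<nu> tb])
        show "(\<lambda>x. complex_of_real (indicator (topspace X - C) x)) \<in> bounded_borel X"
          using bounded_borel_indicator[OF Cb] by (simp only: of_real_indicator)
        fix x assume x: "x \<in> topspace X"
        have "cmod (complex_of_real (1 - g x)) = 1 - g x" using g01[OF x] by (simp only: norm_of_real) simp
        then show "cmod (complex_of_real (1 - g x)) \<le> indicator (topspace X - C) x"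
          using g01[OF x] g1[of x] x by (cases "x \<in> C") auto
      qed
      also have "\<dots> = Re (\<nu> (topspace X - C))"
        by (simp add: of_real_indicator cintegral_indicator[OF X(1) \<nu> Cb])
      finally show ?thesis using mC by simp
    qed
    have apx: "cmod (cintegral X \<mu> f - G \<mu>) \<le> \<bar>B\<bar> * T \<mu>" if \<mu>: "\<mu> \<in> pos_measures X" for \<mu>
    proof -
      note r = pos_measures_regular[OF \<mu>]
      have "cintegral X \<mu> f - G \<mu> = cintegral X \<mu> (\<lambda>x. f x - f x * complex_of_real (g x))"
        unfolding G_def by (rule cintegral_diff[symmetric, OF X(1) r fb' bounded_borel_mult[OF fb' gb]])
      moreover have "cmod (cintegral X \<mu> (\<lambda>x. f x - f x * complex_of_real (g x))) \<le>
         Re (cintegral X \<mu> (\<lambda>x. complex_of_real (\<bar>B\<bar> * (1 - g x))))"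
      proof (rule cintegral_dominated[OF X(1) \<mu>])
        show "(\<lambda>x. f x - f x * complex_of_real (g x)) \<in> bounded_borel X"
          by (intro bounded_borel_diff bounded_borel_mult fb' gb)
        show "(\<lambda>x. complex_of_real (\<bar>B\<bar> * (1 - g x))) \<in> bounded_borel X"
          unfolding of_real_mult by (intro bounded_borel_mult tb bounded_borel_const)
        fix x assume x: "x \<in> topspace X"
        have "f x - f x * complex_of_real (g x) = f x * complex_of_real (1 - g x)" by (simp add: algebra_simps)
        then have "cmod (f x - f x * complex_of_real (g x)) = cmod (f x) * (1 - g x)"
          using g01[OF x] by (simp only: norm_mult norm_of_real) simp
        also have "\<dots> \<le> \<bar>B\<bar> * (1 - g x)" using g01[OF x] fb[OF x] by (intro mult_right_mono) auto
        finally show "cmod (f x - f x * complex_of_real (g x)) \<le> \<bar>B\<bar> * (1 - g x)" .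
      qed
      moreover have "cintegral X \<mu> (\<lambda>x. complex_of_real (\<bar>B\<bar> * (1 - g x))) =
          complex_of_real \<bar>B\<bar> * cintegral X \<mu> (\<lambda>x. complex_of_real (1 - g x))"
        unfolding of_real_mult by (rule cintegral_cmult[OF X(1) r tb])
      ultimately show ?thesis by (simp add: T_def)
    qed
    have "eventually (\<lambda>\<mu>. T \<mu> < d) ?F" using Tc T\<nu> by (rule order_tendstoD)
    moreover have "eventually (\<lambda>\<mu>. dist (G \<mu>) (G \<nu>) < e / 4) ?F" using Gc e by (intro tendstoD) auto
    moreover have "eventually (\<lambda>\<mu>. \<mu> \<in> pos_measures X) ?F"
      using eventually_atin_topspace[of "cone_topology X"] by simp
    ultimately show "eventually (\<lambda>\<mu>. dist (cintegral X \<mu> f) (cintegral X \<nu> f) < e) ?F"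
    proof eventually_elim
      case (elim \<mu>)
      have "cmod (cintegral X \<mu> f - G \<mu>) \<le> e / 4"
        using apx[OF elim(3)] mult_left_mono[of "T \<mu>" d "\<bar>B\<bar>"] elim(1) Bd by simp
      moreover have "cmod (cintegral X \<nu> f - G \<nu>) \<le> e / 4"
        using apx[OF \<nu>] mult_left_mono[of "T \<nu>" d "\<bar>B\<bar>"] T\<nu> Bd by simp
      moreover have "dist (cintegral X \<mu> f) (cintegral X \<nu> f) \<le>
         cmod (cintegral X \<mu> f - G \<mu>) + dist (G \<mu>) (G \<nu>) + cmod (cintegral X \<nu> f - G \<nu>)"
        using dist_triangle[of "cintegral X \<mu> f" "cintegral X \<nu> f" "G \<mu>"] dist_triangle[of "G \<mu>" "cintegral X \<nu> f" "G \<nu>"]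
        by (simp add: dist_norm norm_minus_commute)
      ultimately show ?case using elim(2) e by linarith
    qed
  qed
qed

lemma continuous_map_dirac:
  assumes X: "Hausdorff_space X"
  shows "continuous_map X (cone_topology X) (dirac X)"
  unfolding cone_topology_def
proof (rule continuous_on_generated_topo)
  fix U assume "U \<in> {{\<mu> \<in> pos_measures X. cintegral X \<mu> (\<lambda>x. complex_of_real (f x)) \<in> W} |f W.
           f \<in> Cc_pos X \<union> {\<lambda>_. 1} \<and> open W}"
  then obtain f W where U: "U = {\<mu> \<in> pos_measures X. cintegral X \<mu> (\<lambda>x. complex_of_real (f x)) \<in> W}"
    and f: "f \<in> Cc_pos X \<union> {\<lambda>_. 1}" and W: "open W"
    by (elim CollectE exE conjE) (rule that; assumption)
  have fc: "continuous_map X euclidean (\<lambda>x. complex_of_real (f x))"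
    using f by (auto intro: continuous_map_of_real Cc_pos_continuous)
  have fb: "(\<lambda>x. complex_of_real (f x)) \<in> bounded_borel X"
    by (rule bounded_borel_cone_test[OF f])
  have "dirac X -` U \<inter> topspace X = {x \<in> topspace X. complex_of_real (f x) \<in> W}"
    using prob_measures_pos[OF dirac_prob[OF X]] by (auto simp: U cintegral_dirac[OF X _ fb])
  then show "openin X (dirac X -` U \<inter> topspace X)"
    using fc W by (simp add: continuous_map_def)
next
  show "dirac X ` topspace X \<subseteq> \<Union> {{\<mu> \<in> pos_measures X. cintegral X \<mu> (\<lambda>x. complex_of_real (f x)) \<in> W} |f W.
           f \<in> Cc_pos X \<union> {\<lambda>_. 1} \<and> open W}"
    using prob_measures_pos[OF dirac_prob[OF X]] by (auto intro!: exI[of _ "\<lambda>_. 1"] exI[of _ UNIV])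
qed

text \<open>Near \<nu>, finitely many integrals decide membership in U. The test functions may be
  any bounded Borel functions, the class that \<open>partition_approx\<close> accepts.\<close>

definition controls_nbhd :: "'a topology \<Rightarrow> ('a set \<Rightarrow> complex) \<Rightarrow> ('a \<Rightarrow> complex) set \<Rightarrow> real \<Rightarrow>
    ('a set \<Rightarrow> complex) set \<Rightarrow> bool" where
  "controls_nbhd X \<nu> \<F> \<delta> U \<longleftrightarrow> finite \<F> \<and> \<F> \<subseteq> bounded_borel X \<and> 0 < \<delta> \<and>
    (\<forall>\<mu> \<in> pos_measures X. (\<forall>f\<in>\<F>. cmod (cintegral X \<mu> f - cintegral X \<nu> f) < \<delta>) \<longrightarrow> \<mu> \<in> U)"

text \<open>By induction on the generation of the open set: for an intersection the families of test
  functions are joined and the smaller radius is taken.\<close>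

lemma cone_topology_neighbourhood:
  assumes "openin (cone_topology X) U" and "\<nu> \<in> U"
  shows "\<exists>\<F> \<delta>. controls_nbhd X \<nu> \<F> \<delta> U"
proof -
  have "generate_topology_on {{\<mu> \<in> pos_measures X. cintegral X \<mu> (\<lambda>x. complex_of_real (f x)) \<in> W} |f W.
           f \<in> Cc_pos X \<union> {\<lambda>_. 1} \<and> open W} U"
    using assms(1) unfolding cone_topology_def by (rule openin_topology_generated_by)
  then show ?thesis using assms(2)
  proof (induction)
    case (Int a b)
    then obtain \<F> \<delta> \<G> \<epsilon> where "controls_nbhd X \<nu> \<F> \<delta> a" "controls_nbhd X \<nu> \<G> \<epsilon> b"
      by blast
    then have "controls_nbhd X \<nu> (\<F> \<union> \<G>) (min \<delta> \<epsilon>) (a \<inter> b)"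
      by (auto simp: controls_nbhd_def)
    then show ?case by blast
  next
    case (UN K)
    then obtain k \<F> \<delta> where "k \<in> K" "controls_nbhd X \<nu> \<F> \<delta> k" by blast
    then have "controls_nbhd X \<nu> \<F> \<delta> (\<Union>K)" by (auto simp: controls_nbhd_def)
    then show ?case by blast
  next
    case (Basis s)
    then obtain f W where s: "s = {\<mu> \<in> pos_measures X. cintegral X \<mu> (\<lambda>x. complex_of_real (f x)) \<in> W}"
      and f: "f \<in> Cc_pos X \<union> {\<lambda>_. 1}" and W: "open W"
      by (elim CollectE exE conjE) (rule that; assumption)
    have "cintegral X \<nu> (\<lambda>x. complex_of_real (f x)) \<in> W" using Basis s by auto
    then obtain \<delta> where \<delta>: "0 < \<delta>" "ball (cintegral X \<nu> (\<lambda>x. complex_of_real (f x))) \<delta> \<subseteq> W"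
      using W open_contains_ball by blast
    have "(\<lambda>x. complex_of_real (f x)) \<in> bounded_borel X" by (rule bounded_borel_cone_test[OF f])
    then show ?case
      using \<delta> by (intro exI[of _ "{\<lambda>x. complex_of_real (f x)}"] exI[of _ \<delta>])
        (auto simp: s controls_nbhd_def dist_norm norm_minus_commute)
  qed simp
qed

text \<open>Membership in M(X) is part of the conclusion because additivity in the induction step
  requires it.\<close>

lemma clinear_on_sum:
  assumes X: "Hausdorff_space X" and \<phi>: "clinear_on (regular_measures X) \<phi>"
    and "finite P" and "\<And>A. A \<in> P \<Longrightarrow> u A \<in> regular_measures X"
  shows "(\<lambda>s. \<Sum>A\<in>P. c A * u A s) \<in> regular_measures X \<and>
    \<phi> (\<lambda>s. \<Sum>A\<in>P. c A * u A s) = (\<Sum>A\<in>P. c A * \<phi> (u A))"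
  using assms(3,4)
proof (induction)
  case empty
  have "\<phi> (\<lambda>s. 0) = 0" using clinear_on_scale[OF \<phi> regular_measures_zero, of 0] by simp
  then show ?case by simp
next
  case (insert A P)
  then show ?case
    by (simp add: clinear_on_add[OF \<phi>] clinear_on_scale[OF \<phi>] regular_measures_add[OF _ _ X] regular_measures_scale)
qed

lemma pos_measures_sum:
  assumes X: "Hausdorff_space X" and "finite P"
    and "\<And>A. A \<in> P \<Longrightarrow> u A \<in> pos_measures X" "\<And>A. A \<in> P \<Longrightarrow> 0 \<le> c A"
  shows "(\<lambda>s. \<Sum>A\<in>P. c A * u A s) \<in> pos_measures X"
  using assms(2-)
  by (induction) (auto intro!: pos_measures_add[OF _ _ X] pos_measures_scale)

text \<open>The identity is clear for positive combinations of Dirac measures, and these are dense in the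
  cone topology.\<close>

lemma cone_continuous_eq_cintegral:
  assumes X: "Hausdorff_space X" and L: "clinear_on (regular_measures X) L"
    and Lc: "continuous_map (cone_topology X) euclidean L"
    and Lb: "\<And>y. y \<in> topspace X \<Longrightarrow> cmod (L (dirac X y)) \<le> B" and \<nu>: "\<nu> \<in> pos_measures X"
  shows "continuous_map X euclidean (\<lambda>y. L (dirac X y))"
    and "L \<nu> = cintegral X \<nu> (\<lambda>y. L (dirac X y))"
proof -
  let ?h = "\<lambda>y. L (dirac X y)"
  show hc: "continuous_map X euclidean ?h"
    using continuous_map_compose[OF continuous_map_dirac[OF X] Lc] by (simp add: o_def)
  have hb: "?h \<in> bounded_borel X" by (rule bounded_borel_continuous[OF hc Lb])
  have "L \<nu> - cintegral X \<nu> ?h = 0"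
  proof (rule eq_zero_if_small)
    fix \<epsilon> :: real assume \<epsilon>: "0 < \<epsilon>"
    let ?U = "{\<mu> \<in> topspace (cone_topology X). L \<mu> \<in> ball (L \<nu>) \<epsilon>}"
    have "openin (cone_topology X) ?U"
      using Lc unfolding continuous_map_def by auto
    moreover have "\<nu> \<in> ?U" using \<nu> \<epsilon> by simp
    ultimately obtain \<F> \<delta> where "controls_nbhd X \<nu> \<F> \<delta> ?U"
      using cone_topology_neighbourhood by blast
    then have \<F>: "finite \<F>" "\<F> \<subseteq> bounded_borel X" "0 < (\<delta>::real)"
      "\<And>\<mu>. \<mu> \<in> pos_measures X \<Longrightarrow> (\<forall>f\<in>\<F>. cmod (cintegral X \<mu> f - cintegral X \<nu> f) < \<delta>) \<Longrightarrow> \<mu> \<in> ?U"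
      unfolding controls_nbhd_def by simp_all
    \<comment> \<open>4 times the norm of \<nu> is the error constant of the Riemann sums; adding 1
      makes it positive and the final estimate strict.\<close>
    define C where "C = 4 * tv_norm X \<nu> + 1"
    define d where "d = min \<delta> \<epsilon> / C"
    have C: "1 \<le> C" by (simp add: C_def tv_norm_nonneg)
    have d: "0 < d" using \<F>(3) \<epsilon> C by (simp add: d_def)
    have dC: "d * (4 * tv_norm X \<nu>) < min \<delta> \<epsilon>"
    proof -
      have "d * (4 * tv_norm X \<nu>) < d * C" using d by (simp add: C_def)
      also have "\<dots> = min \<delta> \<epsilon>" using C by (simp add: d_def)
      finally show ?thesis .
    qed
    obtain P y where P: "finite P" "P \<subseteq> borel_sets X" "disjoint P" "\<Union>P = topspace X"
      and y: "\<And>A. A \<in> P \<Longrightarrow> y A \<in> A"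
      and close: "\<And>f A x. f \<in> insert ?h \<F> \<Longrightarrow> A \<in> P \<Longrightarrow> x \<in> A \<Longrightarrow> cmod (f x - f (y A)) \<le> d"
    proof -
      have "finite (insert ?h \<F>)" "insert ?h \<F> \<subseteq> bounded_borel X" using \<F> hb by auto
      from partition_approx[OF this d] show ?thesis using that by metis
    qed
    have yX: "y A \<in> topspace X" if "A \<in> P" for A using y[OF that] that P(4) by auto
    \<comment> \<open>The mass of each cell is moved to its sample point. The partition serves all
      functions at once: closeness for \<F> puts the new measure into the neighbourhood of \<nu>,
      and closeness for y \<mapsto> L (p_y) brings the value of L there near the integral.\<close>
    define \<nu>' where "\<nu>' = (\<lambda>s. \<Sum>A\<in>P. \<nu> A * dirac X (y A) s)"
    have dir: "dirac X (y A) \<in> pos_measures X" if "A \<in> P" for A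
      by (intro prob_measures_pos dirac_prob X yX that)
    have \<nu>': "\<nu>' \<in> pos_measures X"
      unfolding \<nu>'_def by (intro pos_measures_sum X P(1) dir pos_measures_nonneg[OF \<nu>])
    have sum: "\<phi> \<nu>' = (\<Sum>A\<in>P. \<nu> A * \<phi> (dirac X (y A)))" if "clinear_on (regular_measures X) \<phi>" for \<phi>
      unfolding \<nu>'_def
      by (rule conjunct2[OF clinear_on_sum[OF X that P(1)]]) (rule pos_measures_regular[OF dir])
    have apx: "cmod (cintegral X \<nu> f - (\<Sum>A\<in>P. \<nu> A * f (y A))) < min \<delta> \<epsilon>"
      if f: "f \<in> insert ?h \<F>" for f
    proof -
      have "cmod (cintegral X \<nu> f - (\<Sum>A\<in>P. \<nu> A * f (y A))) \<le> d * (4 * tv_norm X \<nu>)"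
        using f hb \<F>(2) by (intro cintegral_partition_approx X pos_measures_regular \<nu> P close less_imp_le[OF d]) auto
      then show ?thesis using dC by linarith
    qed
    have "cmod (cintegral X \<nu>' f - cintegral X \<nu> f) < \<delta>" if f: "f \<in> \<F>" for f
    proof -
      have fb: "f \<in> bounded_borel X" using f \<F>(2) by auto
      have "cintegral X \<nu>' f = (\<Sum>A\<in>P. \<nu> A * f (y A))"
        using sum[OF cintegral_clinear[OF X fb]] by (simp add: cintegral_dirac[OF X yX fb])
      then show ?thesis using apx[of f] f by (simp add: norm_minus_commute)
    qed
    then have "\<nu>' \<in> ?U" using \<F>(4)[OF \<nu>'] by blast
    then have "cmod (L \<nu> - L \<nu>') < \<epsilon>" by (simp add: dist_norm)
    moreover have "cmod (L \<nu>' - cintegral X \<nu> ?h) < \<epsilon>"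
      using apx[of ?h] unfolding sum[OF L] by (simp add: norm_minus_commute)
    ultimately show "cmod (L \<nu> - cintegral X \<nu> ?h) \<le> \<epsilon> * 2"
      using norm_triangle_ineq[of "L \<nu> - L \<nu>'" "L \<nu>' - cintegral X \<nu> ?h"] by simp
  qed
  then show "L \<nu> = cintegral X \<nu> ?h" by simp
qed

text \<open>The axioms behind the double integral formula, collected so that they can be verified a
  second time, for the convolution restricted to a closed subset. Bilinearity is stated for the
  value on each set E, which makes it a statement about complex functionals in the sense of
  \<open>clinear_on\<close>.\<close>

locale sep_cont_convolution =
  fixes X :: "'a topology" and conv :: "'a convolution"
  assumes Hausdorff: "Hausdorff_space X" and locally_compact: "locally_compact_space X"
    and conv_closed: "\<mu> \<in> regular_measures X \<Longrightarrow> \<nu> \<in> regular_measures X \<Longrightarrow> conv \<mu> \<nu> \<in> regular_measures X"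
    and conv_clinear_left: "\<nu> \<in> regular_measures X \<Longrightarrow> clinear_on (regular_measures X) (\<lambda>\<mu>. conv \<mu> \<nu> E)"
    and conv_clinear_right: "\<mu> \<in> regular_measures X \<Longrightarrow> clinear_on (regular_measures X) (\<lambda>\<nu>. conv \<mu> \<nu> E)"
    and conv_pos: "\<mu> \<in> pos_measures X \<Longrightarrow> \<nu> \<in> pos_measures X \<Longrightarrow> conv \<mu> \<nu> \<in> pos_measures X"
    and conv_cont_right: "\<mu> \<in> pos_measures X \<Longrightarrow> continuous_map (cone_topology X) (cone_topology X) (\<lambda>\<nu>. conv \<mu> \<nu>)"
    and conv_cont_left: "\<nu> \<in> pos_measures X \<Longrightarrow> continuous_map (cone_topology X) (cone_topology X) (\<lambda>\<mu>. conv \<mu> \<nu>)"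
    and conv_dirac: "x \<in> topspace X \<Longrightarrow> y \<in> topspace X \<Longrightarrow> conv (dirac X x) (dirac X y) \<in> prob_measures X"
begin

section \<open>The convolution as a double integral\<close>

lemma dirac_pos: "x \<in> topspace X \<Longrightarrow> dirac X x \<in> pos_measures X"
  by (intro prob_measures_pos dirac_prob Hausdorff)

lemma dirac_regular: "x \<in> topspace X \<Longrightarrow> dirac X x \<in> regular_measures X"
  by (intro pos_measures_regular dirac_pos)

lemma conv_add_left: "u \<in> regular_measures X \<Longrightarrow> v \<in> regular_measures X \<Longrightarrow> w \<in> regular_measures X \<Longrightarrow>
    conv (\<lambda>s. u s + v s) w = (\<lambda>s. conv u w s + conv v w s)"
  using clinear_on_add[OF conv_clinear_left] by (intro ext) blast

lemma conv_add_right: "u \<in> regular_measures X \<Longrightarrow> v \<in> regular_measures X \<Longrightarrow> w \<in> regular_measures X \<Longrightarrow>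
    conv w (\<lambda>s. u s + v s) = (\<lambda>s. conv w u s + conv w v s)"
  using clinear_on_add[OF conv_clinear_right] by (intro ext) blast

lemma conv_scale_left: "u \<in> regular_measures X \<Longrightarrow> w \<in> regular_measures X \<Longrightarrow>
    conv (\<lambda>s. c * u s) w = (\<lambda>s. c * conv u w s)"
  using clinear_on_scale[OF conv_clinear_left] by (intro ext) blast

lemma conv_scale_right: "u \<in> regular_measures X \<Longrightarrow> w \<in> regular_measures X \<Longrightarrow>
    conv w (\<lambda>s. c * u s) = (\<lambda>s. c * conv w u s)"
  using clinear_on_scale[OF conv_clinear_right] by (intro ext) blast

lemma cintegral_conv_clinear:
  assumes f: "f \<in> bounded_borel X"
  shows cintegral_conv_clinear_left: "\<nu> \<in> regular_measures X \<Longrightarrow>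
      clinear_on (regular_measures X) (\<lambda>\<mu>. cintegral X (conv \<mu> \<nu>) f)"
    and cintegral_conv_clinear_right: "\<mu> \<in> regular_measures X \<Longrightarrow>
      clinear_on (regular_measures X) (\<lambda>\<nu>. cintegral X (conv \<mu> \<nu>) f)"
  by (auto intro!: clinear_onI simp: conv_add_left conv_add_right conv_scale_left conv_scale_right conv_closed
      clinear_on_add[OF cintegral_clinear[OF Hausdorff f]] clinear_on_scale[OF cintegral_clinear[OF Hausdorff f]])

lemma cintegral_conv_continuous:
  assumes f: "continuous_map X euclidean f" and fb: "\<And>x. x \<in> topspace X \<Longrightarrow> cmod (f x) \<le> B"
  shows "\<mu> \<in> pos_measures X \<Longrightarrow> continuous_map (cone_topology X) euclidean (\<lambda>\<nu>. cintegral X (conv \<mu> \<nu>) f)"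
    and "\<nu> \<in> pos_measures X \<Longrightarrow> continuous_map (cone_topology X) euclidean (\<lambda>\<mu>. cintegral X (conv \<mu> \<nu>) f)"
proof -
  note c = cone_topology_continuous_bounded[OF Hausdorff locally_compact f fb]
  show "\<mu> \<in> pos_measures X \<Longrightarrow> continuous_map (cone_topology X) euclidean (\<lambda>\<nu>. cintegral X (conv \<mu> \<nu>) f)"
    using continuous_map_compose[OF conv_cont_right c] by (simp add: o_def)
  show "\<nu> \<in> pos_measures X \<Longrightarrow> continuous_map (cone_topology X) euclidean (\<lambda>\<mu>. cintegral X (conv \<mu> \<nu>) f)"
    using continuous_map_compose[OF conv_cont_left c] by (simp add: o_def)
qed

lemma cintegral_prob_le:
  assumes "\<mu> \<in> prob_measures X" "f \<in> bounded_borel X" "\<And>x. x \<in> topspace X \<Longrightarrow> cmod (f x) \<le> B"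
  shows "cmod (cintegral X \<mu> f) \<le> B"
  using cintegral_bound[OF Hausdorff prob_measures_pos[OF assms(1)] assms(2,3)] assms(1)
  by (simp add: prob_measures_def)

text \<open>The first integration: the representation of cone-continuous functionals is applied to
  \<mu> \<mapsto> \<integral> f d(\<mu> * p_y). Its values on Dirac measures are bounded because p_x
  * p_y is a probability measure.\<close>

lemma cintegral_conv_dirac_right:
  assumes f: "continuous_map X euclidean f" and fb: "\<And>x. x \<in> topspace X \<Longrightarrow> cmod (f x) \<le> B"
    and \<mu>: "\<mu> \<in> regular_measures X" and y: "y \<in> topspace X"
  shows "cintegral X (conv \<mu> (dirac X y)) f = cintegral X \<mu> (\<lambda>x. cintegral X (conv (dirac X x) (dirac X y)) f)"
    and "(\<lambda>x. cintegral X (conv (dirac X x) (dirac X y)) f) \<in> bounded_borel X"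
proof -
  have f': "f \<in> bounded_borel X" by (rule bounded_borel_continuous[OF f fb])
  let ?L = "\<lambda>\<mu>. cintegral X (conv \<mu> (dirac X y)) f"
  have Lb: "cmod (?L (dirac X x)) \<le> B" if "x \<in> topspace X" for x
    by (rule cintegral_prob_le[OF conv_dirac[OF that y] f' fb])
  have Ll: "clinear_on (regular_measures X) ?L" by (rule cintegral_conv_clinear_left[OF f' dirac_regular[OF y]])
  have Lc: "continuous_map (cone_topology X) euclidean ?L"
    by (rule cintegral_conv_continuous(2)[OF f _ dirac_pos[OF y]]) (rule fb)
  have c: "continuous_map X euclidean (\<lambda>x. ?L (dirac X x))"
    by (rule cone_continuous_eq_cintegral(1)[OF Hausdorff Ll Lc _ pos_measures_zero]) (rule Lb)
  show b: "(\<lambda>x. ?L (dirac X x)) \<in> bounded_borel X"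
    by (rule bounded_borel_continuous[OF c Lb])
  show "?L \<mu> = cintegral X \<mu> (\<lambda>x. ?L (dirac X x))"
    by (rule clinear_on_eqI[OF Hausdorff Ll cintegral_clinear[OF Hausdorff b] _ \<mu>])
       (rule cone_continuous_eq_cintegral(2)[OF Hausdorff Ll Lc Lb])
qed

text \<open>The first integration with f = 1. It supplies the bound on Dirac measures that the
  second integration requires.\<close>

lemma conv_dirac_mass:
  assumes "\<mu> \<in> pos_measures X" "y \<in> topspace X"
  shows "conv \<mu> (dirac X y) (topspace X) = \<mu> (topspace X)"
proof -
  have "conv \<mu> (dirac X y) (topspace X) = cintegral X (conv \<mu> (dirac X y)) (\<lambda>_. 1)"
    using cintegral_const[OF Hausdorff conv_pos[OF assms(1) dirac_pos[OF assms(2)]], of 1] by simp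
  also have "\<dots> = cintegral X \<mu> (\<lambda>x. cintegral X (conv (dirac X x) (dirac X y)) (\<lambda>_. 1))"
    using assms by (intro cintegral_conv_dirac_right[where B = 1] pos_measures_regular) auto
  also have "\<dots> = cintegral X \<mu> (\<lambda>_. 1)"
    using cintegral_const[OF Hausdorff prob_measures_pos[OF conv_dirac[OF _ assms(2)]], of _ 1] conv_dirac[OF _ assms(2)]
    by (intro cintegral_cong) (simp add: prob_measures_def)
  also have "\<dots> = \<mu> (topspace X)" by (simp add: cintegral_const[OF Hausdorff assms(1)])
  finally show ?thesis .
qed

text \<open>The second integration. Continuity in \<nu> is available for positive \<mu> only, so a
  general \<mu> is split into its Jordan parts. The inner integral is then a combination of four
  continuous functions, which makes the right-hand side linear in \<mu> as well.\<close>

lemma cintegral_conv_right: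
  assumes f: "continuous_map X euclidean f" and fb: "\<And>x. x \<in> topspace X \<Longrightarrow> cmod (f x) \<le> B"
    and \<mu>: "\<mu> \<in> regular_measures X" and \<nu>: "\<nu> \<in> regular_measures X"
  shows "cintegral X (conv \<mu> \<nu>) f = cintegral X \<nu> (\<lambda>y. cintegral X (conv \<mu> (dirac X y)) f)"
    and "(\<lambda>y. cintegral X (conv \<mu> (dirac X y)) f) \<in> bounded_borel X"
proof -
  have f': "f \<in> bounded_borel X" by (rule bounded_borel_continuous[OF f fb])
  have Lb: "cmod (cintegral X (conv \<mu> (dirac X y)) f) \<le> B * Re (\<mu> (topspace X))"
    if "\<mu> \<in> pos_measures X" "y \<in> topspace X" for \<mu> y
    using cintegral_bound[OF Hausdorff conv_pos[OF that(1) dirac_pos[OF that(2)]] f' fb]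
    by (simp add: conv_dirac_mass[OF that])
  have Ll: "clinear_on (regular_measures X) (\<lambda>\<nu>. cintegral X (conv \<mu> \<nu>) f)" if "\<mu> \<in> pos_measures X" for \<mu>
    by (rule cintegral_conv_clinear_right[OF f' pos_measures_regular[OF that]])
  have Lc: "continuous_map (cone_topology X) euclidean (\<lambda>\<nu>. cintegral X (conv \<mu> \<nu>) f)" if "\<mu> \<in> pos_measures X" for \<mu>
    by (rule cintegral_conv_continuous(1)[OF f _ that]) (rule fb)
  have b: "(\<lambda>y. cintegral X (conv \<mu> (dirac X y)) f) \<in> bounded_borel X" if \<mu>: "\<mu> \<in> pos_measures X" for \<mu>
  proof (rule bounded_borel_continuous)
    show "continuous_map X euclidean (\<lambda>y. cintegral X (conv \<mu> (dirac X y)) f)"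
      by (rule cone_continuous_eq_cintegral(1)[OF Hausdorff Ll[OF \<mu>] Lc[OF \<mu>] _ pos_measures_zero]) (rule Lb[OF \<mu>])
  qed (rule Lb[OF \<mu>])
  have pos: "cintegral X (conv \<mu> \<nu>) f = cintegral X \<nu> (\<lambda>y. cintegral X (conv \<mu> (dirac X y)) f)"
    if \<mu>: "\<mu> \<in> pos_measures X" and \<nu>: "\<nu> \<in> regular_measures X" for \<mu> \<nu>
    by (rule clinear_on_eqI[OF Hausdorff Ll[OF \<mu>] cintegral_clinear[OF Hausdorff b[OF \<mu>]] _ \<nu>])
       (rule cone_continuous_eq_cintegral(2)[OF Hausdorff Ll[OF \<mu>] Lc[OF \<mu>] Lb[OF \<mu>]])
  have b': "(\<lambda>y. cintegral X (conv \<mu> (dirac X y)) f) \<in> bounded_borel X" if \<mu>: "\<mu> \<in> regular_measures X" for \<mu>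
  proof -
    let ?J = "\<lambda>c y. cintegral X (conv (jordan X (\<lambda>s. c * \<mu> s)) (dirac X y)) f"
    have J: "?J c \<in> bounded_borel X" for c by (intro b jordan_pos Hausdorff regular_measures_scale \<mu>)
    have "(\<lambda>y. (?J 1 y - ?J (-1) y) + \<i> * (?J (-\<i>) y - ?J \<i> y)) \<in> bounded_borel X"
      by (intro bounded_borel_add bounded_borel_diff bounded_borel_mult J bounded_borel_const)
    moreover have "cintegral X (conv \<mu> (dirac X y)) f = (?J 1 y - ?J (-1) y) + \<i> * (?J (-\<i>) y - ?J \<i> y)"
      if "y \<in> space (borel_space X)" for y
      using clinear_on_jordan[OF Hausdorff cintegral_conv_clinear_left[OF f' dirac_regular] \<mu>, of y] that by simp
    ultimately show ?thesis
      using bounded_borel_cong[of X "\<lambda>y. cintegral X (conv \<mu> (dirac X y)) f"] by simp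
  qed
  have "clinear_on (regular_measures X) (\<lambda>\<mu>. cintegral X \<nu> (\<lambda>y. cintegral X (conv \<mu> (dirac X y)) f))"
  proof (rule clinear_onI)
    fix u v assume uv: "u \<in> regular_measures X" "v \<in> regular_measures X"
    have "cintegral X \<nu> (\<lambda>y. cintegral X (conv (\<lambda>s. u s + v s) (dirac X y)) f) =
      cintegral X \<nu> (\<lambda>y. cintegral X (conv u (dirac X y)) f + cintegral X (conv v (dirac X y)) f)"
      using uv by (intro cintegral_cong clinear_on_add[OF cintegral_conv_clinear_left[OF f' dirac_regular]])
    then show "cintegral X \<nu> (\<lambda>y. cintegral X (conv (\<lambda>s. u s + v s) (dirac X y)) f) =
      cintegral X \<nu> (\<lambda>y. cintegral X (conv u (dirac X y)) f) + cintegral X \<nu> (\<lambda>y. cintegral X (conv v (dirac X y)) f)"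
      using cintegral_add[OF Hausdorff \<nu> b'[OF uv(1)] b'[OF uv(2)]] by simp
  next
    fix c :: complex and u assume u: "u \<in> regular_measures X"
    have "cintegral X \<nu> (\<lambda>y. cintegral X (conv (\<lambda>s. c * u s) (dirac X y)) f) =
      cintegral X \<nu> (\<lambda>y. c * cintegral X (conv u (dirac X y)) f)"
      using u by (intro cintegral_cong clinear_on_scale[OF cintegral_conv_clinear_left[OF f' dirac_regular]])
    then show "cintegral X \<nu> (\<lambda>y. cintegral X (conv (\<lambda>s. c * u s) (dirac X y)) f) =
      c * cintegral X \<nu> (\<lambda>y. cintegral X (conv u (dirac X y)) f)"
      using cintegral_cmult[OF Hausdorff \<nu> b'[OF u]] by simp
  qed
  then show "cintegral X (conv \<mu> \<nu>) f = cintegral X \<nu> (\<lambda>y. cintegral X (conv \<mu> (dirac X y)) f)"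
    by (rule clinear_on_eqI[OF Hausdorff cintegral_conv_clinear_left[OF f' \<nu>] _ pos[OF _ \<nu>] \<mu>])
  show "(\<lambda>y. cintegral X (conv \<mu> (dirac X y)) f) \<in> bounded_borel X" by (rule b'[OF \<mu>])
qed

lemma cintegral_conv:
  assumes f: "continuous_map X euclidean f" and fb: "\<And>x. x \<in> topspace X \<Longrightarrow> cmod (f x) \<le> B"
    and \<mu>: "\<mu> \<in> regular_measures X" and \<nu>: "\<nu> \<in> regular_measures X"
  shows "cintegral X (conv \<mu> \<nu>) f =
    cintegral X \<nu> (\<lambda>y. cintegral X \<mu> (\<lambda>x. cintegral X (conv (dirac X x) (dirac X y)) f))"
proof -
  have "cintegral X (conv \<mu> \<nu>) f = cintegral X \<nu> (\<lambda>y. cintegral X (conv \<mu> (dirac X y)) f)"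
    by (rule cintegral_conv_right(1)[OF f _ \<mu> \<nu>]) (rule fb)
  also have "\<dots> = cintegral X \<nu> (\<lambda>y. cintegral X \<mu> (\<lambda>x. cintegral X (conv (dirac X x) (dirac X y)) f))"
    by (intro cintegral_cong cintegral_conv_dirac_right(1)[OF f _ \<mu>]) (rule fb)
  finally show ?thesis .
qed

text \<open>Both integrations with f = 1. This bounds translates of functionals, and it shows that
  mass convolved inside a closed sub-semihypergroup is neither lost nor gained.\<close>

lemma conv_mass:
  assumes \<mu>: "\<mu> \<in> pos_measures X" and \<nu>: "\<nu> \<in> pos_measures X"
  shows "conv \<mu> \<nu> (topspace X) = \<mu> (topspace X) * \<nu> (topspace X)"
proof -
  have "conv \<mu> \<nu> (topspace X) = cintegral X (conv \<mu> \<nu>) (\<lambda>_. 1)"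
    using cintegral_const[OF Hausdorff conv_pos[OF \<mu> \<nu>], of 1] by simp
  also have "\<dots> = cintegral X \<nu> (\<lambda>y. cintegral X (conv \<mu> (dirac X y)) (\<lambda>_. 1))"
    by (intro cintegral_conv_right[where B = 1] pos_measures_regular \<mu> \<nu>) auto
  also have "\<dots> = cintegral X \<nu> (\<lambda>_. \<mu> (topspace X))"
    by (intro cintegral_cong)
       (simp add: cintegral_const[OF Hausdorff conv_pos[OF \<mu> dirac_pos]] conv_dirac_mass[OF \<mu>])
  also have "\<dots> = \<mu> (topspace X) * \<nu> (topspace X)"
    by (simp add: cintegral_const[OF Hausdorff \<nu>])
  finally show ?thesis .
qed

end

text \<open>The uniqueness half of the Riesz representation theorem. A single cutoff between C
  \<union> D and U \<inter> V approximates the indicator of E for both measures.\<close>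

lemma pos_measures_eqI:
  assumes X: "Hausdorff_space X" "locally_compact_space X" and p: "p \<in> pos_measures X" and q: "q \<in> pos_measures X"
    and eq: "\<And>g. g \<in> Cc_pos X \<Longrightarrow> cintegral X p (\<lambda>x. complex_of_real (g x)) = cintegral X q (\<lambda>x. complex_of_real (g x))"
  shows "p = q"
proof
  fix E show "p E = q E"
  proof (cases "E \<in> borel_sets X")
    case E: True
    have "p E - q E = 0"
    proof (rule eq_zero_if_small)
      fix e :: real assume e: "0 < e"
      obtain C U where CU: "compactin X C" "openin X U" "C \<subseteq> E" "E \<subseteq> U" "total_variation X p (U - C) < ennreal e"
        using regular_measures_regular[OF pos_measures_regular[OF p] E e] by auto
      obtain D V where DV: "compactin X D" "openin X V" "D \<subseteq> E" "E \<subseteq> V" "total_variation X q (V - D) < ennreal e"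
        using regular_measures_regular[OF pos_measures_regular[OF q] E e] by auto
      note b = borel_sets_compactin[OF X(1) CU(1)] borel_sets_compactin[OF X(1) DV(1)]
        borel_sets_openin[OF CU(2)] borel_sets_openin[OF DV(2)]
      obtain g where g: "g \<in> Cc_pos X" and g01: "\<And>x. x \<in> topspace X \<Longrightarrow> 0 \<le> g x \<and> g x \<le> 1"
        and g1: "\<And>x. x \<in> C \<union> D \<Longrightarrow> g x = 1" and g0: "\<And>x. x \<in> topspace X - (U \<inter> V) \<Longrightarrow> g x = 0"
      proof -
        have "compactin X (C \<union> D)" "openin X (U \<inter> V)" "C \<union> D \<subseteq> U \<inter> V"
          using CU DV by (auto intro: compactin_Un)
        from Cc_pos_cutoff[OF X this] show ?thesis using that by metis
      qed
      \<comment> \<open>The cutoff and the indicator of E agree on C \<union> D and off U \<inter>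
        V. The set F is U - C for the first measure and V - D for the second; both contain the
        region of possible disagreement.\<close>
      have near: "cmod (cintegral X r (\<lambda>x. complex_of_real (g x)) - r E) \<le> e"
        if r: "r \<in> pos_measures X" and F: "F \<in> borel_sets X" "U \<inter> V - (C \<union> D) \<subseteq> F" "total_variation X r F < ennreal e"
        for r F
      proof -
        note Eb = bounded_borel_indicator[OF E] and Fb = bounded_borel_indicator[OF F(1)] and gb = bounded_borel_Cc_pos[OF g]
        have "cintegral X r (\<lambda>x. complex_of_real (g x)) - r E = cintegral X r (\<lambda>x. complex_of_real (g x) - indicator E x)"
          by (simp add: cintegral_diff[OF X(1) pos_measures_regular[OF r] gb Eb] cintegral_indicator[OF X(1) r E])
        also have "cmod \<dots> \<le> Re (cintegral X r (\<lambda>x. complex_of_real (indicator F x)))"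
        proof (rule cintegral_dominated[OF X(1) r])
          show "(\<lambda>x. complex_of_real (g x) - indicator E x) \<in> bounded_borel X" by (intro bounded_borel_diff gb Eb)
          show "(\<lambda>x. complex_of_real (indicator F x)) \<in> bounded_borel X" using Fb by (simp add: of_real_indicator)
          fix x assume x: "x \<in> topspace X"
          have "complex_of_real (g x) - indicator E x = complex_of_real (g x - indicator E x)"
            by (simp add: of_real_indicator)
          then have "cmod (complex_of_real (g x) - indicator E x) = \<bar>g x - indicator E x\<bar>"
            by (simp only: norm_of_real)
          also have "\<dots> \<le> indicator F x"
          proof (cases "x \<in> F")
            case True
            then show ?thesis using g01[OF x] by (simp add: indicator_def)
          next
            case False
            then have "x \<in> C \<union> D \<or> x \<in> topspace X - (U \<inter> V)" using F(2) x by auto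
            then show ?thesis using g1[of x] g0[of x] CU DV False by (auto simp: indicator_def)
          qed
          finally show "cmod (complex_of_real (g x) - indicator E x) \<le> indicator F x" .
        qed
        also have "\<dots> = Re (r F)" by (simp add: of_real_indicator cintegral_indicator[OF X(1) r F(1)])
        also have "\<dots> \<le> cmod (r F)" by (rule complex_Re_le_cmod)
        also have "\<dots> \<le> e"
        proof -
          have "ennreal (cmod (r F)) < ennreal e"
            using cmod_le_total_variation[OF F(1), of r] F(3) by (rule le_less_trans)
          then show ?thesis using e by (simp add: ennreal_less_iff)
        qed
        finally show ?thesis .
      qed
      have "cmod (cintegral X p (\<lambda>x. complex_of_real (g x)) - p E) \<le> e"
        using near[OF p borel_sets_Diff[OF b(3,1)] _ CU(5)] by auto
      moreover have "cmod (cintegral X p (\<lambda>x. complex_of_real (g x)) - q E) \<le> e"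
        using near[OF q borel_sets_Diff[OF b(4,2)] _ DV(5)] unfolding eq[OF g] by auto
      ultimately show "cmod (p E - q E) \<le> e * 2"
        using norm_triangle_ineq4[of "cintegral X p (\<lambda>x. complex_of_real (g x)) - q E" "cintegral X p (\<lambda>x. complex_of_real (g x)) - p E"]
        by simp
    qed
    then show ?thesis by simp
  qed (simp add: regular_measures_off[OF pos_measures_regular[OF p]] regular_measures_off[OF pos_measures_regular[OF q]])
qed

lemma cintegral_pos_real:
  assumes X: "Hausdorff_space X" and p: "p \<in> pos_measures X" and g: "(\<lambda>x. complex_of_real (g x)) \<in> bounded_borel X"
  shows "Im (cintegral X p (\<lambda>x. complex_of_real (g x))) = 0"
  by (simp add: cintegral_pos[OF X p g])

text \<open>Integrals of a real function against the four Jordan parts of the difference are real.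
  If their combination vanishes, the parts of Re and those of Im therefore cancel separately, and
  uniqueness for positive measures applies to each pair.\<close>

lemma regular_measures_eqI:
  assumes X: "Hausdorff_space X" "locally_compact_space X" and \<mu>: "\<mu> \<in> regular_measures X" and \<nu>: "\<nu> \<in> regular_measures X"
    and eq: "\<And>g. g \<in> Cc_pos X \<Longrightarrow> cintegral X \<mu> (\<lambda>x. complex_of_real (g x)) = cintegral X \<nu> (\<lambda>x. complex_of_real (g x))"
  shows "\<mu> = \<nu>"
proof
  fix E
  define \<rho> where "\<rho> = (\<lambda>s. \<mu> s + (-1) * \<nu> s)"
  have \<rho>: "\<rho> \<in> regular_measures X" unfolding \<rho>_def by (intro regular_measures_add regular_measures_scale \<mu> \<nu> X)
  let ?J = "\<lambda>c. jordan X (\<lambda>s. c * \<rho> s)"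
  have J: "?J c \<in> pos_measures X" for c by (intro jordan_pos X regular_measures_scale \<rho>)
  have *: "cintegral X (?J 1) (\<lambda>x. complex_of_real (g x)) = cintegral X (?J (-1)) (\<lambda>x. complex_of_real (g x)) \<and>
     cintegral X (?J (-\<i>)) (\<lambda>x. complex_of_real (g x)) = cintegral X (?J \<i>) (\<lambda>x. complex_of_real (g x))"
    if g: "g \<in> Cc_pos X" for g
  proof -
    note gb = bounded_borel_Cc_pos[OF g]
    note lin = cintegral_clinear[OF X(1) gb]
    have "cintegral X \<rho> (\<lambda>x. complex_of_real (g x)) = 0"
      unfolding \<rho>_def by (simp only: clinear_on_add[OF lin \<mu> regular_measures_scale[OF \<nu>]] clinear_on_scale[OF lin \<nu>] eq[OF g]) simp
    then show ?thesis
      using clinear_on_jordan[OF X(1) lin \<rho>] cintegral_pos_real[OF X(1) J gb, of 1] cintegral_pos_real[OF X(1) J gb, of "-1"]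
       cintegral_pos_real[OF X(1) J gb, of "-\<i>"] cintegral_pos_real[OF X(1) J gb, of "\<i>"]
      by (simp add: complex_eq_iff)
  qed
  have "?J 1 = ?J (-1)" "?J (-\<i>) = ?J \<i>"
    by (rule pos_measures_eqI[OF X J J], use * in blast)+
  then have "\<rho> E = 0" using jordan_decomposition[OF X(1) \<rho>, of E] by simp
  then show "\<mu> E = \<nu> E" by (simp add: \<rho>_def)
qed

section \<open>Measures on a closed subspace\<close>

definition res_measure :: "'a topology \<Rightarrow> 'a set \<Rightarrow> ('a set \<Rightarrow> complex) \<Rightarrow> 'a set \<Rightarrow> complex" where
  "res_measure X H \<nu> = (\<lambda>E. if E \<in> borel_sets (subtopology X H) then \<nu> E else 0)"

text \<open>The image of \<sigma> under the inclusion of H.\<close>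

definition ext_measure :: "'a topology \<Rightarrow> 'a set \<Rightarrow> ('a set \<Rightarrow> complex) \<Rightarrow> 'a set \<Rightarrow> complex" where
  "ext_measure X H \<sigma> = (\<lambda>E. if E \<in> borel_sets X then \<sigma> (E \<inter> H) else 0)"

lemma res_measure_add: "res_measure X H (\<lambda>s. u s + v s) = (\<lambda>s. res_measure X H u s + res_measure X H v s)"
  and res_measure_scale: "res_measure X H (\<lambda>s. c * u s) = (\<lambda>s. c * res_measure X H u s)"
  and ext_measure_add: "ext_measure X H (\<lambda>s. u s + v s) = (\<lambda>s. ext_measure X H u s + ext_measure X H v s)"
  and ext_measure_scale: "ext_measure X H (\<lambda>s. c * u s) = (\<lambda>s. c * ext_measure X H u s)"
  by (auto simp: res_measure_def ext_measure_def)

text \<open>The complement of the support is a union of null open sets, but possibly an uncountable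
  one. Inner regularity reduces E to a compact subset, for which finitely many of them
  suffice.\<close>

lemma measure_eq_0_if_msupp_disjoint:
  assumes X: "Hausdorff_space X" and \<nu>: "\<nu> \<in> regular_measures X" and E: "E \<in> borel_sets X"
    and disj: "msupp X \<nu> \<inter> E = {}"
  shows "\<nu> E = 0"
proof (rule eq_zero_if_small)
  fix e :: real assume e: "0 < e"
  note ca = regular_measures_ca[OF \<nu>]
  obtain C U where CU: "compactin X C" "openin X U" "C \<subseteq> E" "E \<subseteq> U" "total_variation X \<nu> (U - C) < ennreal e"
    using regular_measures_regular[OF \<nu> E e] by auto
  have b: "C \<in> borel_sets X" "U \<in> borel_sets X" using CU X by (auto intro: borel_sets_compactin borel_sets_openin)
  obtain W where W: "openin X W" "C \<subseteq> W" "total_variation X \<nu> W = 0"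
  proof (rule compactin_open_cover_property[OF CU(1), where P = "\<lambda>U. total_variation X \<nu> U = 0"])
    show "\<exists>V. openin X V \<and> x \<in> V \<and> total_variation X \<nu> V = 0" if "x \<in> C" for x
    proof -
      have "x \<in> topspace X" "x \<notin> msupp X \<nu>"
        using that CU disj compactin_subset_topspace by blast+
      then show ?thesis by (auto simp: msupp_def)
    qed
    show "total_variation X \<nu> (U \<union> V) = 0"
      if "openin X U" "openin X V" "total_variation X \<nu> U = 0" "total_variation X \<nu> V = 0" for U V
      using total_variation_Un[OF ca borel_sets_openin[OF that(1)] borel_sets_openin[OF that(2)]] that by simp
  qed (simp_all add: total_variation_empty[OF ca] that)
  have "ennreal (cmod (\<nu> C)) \<le> total_variation X \<nu> C" by (rule cmod_le_total_variation[OF b(1)])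
  also have "\<dots> \<le> total_variation X \<nu> W"
    by (rule total_variation_mono[OF b(1) borel_sets_openin[OF W(1)] W(2)])
  finally have C0: "\<nu> C = 0" using W(3) by simp
  have EC: "E - C \<in> borel_sets X" by (rule borel_sets_Diff[OF E b(1)])
  have "\<nu> E = \<nu> (E - C)" using countably_additive_Diff[OF ca E b(1) CU(3)] C0 by simp
  moreover have "ennreal (cmod (\<nu> (E - C))) < ennreal e"
  proof -
    have "ennreal (cmod (\<nu> (E - C))) \<le> total_variation X \<nu> (E - C)" by (rule cmod_le_total_variation[OF EC])
    also have "\<dots> \<le> total_variation X \<nu> (U - C)"
      using CU by (intro total_variation_mono EC borel_sets_Diff b) auto
    finally show ?thesis using CU(5) by (rule le_less_trans)
  qed
  ultimately show "cmod (\<nu> E) \<le> e * 1" using e by (simp add: ennreal_less_iff)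
qed

locale closed_subspace =
  fixes X :: "'a topology" and H :: "'a set"
  assumes Haus: "Hausdorff_space X" and lc: "locally_compact_space X" and closed: "closedin X H"
begin

abbreviation "Y \<equiv> subtopology X H"
abbreviation "res \<equiv> res_measure X H"
abbreviation "ext \<equiv> ext_measure X H"

lemma H_subset: "H \<subseteq> topspace X" using closed closedin_subset by blast

lemma topspace_Y: "topspace Y = H" using H_subset by auto

lemma Haus_Y: "Hausdorff_space Y" by (simp add: Hausdorff_space_subtopology Haus)

lemma lc_Y: "locally_compact_space Y" by (rule locally_compact_space_closed_subset[OF lc closed])

lemma H_borel: "H \<in> borel_sets X" by (rule borel_sets_closedin[OF closed])

lemma Hc_borel: "topspace X - H \<in> borel_sets X" by (intro borel_sets_Diff H_borel) auto

text \<open>Two inductions over the generation of Borel sets: one uses that H is itself Borel, the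
  other shows that traces on H of Borel sets are Borel in H.\<close>

lemma borel_sets_subspace: "E \<in> borel_sets Y \<longleftrightarrow> E \<in> borel_sets X \<and> E \<subseteq> H"
proof
  assume E: "E \<in> borel_sets Y"
  have "E \<in> borel_sets X" using E unfolding borel_sets_def[of Y]
  proof (induction rule: sigma_sets.induct)
    case (Basic a)
    then obtain U where "openin X U" "a = U \<inter> H" by (auto simp: openin_subtopology)
    then show ?case by (auto intro!: borel_sets_Int H_borel intro: borel_sets_openin)
  next
    case (Compl a)
    then show ?case unfolding topspace_Y by (intro borel_sets_Diff H_borel)
  next
    case (Union a)
    then show ?case by (intro borel_sets_UN) auto
  qed simp
  then show "E \<in> borel_sets X \<and> E \<subseteq> H" using borel_sets_subset[OF E] topspace_Y by auto
next
  have "E \<inter> H \<in> borel_sets Y" if "E \<in> borel_sets X" for E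
    using that unfolding borel_sets_def[of X]
  proof (induction rule: sigma_sets.induct)
    case (Basic a)
    then show ?case by (intro borel_sets_openin) (auto simp: openin_subtopology)
  next
    case (Compl a)
    have "(topspace X - a) \<inter> H = topspace Y - a \<inter> H" using H_subset topspace_Y by auto
    then show ?case using Compl by (simp only: borel_sets_Diff borel_sets_topspace)
  next
    case (Union a)
    have "(\<Union>i. a i) \<inter> H = (\<Union>i. a i \<inter> H)" by auto
    moreover have "(\<Union>i. a i \<inter> H) \<in> borel_sets Y" using Union by (intro borel_sets_UN) auto
    ultimately show ?case by (simp only:)
  qed simp
  moreover assume "E \<in> borel_sets X \<and> E \<subseteq> H"
  ultimately show "E \<in> borel_sets Y" by (metis inf.absorb1)
qed

lemma borel_sets_Int_subspace: "E \<in> borel_sets X \<Longrightarrow> E \<inter> H \<in> borel_sets Y"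
  by (simp add: borel_sets_subspace borel_sets_Int H_borel)

lemma res_regular:
  assumes \<nu>: "\<nu> \<in> regular_measures X"
  shows "res \<nu> \<in> regular_measures Y"
  unfolding regular_measures_iff
proof (intro conjI allI impI ballI)
  show "countably_additive_on Y (res \<nu>)"
    unfolding countably_additive_on_def
  proof (intro allI impI)
    fix A :: "nat \<Rightarrow> 'a set" assume A: "range A \<subseteq> borel_sets Y" "disjoint_family A"
    have AY: "A i \<in> borel_sets Y" for i using A(1) by auto
    then have "range A \<subseteq> borel_sets X" using borel_sets_subspace by auto
    then show "(\<lambda>i. res \<nu> (A i)) sums res \<nu> (\<Union>i. A i)"
      using regular_measures_sums[OF \<nu> _ A(2)] borel_sets_UN[OF A(1)] AY by (simp add: res_measure_def)
  qed
  fix E e assume E: "E \<in> borel_sets Y" and e: "0 < (e::real)"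
  then have EX: "E \<in> borel_sets X" "E \<subseteq> H" by (auto simp: borel_sets_subspace)
  obtain C U where CU: "compactin X C" "openin X U" "C \<subseteq> E" "E \<subseteq> U" "total_variation X \<nu> (U - C) < ennreal e"
    using regular_measures_regular[OF \<nu> EX(1) e] by auto
  have b: "C \<in> borel_sets X" "U \<in> borel_sets X" using CU Haus by (auto intro: borel_sets_compactin borel_sets_openin)
  have "total_variation Y (res \<nu>) (U \<inter> H - C) \<le> total_variation X \<nu> (U \<inter> H - C)"
  proof (rule total_variation_least)
    fix A :: "nat \<Rightarrow> 'a set" assume A: "range A \<subseteq> borel_sets Y" "disjoint_family A" "(\<Union>i. A i) = U \<inter> H - C"
    have AY: "A i \<in> borel_sets Y" for i using A(1) by auto
    then have AX: "range A \<subseteq> borel_sets X" using borel_sets_subspace by auto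
    have "(\<Sum>i. ennreal (cmod (res \<nu> (A i)))) = (\<Sum>i. ennreal (cmod (\<nu> (A i))))"
      using AY by (simp add: res_measure_def)
    also have "\<dots> \<le> total_variation X \<nu> (U \<inter> H - C)" by (rule total_variation_upper[OF AX A(2,3)])
    finally show "(\<Sum>i. ennreal (cmod (res \<nu> (A i)))) \<le> total_variation X \<nu> (U \<inter> H - C)" .
  qed
  also have "\<dots> \<le> total_variation X \<nu> (U - C)"
    using b H_borel by (intro total_variation_mono borel_sets_intros) auto
  finally have "total_variation Y (res \<nu>) (U \<inter> H - C) < ennreal e" using CU(5) by (rule le_less_trans)
  moreover have "compactin Y C" using CU EX by (simp add: compactin_subtopology)
  moreover have "openin Y (U \<inter> H)" using CU by (auto simp: openin_subtopology)
  ultimately show "\<exists>C U. compactin Y C \<and> openin Y U \<and> C \<subseteq> E \<and> E \<subseteq> U \<and> total_variation Y (res \<nu>) (U - C) < ennreal e"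
    using CU EX by (intro exI[of _ C] exI[of _ "U \<inter> H"]) auto
qed (simp add: res_measure_def)

lemma ext_regular:
  assumes \<sigma>: "\<sigma> \<in> regular_measures Y"
  shows "ext \<sigma> \<in> regular_measures X"
  unfolding regular_measures_iff
proof (intro conjI allI impI ballI)
  have AH: "range (\<lambda>i. A i \<inter> H) \<subseteq> borel_sets Y" "disjoint_family (\<lambda>i. A i \<inter> H)" "(\<Union>i. A i \<inter> H) = (\<Union>i. A i) \<inter> H"
    if "range A \<subseteq> borel_sets X" "disjoint_family A" for A :: "nat \<Rightarrow> 'a set"
  proof -
    have "A i \<in> borel_sets X" for i using that(1) by auto
    then show "range (\<lambda>i. A i \<inter> H) \<subseteq> borel_sets Y" using borel_sets_Int_subspace by auto
    show "disjoint_family (\<lambda>i. A i \<inter> H)" using that(2) unfolding disjoint_family_on_def by blast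
  qed auto
  show "countably_additive_on X (ext \<sigma>)"
    unfolding countably_additive_on_def
  proof (intro allI impI)
    fix A :: "nat \<Rightarrow> 'a set" assume A: "range A \<subseteq> borel_sets X" "disjoint_family A"
    have AX: "A i \<in> borel_sets X" for i using A(1) by auto
    then show "(\<lambda>i. ext \<sigma> (A i)) sums ext \<sigma> (\<Union>i. A i)"
      using regular_measures_sums[OF \<sigma> AH(1,2)[OF A]] borel_sets_UN[OF A(1)] AH(3)[OF A] by (simp add: ext_measure_def)
  qed
  fix E e assume E: "E \<in> borel_sets X" and e: "0 < (e::real)"
  obtain C V where CV: "compactin Y C" "openin Y V" "C \<subseteq> E \<inter> H" "E \<inter> H \<subseteq> V" "total_variation Y \<sigma> (V - C) < ennreal e"
    using regular_measures_regular[OF \<sigma> borel_sets_Int_subspace[OF E] e] by auto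
  obtain W where W: "openin X W" "V = W \<inter> H" using CV(2) by (auto simp: openin_subtopology)
  \<comment> \<open>The whole complement of H may be added: it is open because H is closed, it
    carries no mass of the extended measure, and it covers the part of E outside H.\<close>
  let ?U = "W \<union> (topspace X - H)"
  have U: "openin X ?U" using W closed by (auto intro: openin_Un)
  have VC: "(?U - C) \<inter> H = V - C" using W by auto
  have "total_variation X (ext \<sigma>) (?U - C) \<le> total_variation Y \<sigma> (V - C)"
  proof (rule total_variation_least)
    fix A :: "nat \<Rightarrow> 'a set" assume A: "range A \<subseteq> borel_sets X" "disjoint_family A" "(\<Union>i. A i) = ?U - C"
    have AX: "A i \<in> borel_sets X" for i using A(1) by auto
    then have "(\<Sum>i. ennreal (cmod (ext \<sigma> (A i)))) = (\<Sum>i. ennreal (cmod (\<sigma> (A i \<inter> H))))"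
      by (simp add: ext_measure_def)
    also have "\<dots> \<le> total_variation Y \<sigma> (V - C)"
      by (rule total_variation_upper[OF AH(1,2)[OF A(1,2)]]) (use AH(3)[OF A(1,2)] A(3) VC in simp)
    finally show "(\<Sum>i. ennreal (cmod (ext \<sigma> (A i)))) \<le> total_variation Y \<sigma> (V - C)" .
  qed
  then have "total_variation X (ext \<sigma>) (?U - C) < ennreal e" using CV(5) by (rule le_less_trans)
  moreover have "compactin X C" using CV(1) by (simp add: compactin_subtopology)
  ultimately show "\<exists>C U. compactin X C \<and> openin X U \<and> C \<subseteq> E \<and> E \<subseteq> U \<and> total_variation X (ext \<sigma>) (U - C) < ennreal e"
    using CV U W borel_sets_subset[OF E] by (intro exI[of _ C] exI[of _ ?U]) auto
qed (simp add: ext_measure_def)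

section \<open>Restriction and extension of measures and their integrals\<close>

lemma res_pos: "\<nu> \<in> pos_measures X \<Longrightarrow> res \<nu> \<in> pos_measures Y"
  using pos_measures_nonneg[of \<nu> X] res_regular[of \<nu>]
  by (auto simp: pos_measures_def) (simp add: res_measure_def)

lemma ext_pos: "\<sigma> \<in> pos_measures Y \<Longrightarrow> ext \<sigma> \<in> pos_measures X"
  using pos_measures_nonneg[of \<sigma> Y] ext_regular[of \<sigma>]
  by (auto simp: pos_measures_def) (simp add: ext_measure_def)

lemma res_H: "res \<nu> H = \<nu> H"
  by (simp add: res_measure_def borel_sets_subspace H_borel)

lemma ext_mass: "ext \<sigma> (topspace X) = \<sigma> H"
  using H_subset by (simp add: ext_measure_def Int_absorb1)

lemma ext_H: "ext \<sigma> H = \<sigma> H"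
  by (simp add: ext_measure_def H_borel)

lemma ext_Hc: "\<sigma> \<in> regular_measures Y \<Longrightarrow> ext \<sigma> (topspace X - H) = 0"
  using countably_additive_empty[OF regular_measures_ca, of \<sigma> Y] by (simp add: ext_measure_def Int_commute)

lemma res_ext: "\<sigma> \<in> regular_measures Y \<Longrightarrow> res (ext \<sigma>) = \<sigma>"
  using regular_measures_off[of \<sigma> Y]
  by (intro HOL.ext) (auto simp: res_measure_def ext_measure_def borel_sets_subspace Int_absorb2)

lemma ext_res:
  assumes \<nu>: "\<nu> \<in> pos_measures X" and z: "\<nu> (topspace X - H) = 0"
  shows "ext (res \<nu>) = \<nu>"
proof (rule HOL.ext)
  fix E show "ext (res \<nu>) E = \<nu> E"
  proof (cases "E \<in> borel_sets X")
    case E: True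
    have Hc: "E - H \<in> borel_sets X" by (rule borel_sets_Diff[OF E H_borel])
    have "Re (\<nu> (E - H)) \<le> Re (\<nu> (topspace X - H))"
      using borel_sets_subset[OF E] by (intro pos_measures_mono[OF \<nu>] Hc Hc_borel) auto
    then have "\<nu> (E - H) = 0"
      using z pos_measures_Re_nonneg[OF \<nu>, of "E - H"] pos_measures_of_real[OF \<nu>, of "E - H"] by simp
    moreover have "\<nu> (E \<inter> H \<union> (E - H)) = \<nu> (E \<inter> H) + \<nu> (E - H)"
      by (intro countably_additive_Un[OF regular_measures_ca[OF pos_measures_regular[OF \<nu>]]] borel_sets_Int E H_borel Hc) auto
    ultimately show ?thesis
      using E borel_sets_Int_subspace[OF E] by (simp add: ext_measure_def res_measure_def Int_Diff_Un)
  qed (simp add: ext_measure_def regular_measures_off[OF pos_measures_regular[OF \<nu>]])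
qed

lemma ext_dirac:
  assumes "x \<in> H" shows "ext (dirac Y x) = dirac X x"
proof (rule HOL.ext)
  fix E show "ext (dirac Y x) E = dirac X x E"
    using assms borel_sets_Int_subspace[of E] by (auto simp: ext_measure_def dirac_def)
qed

lemma bounded_borel_indicator_mult:
  assumes f: "f \<in> bounded_borel Y"
  shows "(\<lambda>z. indicator H z * f z) \<in> bounded_borel X"
proof -
  obtain B where B: "\<And>x. x \<in> H \<Longrightarrow> cmod (f x) \<le> B"
    using bounded_borel_bound[OF f] topspace_Y by auto
  have "sets (borel_space Y) = sets (restrict_space (borel_space X) H)"
    using borel_sets_subspace H_borel by (auto simp: sets_restrict_space image_iff Int_absorb1 Int_absorb2 borel_sets_Int)
  then have "f \<in> borel_measurable (restrict_space (borel_space X) H)"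
    using bounded_borel_measurable[OF f] measurable_cong_sets by blast
  then have "(\<lambda>z. indicator H z *\<^sub>R f z) \<in> borel_measurable (borel_space X)"
    using H_borel by (subst (asm) borel_measurable_restrict_space_iff) (auto intro!: borel_sets_Int)
  then have "(\<lambda>z. indicator H z * f z) \<in> borel_measurable (borel_space X)"
    by (simp add: scaleR_conv_of_real of_real_indicator)
  \<comment> \<open>The bound must also cover the value 0 off H, and B may be negative if H is
    empty.\<close>
  then show ?thesis
    by (rule bounded_borelI[of _ _ "max 0 B"]) (auto simp: indicator_def B le_max_iff_disj)
qed

lemma bounded_borel_subspace:
  assumes f: "f \<in> bounded_borel X"
  shows "f \<in> bounded_borel Y"
proof -
  obtain B where B: "\<And>x. x \<in> topspace X \<Longrightarrow> cmod (f x) \<le> B"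
    using bounded_borel_bound[OF f] by auto
  have "f \<in> borel_measurable (borel_space Y)"
  proof (rule borel_measurableI)
    fix S :: "complex set" assume "open S"
    then have "f -` S \<inter> topspace X \<in> borel_sets X"
      using measurable_sets[OF bounded_borel_measurable[OF f], of S] by simp
    then have "f -` S \<inter> topspace X \<inter> H \<in> borel_sets Y" by (rule borel_sets_Int_subspace)
    moreover have "f -` S \<inter> topspace X \<inter> H = f -` S \<inter> H" using H_subset by auto
    ultimately show "f -` S \<inter> space (borel_space Y) \<in> sets (borel_space Y)"
      by (simp only: sets_borel_space space_borel_space topspace_Y)
  qed
  then show ?thesis using B H_subset by (intro bounded_borelI) (auto simp: topspace_Y)
qed

lemma cintegral_res:
  assumes \<nu>: "\<nu> \<in> pos_measures X" and f: "f \<in> bounded_borel Y"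
  shows "cintegral Y (res \<nu>) f = cintegral X \<nu> (\<lambda>z. indicator H z * f z)"
proof -
  have "re_pos Y (res \<nu>) = restrict_space (re_pos X \<nu>) H"
  proof (rule measure_eqI)
    show "sets (re_pos Y (res \<nu>)) = sets (restrict_space (re_pos X \<nu>) H)"
      using borel_sets_subspace H_borel by (auto simp: sets_restrict_space image_iff Int_absorb1 Int_absorb2 borel_sets_Int)
    fix A assume "A \<in> sets (re_pos Y (res \<nu>))"
    then have A: "A \<in> borel_sets Y" by simp
    then have "A \<in> borel_sets X" "A \<subseteq> H" by (auto simp: borel_sets_subspace)
    then show "emeasure (re_pos Y (res \<nu>)) A = emeasure (restrict_space (re_pos X \<nu>) H) A"
      using measure_re_pos_pos(1)[OF res_pos[OF \<nu>] A] H_borel A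
      by (subst emeasure_restrict_space)
        (auto simp: measure_re_pos_pos(1)[OF \<nu>] res_measure_def borel_sets_Int)
  qed
  then have "cintegral Y (res \<nu>) f = integral\<^sup>L (restrict_space (re_pos X \<nu>) H) f"
    by (simp add: cintegral_pos[OF Haus_Y res_pos[OF \<nu>] f])
  also have "\<dots> = integral\<^sup>L (re_pos X \<nu>) (\<lambda>z. indicator H z *\<^sub>R f z)"
    using H_borel by (intro integral_restrict_space) (auto intro!: borel_sets_Int)
  also have "\<dots> = cintegral X \<nu> (\<lambda>z. indicator H z * f z)"
    by (simp add: cintegral_pos[OF Haus \<nu> bounded_borel_indicator_mult[OF f]] scaleR_conv_of_real of_real_indicator)
  finally show ?thesis .
qed

lemma cintegral_ext:
  assumes \<sigma>: "\<sigma> \<in> pos_measures Y" and f: "f \<in> bounded_borel X"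
  shows "cintegral X (ext \<sigma>) f = cintegral Y \<sigma> f"
proof -
  note \<nu> = ext_pos[OF \<sigma>] and fY = bounded_borel_subspace[OF f]
  obtain B where B: "\<And>x. x \<in> topspace X \<Longrightarrow> cmod (f x) \<le> B"
    using bounded_borel_bound[OF f] by auto
  note ib = bounded_borel_indicator_mult[OF fY] and Ib = bounded_borel_indicator[OF Hc_borel]
  have "cintegral X (ext \<sigma>) f - cintegral X (ext \<sigma>) (\<lambda>z. indicator H z * f z)
    = cintegral X (ext \<sigma>) (\<lambda>z. f z - indicator H z * f z)"
    by (rule cintegral_diff[symmetric, OF Haus pos_measures_regular[OF \<nu>] f ib])
  also have "\<dots> = 0"
  proof -
    let ?g = "\<lambda>z. \<bar>B\<bar> * indicator (topspace X - H) z"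
    have g: "(\<lambda>z. complex_of_real (?g z)) = (\<lambda>z. complex_of_real \<bar>B\<bar> * indicator (topspace X - H) z)"
      by (simp add: of_real_indicator)
    have "cmod (cintegral X (ext \<sigma>) (\<lambda>z. f z - indicator H z * f z)) \<le> Re (cintegral X (ext \<sigma>) (\<lambda>z. complex_of_real (?g z)))"
    proof (rule cintegral_dominated[OF Haus \<nu>])
      show "(\<lambda>z. f z - indicator H z * f z) \<in> bounded_borel X" by (intro bounded_borel_diff f ib)
      show "(\<lambda>z. complex_of_real (?g z)) \<in> bounded_borel X"
        unfolding g by (intro bounded_borel_mult Ib bounded_borel_const)
      fix x assume "x \<in> topspace X"
      then show "cmod (f x - indicator H x * f x) \<le> ?g x" using B[of x] by (auto simp: indicator_def)
    qed
    also have "cintegral X (ext \<sigma>) (\<lambda>z. complex_of_real (?g z)) = 0"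
      unfolding g using cintegral_cmult[OF Haus pos_measures_regular[OF \<nu>] Ib]
      by (simp add: cintegral_indicator[OF Haus \<nu> Hc_borel] ext_Hc[OF pos_measures_regular[OF \<sigma>]])
    finally show ?thesis by simp
  qed
  finally show ?thesis using cintegral_res[OF \<nu> fY] by (simp add: res_ext[OF pos_measures_regular[OF \<sigma>]])
qed

text \<open>Tietze's theorem extends g from the compact set L \<inter> H, where L is a compact
  neighbourhood of the support. The extension is uncontrolled on the rest of H, and the cutoff u
  removes it there.\<close>

lemma Cc_pos_extend:
  assumes g: "g \<in> Cc_pos Y"
  obtains G where "G \<in> Cc_pos X" "\<And>x. x \<in> H \<Longrightarrow> G x = g x"
proof -
  let ?S = "Y closure_of {x \<in> topspace Y. g x \<noteq> 0}"
  have S: "compactin X ?S" "?S \<subseteq> H" using Cc_pos_compact[OF g] by (auto simp: compactin_subtopology)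
  obtain V L where VL: "openin X V" "compactin X L" "closedin X L" "?S \<subseteq> V" "V \<subseteq> L"
    using iffD1[OF locally_compact_space_compact_closed_compact[OF disjI1[OF Haus]] lc] S(1) by meson
  obtain u where u: "u \<in> Cc_pos X" "\<And>x. x \<in> topspace X \<Longrightarrow> 0 \<le> u x \<and> u x \<le> 1"
      "\<And>x. x \<in> ?S \<Longrightarrow> u x = 1" "\<And>x. x \<in> topspace X - V \<Longrightarrow> u x = 0"
    by (rule Cc_pos_cutoff[OF Haus lc S(1) VL(1) VL(4)]) (rule that)
  have LH: "compactin X (L \<inter> H)" by (rule compact_Int_closedin[OF VL(2) closed])
  have cr: "completely_regular_space X"
    using Haus lc by (simp add: locally_compact_regular_imp_completely_regular_space)
  have "subtopology Y (L \<inter> H) = subtopology X (L \<inter> H)" by (simp add: subtopology_subtopology Int_absorb1)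
  then have gc: "continuous_map (subtopology X (L \<inter> H)) euclideanreal g"
    using continuous_map_from_subtopology[OF Cc_pos_continuous[OF g], of "L \<inter> H"] by simp
  have gn: "g ` (L \<inter> H) \<subseteq> {0..}" using Cc_pos_nonneg[OF g] topspace_Y by auto
  obtain g' where g': "continuous_map X euclideanreal g'" "g' ` topspace X \<subseteq> {0..}" "\<And>x. x \<in> L \<inter> H \<Longrightarrow> g' x = g x"
  proof -
    have "is_interval {0::real..}" "{0::real..} \<noteq> {}" by (auto simp: is_interval_ci)
    from Tietze_extension_completely_regular[OF cr LH this gc gn] show ?thesis using that by metis
  qed
  show thesis
  proof (rule that)
    show "(\<lambda>x. g' x * u x) \<in> Cc_pos X" using g' by (intro Cc_pos_mult u) auto
    fix x assume x: "x \<in> H"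
    show "g' x * u x = g x"
    proof (cases "g x = 0")
      case False
      then have "x \<in> {x \<in> topspace Y. g x \<noteq> 0}" using x H_subset by auto
      moreover have "{x \<in> topspace Y. g x \<noteq> 0} \<subseteq> ?S" by (rule closure_of_subset) blast
      ultimately have "x \<in> ?S" by blast
      then show ?thesis using u(3) g'(3)[of x] VL x by auto
    next
      \<comment> \<open>Inside V the Tietze extension agrees with g, as V \<subseteq> L; outside V
        the cutoff vanishes.\<close>
      case True
      then show ?thesis using g'(3)[of x] u(4)[of x] x VL H_subset by (cases "x \<in> V") auto
    qed
  qed
qed

text \<open>Integrals of a test function over X turn into integrals of its restriction over H, which
  is bounded and continuous and hence controlled by the cone topology of H.\<close>

lemma continuous_map_ext: "continuous_map (cone_topology Y) (cone_topology X) ext"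
  unfolding cone_topology_def[of X]
proof (rule continuous_on_generated_topo)
  fix U assume "U \<in> {{\<mu> \<in> pos_measures X. cintegral X \<mu> (\<lambda>x. complex_of_real (f x)) \<in> W} |f W.
           f \<in> Cc_pos X \<union> {\<lambda>_. 1} \<and> open W}"
  then obtain f W where U: "U = {\<mu> \<in> pos_measures X. cintegral X \<mu> (\<lambda>x. complex_of_real (f x)) \<in> W}"
    and f: "f \<in> Cc_pos X \<union> {\<lambda>_. 1}" and W: "open W"
    by (elim CollectE exE conjE) (rule that; assumption)
  let ?f = "\<lambda>x. complex_of_real (f x)"
  have fb: "?f \<in> bounded_borel X" by (rule bounded_borel_cone_test[OF f])
  obtain B where B: "\<And>x. x \<in> topspace X \<Longrightarrow> cmod (?f x) \<le> B" using bounded_borel_bound[OF fb] by auto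
  have "continuous_map X euclidean ?f"
    using f by (auto intro: continuous_map_of_real Cc_pos_continuous)
  then have "continuous_map Y euclidean ?f" by (rule continuous_map_from_subtopology)
  then have "continuous_map (cone_topology Y) euclidean (\<lambda>\<mu>. cintegral Y \<mu> ?f)"
    using B H_subset by (intro cone_topology_continuous_bounded[OF Haus_Y lc_Y, where B = B]) (auto simp: topspace_Y)
  moreover have "ext -` U \<inter> topspace (cone_topology Y) = {\<mu> \<in> topspace (cone_topology Y). cintegral Y \<mu> ?f \<in> W}"
    by (auto simp: U cintegral_ext[OF _ fb] ext_pos)
  ultimately show "openin (cone_topology Y) (ext -` U \<inter> topspace (cone_topology Y))"
    using W by (simp add: continuous_map_def)
next
  show "ext ` topspace (cone_topology Y) \<subseteq> \<Union> {{\<mu> \<in> pos_measures X. cintegral X \<mu> (\<lambda>x. complex_of_real (f x)) \<in> W} |f W.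
           f \<in> Cc_pos X \<union> {\<lambda>_. 1} \<and> open W}"
    using ext_pos by (auto intro!: exI[of _ "\<lambda>_. 1"] exI[of _ UNIV])
qed

text \<open>Restriction is in general not continuous on the whole cone, because mass outside H can
  converge to mass on H. On measures concentrated on H, integrals of a test function on H equal
  those of an extension to X.\<close>

lemma continuous_map_res:
  "continuous_map (subtopology (cone_topology X) {\<nu>. \<nu> (topspace X - H) = 0}) (cone_topology Y) res"
  unfolding cone_topology_def[of Y]
proof (rule continuous_on_generated_topo)
  let ?Z = "subtopology (cone_topology X) {\<nu>. \<nu> (topspace X - H) = 0}"
  fix U assume "U \<in> {{\<mu> \<in> pos_measures Y. cintegral Y \<mu> (\<lambda>x. complex_of_real (f x)) \<in> W} |f W.
           f \<in> Cc_pos Y \<union> {\<lambda>_. 1} \<and> open W}"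
  then obtain f W where U: "U = {\<mu> \<in> pos_measures Y. cintegral Y \<mu> (\<lambda>x. complex_of_real (f x)) \<in> W}"
    and f: "f \<in> Cc_pos Y \<union> {\<lambda>_. 1}" and W: "open W"
    by (elim CollectE exE conjE) (rule that; assumption)
  obtain G where G: "G \<in> Cc_pos X \<union> {\<lambda>_. 1}" "\<And>x. x \<in> H \<Longrightarrow> G x = f x"
  proof (cases "f \<in> Cc_pos Y")
    case True
    then show ?thesis using Cc_pos_extend that by (metis UnI1)
  next
    case False
    then show ?thesis using f that[of "\<lambda>_. 1"] by auto
  qed
  let ?G = "\<lambda>x. complex_of_real (G x)"
  have eq: "cintegral Y (res \<mu>) (\<lambda>x. complex_of_real (f x)) = cintegral X \<mu> ?G"
    if \<mu>: "\<mu> \<in> pos_measures X" "\<mu> (topspace X - H) = 0" for \<mu>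
  proof -
    have "cintegral Y (res \<mu>) (\<lambda>x. complex_of_real (f x)) = cintegral Y (res \<mu>) ?G"
      by (rule cintegral_cong) (simp add: topspace_Y G(2))
    also have "\<dots> = cintegral X (ext (res \<mu>)) ?G"
      by (rule cintegral_ext[symmetric, OF res_pos[OF \<mu>(1)] bounded_borel_cone_test[OF G(1)]])
    finally show ?thesis by (simp add: ext_res[OF \<mu>])
  qed
  have "continuous_map ?Z euclidean (\<lambda>\<mu>. cintegral X \<mu> ?G)"
    by (intro continuous_map_from_subtopology cone_topology_continuous G)
  moreover have "res -` U \<inter> topspace ?Z = {\<mu> \<in> topspace ?Z. cintegral X \<mu> ?G \<in> W}"
    by (auto simp: U eq res_pos)
  ultimately show "openin ?Z (res -` U \<inter> topspace ?Z)"
    using W by (simp add: continuous_map_def)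
next
  show "res ` topspace (subtopology (cone_topology X) {\<nu>. \<nu> (topspace X - H) = 0}) \<subseteq> 
     \<Union> {{\<mu> \<in> pos_measures Y. cintegral Y \<mu> (\<lambda>x. complex_of_real (f x)) \<in> W} |f W.
           f \<in> Cc_pos Y \<union> {\<lambda>_. 1} \<and> open W}"
    using res_pos by (auto intro!: exI[of _ "\<lambda>_. 1"] exI[of _ UNIV])
qed

end

text \<open>The inclusion H * H \<subseteq> H enters as a statement about measures: p_x * p_y gives
  no mass to the complement of H when x and y lie in H.\<close>

locale sub_convolution = sep_cont_convolution X conv + closed_subspace X H
  for X :: "'a topology" and conv :: "'a convolution" and H :: "'a set" +
  assumes dirac_conc: "x \<in> H \<Longrightarrow> y \<in> H \<Longrightarrow> conv (dirac X x) (dirac X y) (topspace X - H) = 0"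
begin

text \<open>An explicit candidate for the inherited convolution, which \<open>sub_conv\<close> only
  characterises by its integrals.\<close>

abbreviation "hconv \<sigma> \<tau> \<equiv> res (conv (ext \<sigma>) (ext \<tau>))"

text \<open>The double integral formula concerns continuous functions, and the indicator of the
  complement of H need not be one. It is applied to a cutoff that is 1 on a compact subset C of the
  complement and vanishes on H; inner regularity disposes of the remainder.\<close>

lemma conv_ext_Hc:
  assumes \<sigma>: "\<sigma> \<in> pos_measures Y" and \<tau>: "\<tau> \<in> pos_measures Y"
  shows "conv (ext \<sigma>) (ext \<tau>) (topspace X - H) = 0"
proof (rule eq_zero_if_small)
  fix e :: real assume e: "0 < e"
  let ?\<nu> = "conv (ext \<sigma>) (ext \<tau>)" and ?E = "topspace X - H"
  have \<nu>: "?\<nu> \<in> pos_measures X" by (intro conv_pos ext_pos \<sigma> \<tau>)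
  note ca = regular_measures_ca[OF pos_measures_regular[OF \<nu>]]
  obtain C U where CU: "compactin X C" "openin X U" "C \<subseteq> ?E" "?E \<subseteq> U" "total_variation X ?\<nu> (U - C) < ennreal e"
    using regular_measures_regular[OF pos_measures_regular[OF \<nu>] Hc_borel e] by auto
  have b: "C \<in> borel_sets X" "U \<in> borel_sets X" using CU Haus by (auto intro: borel_sets_compactin borel_sets_openin)
  have "openin X ?E" using closed by auto
  then obtain g where g: "g \<in> Cc_pos X" and g01: "\<And>x. x \<in> topspace X \<Longrightarrow> 0 \<le> g x \<and> g x \<le> 1"
    and g1: "\<And>x. x \<in> C \<Longrightarrow> g x = 1" and g0: "\<And>x. x \<in> topspace X - ?E \<Longrightarrow> g x = 0"
    using Cc_pos_cutoff[OF Haus lc CU(1) _ CU(3)] by metis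
  let ?g = "\<lambda>x. complex_of_real (g x)"
  note gb = bounded_borel_Cc_pos[OF g]
  have gc: "continuous_map X euclidean ?g" by (intro continuous_map_of_real Cc_pos_continuous g)
  have g1': "cmod (?g x) \<le> 1" if "x \<in> topspace X" for x using g01[OF that] by simp
  have le_mass: "Re (cintegral X \<mu> ?g) \<le> Re (\<mu> ?E)" if \<mu>: "\<mu> \<in> pos_measures X" for \<mu>
  proof -
    have "Re (cintegral X \<mu> ?g) \<le> cmod (cintegral X \<mu> ?g)" by (rule complex_Re_le_cmod)
    also have "\<dots> \<le> Re (cintegral X \<mu> (\<lambda>x. complex_of_real (indicator ?E x)))"
    proof (rule cintegral_dominated[OF Haus \<mu> gb])
      show "(\<lambda>x. complex_of_real (indicator ?E x)) \<in> bounded_borel X"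
        using bounded_borel_indicator[OF Hc_borel] by (simp only: of_real_indicator)
      fix x assume x: "x \<in> topspace X"
      then show "cmod (?g x) \<le> indicator ?E x" using g01[OF x] g0[of x] by (auto simp: indicator_def)
    qed
    also have "\<dots> = Re (\<mu> ?E)" by (simp only: of_real_indicator cintegral_indicator[OF Haus \<mu> Hc_borel])
    finally show ?thesis .
  qed
  \<comment> \<open>The cutoff lies between 0 and the indicator of the complement of H, which is
    null for p_x * p_y.\<close>
  have inner: "cintegral X (conv (dirac X x) (dirac X y)) ?g = 0" if x: "x \<in> H" and y: "y \<in> H" for x y
  proof -
    have p: "conv (dirac X x) (dirac X y) \<in> pos_measures X"
      using x y H_subset by (intro prob_measures_pos conv_dirac) auto
    have "0 \<le> Re (cintegral X (conv (dirac X x) (dirac X y)) ?g)"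
      using cintegral_pos[OF Haus p gb] g01 by (auto intro!: Bochner_Integration.integral_nonneg)
    then show ?thesis
      using le_mass[OF p] cintegral_pos_real[OF Haus p gb] dirac_conc[OF x y] by (simp add: complex_eq_iff)
  qed
  \<comment> \<open>Integrals against extended measures become integrals over H, so the inner
    integral has to be known only for x and y in H.\<close>
  have "cintegral X ?\<nu> ?g = cintegral X (ext \<tau>) (\<lambda>y. cintegral X (conv (ext \<sigma>) (dirac X y)) ?g)"
    by (rule cintegral_conv_right(1)[OF gc g1']) (auto intro: pos_measures_regular ext_pos \<sigma> \<tau>)
  also have "\<dots> = cintegral Y \<tau> (\<lambda>y. cintegral X (conv (ext \<sigma>) (dirac X y)) ?g)"
    by (rule cintegral_ext[OF \<tau> cintegral_conv_right(2)[OF gc g1']])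
       (auto intro: pos_measures_regular ext_pos \<sigma> \<tau>)
  also have "\<dots> = cintegral Y \<tau> (\<lambda>y. 0)"
  proof (rule cintegral_cong)
    fix y assume "y \<in> topspace Y"
    then have y: "y \<in> H" "y \<in> topspace X" using H_subset topspace_Y by auto
    have "cintegral X (conv (ext \<sigma>) (dirac X y)) ?g = cintegral X (ext \<sigma>) (\<lambda>x. cintegral X (conv (dirac X x) (dirac X y)) ?g)"
      by (rule cintegral_conv_dirac_right(1)[OF gc g1']) (auto intro: pos_measures_regular ext_pos \<sigma> y)
    also have "\<dots> = cintegral Y \<sigma> (\<lambda>x. cintegral X (conv (dirac X x) (dirac X y)) ?g)"
      by (rule cintegral_ext[OF \<sigma> cintegral_conv_dirac_right(2)[OF gc g1']])
         (auto intro: y pos_measures_regular ext_pos \<sigma>)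
    also have "\<dots> = cintegral Y \<sigma> (\<lambda>x. 0)"
      using inner y by (intro cintegral_cong) (simp add: topspace_Y)
    finally show "cintegral X (conv (ext \<sigma>) (dirac X y)) ?g = 0"
      by (simp only: cintegral_const[OF Haus_Y \<sigma>] mult_zero_left)
  qed
  finally have z: "cintegral X ?\<nu> ?g = 0" by (simp only: cintegral_const[OF Haus_Y \<tau>] mult_zero_left)
  have "cmod (cintegral X ?\<nu> (indicator C)) \<le> Re (cintegral X ?\<nu> ?g)"
    using g01 g1 by (intro cintegral_dominated[OF Haus \<nu> bounded_borel_indicator[OF b(1)] gb]) (auto simp: indicator_def)
  then have "?\<nu> C = 0" using z by (simp add: cintegral_indicator[OF Haus \<nu> b(1)])
  then have "?\<nu> ?E = ?\<nu> (?E - C)"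
    using countably_additive_Diff[OF ca Hc_borel b(1) CU(3)] by simp
  moreover have "ennreal (cmod (?\<nu> (?E - C))) < ennreal e"
  proof -
    have EC: "?E - C \<in> borel_sets X" by (intro borel_sets_Diff Hc_borel b)
    have "ennreal (cmod (?\<nu> (?E - C))) \<le> total_variation X ?\<nu> (?E - C)" by (rule cmod_le_total_variation[OF EC])
    also have "\<dots> \<le> total_variation X ?\<nu> (U - C)"
      using CU(4) by (intro total_variation_mono EC borel_sets_Diff b) auto
    finally show ?thesis using CU(5) by (rule le_less_trans)
  qed
  ultimately show "cmod (?\<nu> ?E) \<le> e * 1" using e by (simp add: ennreal_less_iff)
qed

lemma ext_hconv_pos:
  "\<sigma> \<in> pos_measures Y \<Longrightarrow> \<tau> \<in> pos_measures Y \<Longrightarrow> ext (hconv \<sigma> \<tau>) = conv (ext \<sigma>) (ext \<tau>)"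
  by (intro ext_res conv_pos ext_pos conv_ext_Hc)

lemma hconv_clinear:
  shows hconv_clinear_left: "\<tau> \<in> regular_measures Y \<Longrightarrow> clinear_on (regular_measures Y) (\<lambda>\<sigma>. hconv \<sigma> \<tau> E)"
    and hconv_clinear_right: "\<sigma> \<in> regular_measures Y \<Longrightarrow> clinear_on (regular_measures Y) (\<lambda>\<tau>. hconv \<sigma> \<tau> E)"
  by (auto intro!: clinear_onI simp: ext_measure_add ext_measure_scale ext_regular conv_add_left conv_add_right
      conv_scale_left conv_scale_right res_measure_add res_measure_scale)

text \<open>Both sides are linear in each argument, so the positive case extends first in \<tau> and
  then in \<sigma>.\<close>

lemma ext_hconv:
  assumes \<sigma>: "\<sigma> \<in> regular_measures Y" and \<tau>: "\<tau> \<in> regular_measures Y"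
  shows "ext (hconv \<sigma> \<tau>) = conv (ext \<sigma>) (ext \<tau>)"
proof (rule HOL.ext)
  fix E
  have L1: "clinear_on (regular_measures Y) (\<lambda>\<sigma>. ext (hconv \<sigma> \<tau>) E)"
    "clinear_on (regular_measures Y) (\<lambda>\<sigma>. conv (ext \<sigma>) (ext \<tau>) E)"
    if "\<tau> \<in> regular_measures Y" for \<tau>
    using that by (auto intro!: clinear_onI simp: ext_measure_add ext_measure_scale ext_regular conv_add_left conv_add_right
      conv_scale_left conv_scale_right res_measure_add res_measure_scale)
  have L2: "clinear_on (regular_measures Y) (\<lambda>\<tau>. ext (hconv \<sigma> \<tau>) E)"
    "clinear_on (regular_measures Y) (\<lambda>\<tau>. conv (ext \<sigma>) (ext \<tau>) E)"
    if "\<sigma> \<in> regular_measures Y" for \<sigma>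
    using that by (auto intro!: clinear_onI simp: ext_measure_add ext_measure_scale ext_regular conv_add_left conv_add_right
      conv_scale_left conv_scale_right res_measure_add res_measure_scale)
  have "ext (hconv \<sigma> \<tau>) E = conv (ext \<sigma>) (ext \<tau>) E" if \<sigma>: "\<sigma> \<in> pos_measures Y" for \<sigma>
    by (rule clinear_on_eqI[OF Haus_Y L2[OF pos_measures_regular[OF \<sigma>]] _ \<tau>]) (simp only: ext_hconv_pos[OF \<sigma>])
  then show "ext (hconv \<sigma> \<tau>) E = conv (ext \<sigma>) (ext \<tau>) E"
    by (rule clinear_on_eqI[OF Haus_Y L1[OF \<tau>] _ \<sigma>])
qed

text \<open>This makes the double integral formula available on H itself. Separate continuity
  follows by composing extension, convolution in X and restriction; the last is continuous here
  because the convolutions are concentrated on H.\<close>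

lemma hconv_sep_cont: "sep_cont_convolution Y hconv"
proof
  show "Hausdorff_space Y" "locally_compact_space Y" by (rule Haus_Y, rule lc_Y)
  show "hconv \<mu> \<nu> \<in> regular_measures Y" if "\<mu> \<in> regular_measures Y" "\<nu> \<in> regular_measures Y" for \<mu> \<nu>
    by (intro res_regular conv_closed ext_regular that)
  show "clinear_on (regular_measures Y) (\<lambda>\<mu>. hconv \<mu> \<nu> E)" if "\<nu> \<in> regular_measures Y" for \<nu> E
    by (rule hconv_clinear_left[OF that])
  show "clinear_on (regular_measures Y) (\<lambda>\<nu>. hconv \<mu> \<nu> E)" if "\<mu> \<in> regular_measures Y" for \<mu> E
    by (rule hconv_clinear_right[OF that])
  show "hconv \<mu> \<nu> \<in> pos_measures Y" if "\<mu> \<in> pos_measures Y" "\<nu> \<in> pos_measures Y" for \<mu> \<nu>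
    by (intro res_pos conv_pos ext_pos that)
  show "continuous_map (cone_topology Y) (cone_topology Y) (\<lambda>\<nu>. hconv \<mu> \<nu>)" if \<mu>: "\<mu> \<in> pos_measures Y" for \<mu>
  proof -
    have "continuous_map (cone_topology Y) (cone_topology X) (\<lambda>\<nu>. conv (ext \<mu>) (ext \<nu>))"
      using continuous_map_compose[OF continuous_map_ext conv_cont_right[OF ext_pos[OF \<mu>]]] by (simp add: o_def)
    then have "continuous_map (cone_topology Y) (subtopology (cone_topology X) {\<nu>. \<nu> (topspace X - H) = 0}) (\<lambda>\<nu>. conv (ext \<mu>) (ext \<nu>))"
      using conv_ext_Hc[OF \<mu>] by (auto simp: continuous_map_in_subtopology)
    from continuous_map_compose[OF this continuous_map_res] show ?thesis by (simp add: o_def)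
  qed
  show "continuous_map (cone_topology Y) (cone_topology Y) (\<lambda>\<mu>. hconv \<mu> \<nu>)" if \<nu>: "\<nu> \<in> pos_measures Y" for \<nu>
  proof -
    have "continuous_map (cone_topology Y) (cone_topology X) (\<lambda>\<mu>. conv (ext \<mu>) (ext \<nu>))"
      using continuous_map_compose[OF continuous_map_ext conv_cont_left[OF ext_pos[OF \<nu>]]] by (simp add: o_def)
    then have "continuous_map (cone_topology Y) (subtopology (cone_topology X) {\<nu>. \<nu> (topspace X - H) = 0}) (\<lambda>\<mu>. conv (ext \<mu>) (ext \<nu>))"
      using conv_ext_Hc[OF _ \<nu>] by (auto simp: continuous_map_in_subtopology)
    from continuous_map_compose[OF this continuous_map_res] show ?thesis by (simp add: o_def)
  qed
  show "hconv (dirac Y x) (dirac Y y) \<in> prob_measures Y" if "x \<in> topspace Y" "y \<in> topspace Y" for x y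
  proof -
    have xy: "x \<in> H" "y \<in> H" "x \<in> topspace X" "y \<in> topspace X" using that H_subset topspace_Y by auto
    let ?\<nu> = "conv (dirac X x) (dirac X y)"
    have p: "?\<nu> \<in> prob_measures X" by (rule conv_dirac[OF xy(3,4)])
    have "?\<nu> H = ?\<nu> (topspace X) - ?\<nu> (topspace X - H)"
      using countably_additive_Diff[OF regular_measures_ca[OF pos_measures_regular[OF prob_measures_pos[OF p]]]
        borel_sets_topspace H_borel H_subset] by simp
    then have "?\<nu> H = 1" using p dirac_conc[OF xy(1,2)] by (simp add: prob_measures_def)
    then show ?thesis
      using res_pos[OF prob_measures_pos[OF p]] unfolding prob_measures_def mem_Collect_eq topspace_Y
      by (simp add: ext_dirac xy res_H)
  qed
qed

text \<open>The description in \<open>sub_conv\<close> is meaningful only with existence and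
  uniqueness. The double integral formula on H provides the first, with \<open>hconv\<close> as
  witness; the second holds because compactly supported continuous functions determine a regular
  measure.\<close>

lemma sub_conv_eq:
  assumes \<sigma>: "\<sigma> \<in> regular_measures Y" and \<tau>: "\<tau> \<in> regular_measures Y"
  shows "sub_conv X conv H \<sigma> \<tau> = hconv \<sigma> \<tau>"
proof -
  interpret h: sep_cont_convolution Y hconv by (rule hconv_sep_cont)
  let ?I = "\<lambda>f. cintegral Y \<tau> (\<lambda>y. cintegral Y \<sigma> (\<lambda>x. cintegral X (conv (dirac X x) (dirac X y)) (\<lambda>z. indicator H z * f z)))"
  have eq: "cintegral Y (hconv \<sigma> \<tau>) f = ?I f"
    if f: "continuous_map Y euclidean f" and fb: "bounded (f ` topspace Y)" for f :: "'a \<Rightarrow> complex"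
  proof -
    obtain B where "\<And>x. x \<in> topspace Y \<Longrightarrow> cmod (f x) \<le> B" using fb by (auto simp: bounded_iff)
    note B = this
    have f': "f \<in> bounded_borel Y" by (rule bounded_borel_continuous[OF f B])
    have "cintegral Y (hconv \<sigma> \<tau>) f = cintegral Y \<tau> (\<lambda>y. cintegral Y \<sigma> (\<lambda>x. cintegral Y (hconv (dirac Y x) (dirac Y y)) f))"
      by (rule h.cintegral_conv[OF f _ \<sigma> \<tau>]) (rule B)
    also have "\<dots> = ?I f"
    proof (intro cintegral_cong)
      fix x y assume "x \<in> topspace Y" "y \<in> topspace Y"
      then have xy: "x \<in> H" "y \<in> H" "x \<in> topspace X" "y \<in> topspace X" using H_subset topspace_Y by auto
      show "cintegral Y (hconv (dirac Y x) (dirac Y y)) f = cintegral X (conv (dirac X x) (dirac X y)) (\<lambda>z. indicator H z * f z)"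
        by (simp only: ext_dirac xy cintegral_res[OF prob_measures_pos[OF conv_dirac[OF xy(3,4)]] f'])
    qed
    finally show ?thesis .
  qed
  show ?thesis unfolding sub_conv_def
  proof (rule the_equality, intro conjI allI impI)
    show "hconv \<sigma> \<tau> \<in> regular_measures Y" by (rule h.conv_closed[OF \<sigma> \<tau>])
    show "cintegral Y (hconv \<sigma> \<tau>) f = ?I f"
      if "continuous_map Y euclidean f \<and> bounded (f ` topspace Y)" for f
      using eq that by blast
    fix \<rho> assume \<rho>: "\<rho> \<in> regular_measures Y \<and> (\<forall>f :: 'a \<Rightarrow> complex.
        continuous_map Y euclidean f \<and> bounded (f ` topspace Y) \<longrightarrow> cintegral Y \<rho> f = ?I f)"
    show "\<rho> = hconv \<sigma> \<tau>"
    proof (rule regular_measures_eqI[OF Haus_Y lc_Y conjunct1[OF \<rho>] h.conv_closed[OF \<sigma> \<tau>]])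
      fix g assume g: "g \<in> Cc_pos Y"
      let ?g = "\<lambda>x. complex_of_real (g x)"
      have c: "continuous_map Y euclidean ?g" by (intro continuous_map_of_real Cc_pos_continuous g)
      obtain B where "\<And>x. x \<in> topspace Y \<Longrightarrow> cmod (?g x) \<le> B"
        using bounded_borel_bound[OF bounded_borel_Cc_pos[OF g]] by auto
      then have b: "bounded (?g ` topspace Y)" unfolding bounded_iff by blast
      show "cintegral Y \<rho> ?g = cintegral Y (hconv \<sigma> \<tau>) ?g"
        using conjunct2[OF \<rho>] c b eq[OF c b] by (simp only: simp_thms)
    qed
  qed
qed

end

section \<open>Means\<close>

lemma tv_norm_pos_le:
  assumes "\<nu> \<in> pos_measures X" shows "tv_norm X \<nu> \<le> Re (\<nu> (topspace X))"
  unfolding tv_norm_def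
  by (rule enn2real_leI[OF pos_measures_Re_nonneg[OF assms] total_variation_pos[OF assms]])

text \<open>Boundedness can be tested on positive measures, where the total mass replaces the total
  variation norm. The best constant may change by the factor 4 of \<open>clinear_on_bound\<close>;
  the equivalence concerns only the existence of a bound.\<close>

lemma M_dual_iff:
  assumes X: "Hausdorff_space X"
  shows "\<phi> \<in> M_dual X \<longleftrightarrow> (\<forall>v. v \<notin> regular_measures X \<longrightarrow> \<phi> v = 0) \<and> clinear_on (regular_measures X) \<phi> \<and>
    (\<exists>B. \<forall>\<nu> \<in> pos_measures X. cmod (\<phi> \<nu>) \<le> B * Re (\<nu> (topspace X)))"
proof -
  have "(\<exists>B. \<forall>v \<in> regular_measures X. cmod (\<phi> v) \<le> B * tv_norm X v) \<longleftrightarrow>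
    (\<exists>B. \<forall>\<nu> \<in> pos_measures X. cmod (\<phi> \<nu>) \<le> B * Re (\<nu> (topspace X)))"
    if \<phi>: "clinear_on (regular_measures X) \<phi>"
  proof
    assume "\<exists>B. \<forall>v \<in> regular_measures X. cmod (\<phi> v) \<le> B * tv_norm X v"
    then obtain B where B: "\<And>v. v \<in> regular_measures X \<Longrightarrow> cmod (\<phi> v) \<le> B * tv_norm X v" by auto
    have "cmod (\<phi> \<nu>) \<le> \<bar>B\<bar> * Re (\<nu> (topspace X))" if \<nu>: "\<nu> \<in> pos_measures X" for \<nu>
    proof -
      have "cmod (\<phi> \<nu>) \<le> B * tv_norm X \<nu>" by (rule B[OF pos_measures_regular[OF \<nu>]])
      also have "\<dots> \<le> \<bar>B\<bar> * tv_norm X \<nu>" by (intro mult_right_mono tv_norm_nonneg) auto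
      also have "\<dots> \<le> \<bar>B\<bar> * Re (\<nu> (topspace X))" by (intro mult_left_mono tv_norm_pos_le \<nu>) auto
      finally show ?thesis .
    qed
    then show "\<exists>B. \<forall>\<nu> \<in> pos_measures X. cmod (\<phi> \<nu>) \<le> B * Re (\<nu> (topspace X))" by blast
  next
    assume "\<exists>B. \<forall>\<nu> \<in> pos_measures X. cmod (\<phi> \<nu>) \<le> B * Re (\<nu> (topspace X))"
    then obtain B where B: "\<And>\<nu>. \<nu> \<in> pos_measures X \<Longrightarrow> cmod (\<phi> \<nu>) \<le> B * Re (\<nu> (topspace X))" by auto
    show "\<exists>B. \<forall>v \<in> regular_measures X. cmod (\<phi> v) \<le> B * tv_norm X v"
      using clinear_on_bound[OF X \<phi> B] by blast
  qed
  then show ?thesis unfolding M_dual_def cdual_def mem_Collect_eq clinear_on_def by blast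
qed

lemma M_dualD:
  assumes "Hausdorff_space X" "\<phi> \<in> M_dual X"
  shows M_dual_off: "v \<notin> regular_measures X \<Longrightarrow> \<phi> v = 0"
    and M_dual_clinear: "clinear_on (regular_measures X) \<phi>"
    and M_dual_bound: "\<exists>B\<ge>0. \<forall>\<nu> \<in> pos_measures X. cmod (\<phi> \<nu>) \<le> B * Re (\<nu> (topspace X))"
proof -
  from assms(2)[unfolded M_dual_iff[OF assms(1)]]
  have off: "\<forall>v. v \<notin> regular_measures X \<longrightarrow> \<phi> v = 0" and lin: "clinear_on (regular_measures X) \<phi>"
    and "\<exists>B. \<forall>\<nu> \<in> pos_measures X. cmod (\<phi> \<nu>) \<le> B * Re (\<nu> (topspace X))" by simp_all
  then obtain B where B: "\<And>\<nu>. \<nu> \<in> pos_measures X \<Longrightarrow> cmod (\<phi> \<nu>) \<le> B * Re (\<nu> (topspace X))" by auto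
  have "cmod (\<phi> \<nu>) \<le> \<bar>B\<bar> * Re (\<nu> (topspace X))" if "\<nu> \<in> pos_measures X" for \<nu>
    by (rule order_trans[OF B[OF that]]) (intro mult_right_mono pos_measures_Re_nonneg[OF that] abs_ge_self)
  then show "\<exists>B\<ge>0. \<forall>\<nu> \<in> pos_measures X. cmod (\<phi> \<nu>) \<le> B * Re (\<nu> (topspace X))"
    by (intro exI[of _ "\<bar>B\<bar>"]) auto
  show "v \<notin> regular_measures X \<Longrightarrow> \<phi> v = 0" using off by simp
  show "clinear_on (regular_measures X) \<phi>" by (rule lin)
qed

lemma M_dualI:
  assumes "Hausdorff_space X" "\<And>v. v \<notin> regular_measures X \<Longrightarrow> \<phi> v = 0" "clinear_on (regular_measures X) \<phi>"
    "\<And>\<nu>. \<nu> \<in> pos_measures X \<Longrightarrow> cmod (\<phi> \<nu>) \<le> B * Re (\<nu> (topspace X))"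
  shows "\<phi> \<in> M_dual X"
  using assms M_dual_iff by blast

lemma M_dual_add:
  assumes X: "Hausdorff_space X" and \<phi>: "\<phi> \<in> M_dual X" and \<psi>: "\<psi> \<in> M_dual X"
  shows "(\<lambda>s. \<phi> s + \<psi> s) \<in> M_dual X"
proof -
  obtain B C where B: "\<And>\<nu>. \<nu> \<in> pos_measures X \<Longrightarrow> cmod (\<phi> \<nu>) \<le> B * Re (\<nu> (topspace X))"
    and C: "\<And>\<nu>. \<nu> \<in> pos_measures X \<Longrightarrow> cmod (\<psi> \<nu>) \<le> C * Re (\<nu> (topspace X))"
    using M_dual_bound[OF X \<phi>] M_dual_bound[OF X \<psi>] by blast
  show ?thesis
  proof (rule M_dualI[OF X, where B = "B + C"])
    fix \<nu> assume \<nu>: "\<nu> \<in> pos_measures X"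
    show "cmod (\<phi> \<nu> + \<psi> \<nu>) \<le> (B + C) * Re (\<nu> (topspace X))"
      using norm_triangle_ineq[of "\<phi> \<nu>" "\<psi> \<nu>"] B[OF \<nu>] C[OF \<nu>] by (simp add: distrib_right)
  qed (auto intro!: clinear_onI simp: M_dual_off[OF X \<phi>] M_dual_off[OF X \<psi>] algebra_simps
      clinear_on_add[OF M_dual_clinear[OF X \<phi>]] clinear_on_add[OF M_dual_clinear[OF X \<psi>]]
      clinear_on_scale[OF M_dual_clinear[OF X \<phi>]] clinear_on_scale[OF M_dual_clinear[OF X \<psi>]])
qed

lemma M_dual_scale:
  assumes X: "Hausdorff_space X" and \<phi>: "\<phi> \<in> M_dual X"
  shows "(\<lambda>s. c * \<phi> s) \<in> M_dual X"
proof -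
  obtain B where B: "\<And>\<nu>. \<nu> \<in> pos_measures X \<Longrightarrow> cmod (\<phi> \<nu>) \<le> B * Re (\<nu> (topspace X))"
    using M_dual_bound[OF X \<phi>] by blast
  show ?thesis
  proof (rule M_dualI[OF X, where B = "cmod c * B"])
    fix \<nu> assume \<nu>: "\<nu> \<in> pos_measures X"
    show "cmod (c * \<phi> \<nu>) \<le> cmod c * B * Re (\<nu> (topspace X))"
      using mult_left_mono[OF B[OF \<nu>], of "cmod c"] by (simp add: norm_mult mult.assoc)
  qed (auto intro!: clinear_onI simp: M_dual_off[OF X \<phi>] algebra_simps
      clinear_on_add[OF M_dual_clinear[OF X \<phi>]] clinear_on_scale[OF M_dual_clinear[OF X \<phi>]])
qed

lemma M_dual_diff:
  assumes X: "Hausdorff_space X" and \<phi>: "\<phi> \<in> M_dual X" and \<psi>: "\<psi> \<in> M_dual X"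
  shows "(\<lambda>s. \<phi> s - \<psi> s) \<in> M_dual X"
  using M_dual_add[OF X \<phi> M_dual_scale[OF X \<psi>, of "-1"]] by simp

lemma clinear_on_diff:
  assumes X: "Hausdorff_space X" and m: "clinear_on (M_dual X) m" and \<phi>: "\<phi> \<in> M_dual X" and \<psi>: "\<psi> \<in> M_dual X"
  shows "m (\<lambda>s. \<phi> s - \<psi> s) = m \<phi> - m \<psi>"
  using clinear_on_add[OF m \<phi> M_dual_scale[OF X \<psi>, of "-1"]] clinear_on_scale[OF m \<psi>, of "-1"] by simp

lemma char_functional_M_dual:
  assumes X: "Hausdorff_space X" and E: "E \<in> borel_sets X"
  shows "char_functional X E \<in> M_dual X"
proof (rule M_dualI[OF X, where B = 1])
  fix \<nu> assume \<nu>: "\<nu> \<in> pos_measures X"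
  have "cmod (\<nu> E) = Re (\<nu> E)"
    by (subst pos_measures_of_real[OF \<nu>]) (simp add: pos_measures_Re_nonneg[OF \<nu>])
  also have "\<dots> \<le> Re (\<nu> (topspace X))"
    by (intro pos_measures_mono[OF \<nu>] E borel_sets_topspace borel_sets_subset)
  finally show "cmod (char_functional X E \<nu>) \<le> 1 * Re (\<nu> (topspace X))"
    by (simp add: char_functional_def pos_measures_regular[OF \<nu>])
qed (auto intro!: clinear_onI simp: char_functional_def regular_measures_add[OF _ _ X] regular_measures_scale)

lemma regular_measures_cnj:
  assumes \<nu>: "\<nu> \<in> regular_measures X" shows "(\<lambda>E. cnj (\<nu> E)) \<in> regular_measures X"
proof -
  have "total_variation X (\<lambda>E. cnj (\<nu> E)) F \<le> total_variation X \<nu> F" for F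
    by (rule total_variation_dominated) simp
  then show ?thesis
    using \<nu> unfolding regular_measures_iff countably_additive_on_def
    by (auto simp: sums_cnj) (meson le_less_trans)
qed

text \<open>Re (\<theta> \<nu>) is not complex linear in \<nu>. Averaging \<theta> with the
  functional sending \<nu> to cnj (\<theta> (cnj \<nu>)), which is again linear, gives a linear
  functional that equals Re (\<theta> \<nu>) on positive measures.\<close>

definition real_part_functional :: "'a topology \<Rightarrow> (('a set \<Rightarrow> complex) \<Rightarrow> complex) \<Rightarrow> ('a set \<Rightarrow> complex) \<Rightarrow> complex" where
  "real_part_functional X \<theta> = (\<lambda>\<nu>. if \<nu> \<in> regular_measures X then (\<theta> \<nu> + cnj (\<theta> (\<lambda>E. cnj (\<nu> E)))) / 2 else 0)"

lemma real_part_functional_pos: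
  assumes \<nu>: "\<nu> \<in> pos_measures X"
  shows "real_part_functional X \<theta> \<nu> = complex_of_real (Re (\<theta> \<nu>))"
proof -
  have "(\<lambda>E. cnj (\<nu> E)) = \<nu>"
    by (rule ext) (subst (1 2) pos_measures_of_real[OF \<nu>], simp)
  then show ?thesis
    using pos_measures_regular[OF \<nu>] by (simp add: real_part_functional_def complex_eq_iff)
qed

lemma real_part_functional_M_dual:
  assumes X: "Hausdorff_space X" and \<theta>: "\<theta> \<in> M_dual X"
  shows "real_part_functional X \<theta> \<in> M_dual X"
proof -
  obtain B where B: "\<And>\<nu>. \<nu> \<in> pos_measures X \<Longrightarrow> cmod (\<theta> \<nu>) \<le> B * Re (\<nu> (topspace X))"
    using M_dual_bound[OF X \<theta>] by blast
  note lin = M_dual_clinear[OF X \<theta>]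
  show ?thesis
  proof (rule M_dualI[OF X, where B = B])
    fix \<nu> assume \<nu>: "\<nu> \<in> pos_measures X"
    show "cmod (real_part_functional X \<theta> \<nu>) \<le> B * Re (\<nu> (topspace X))"
      unfolding real_part_functional_pos[OF \<nu>] using B[OF \<nu>] abs_Re_le_cmod[of "\<theta> \<nu>"] by simp
  next
    show "clinear_on (regular_measures X) (real_part_functional X \<theta>)"
    proof (rule clinear_onI)
      fix u v assume "u \<in> regular_measures X" "v \<in> regular_measures X"
      then show "real_part_functional X \<theta> (\<lambda>s. u s + v s) = real_part_functional X \<theta> u + real_part_functional X \<theta> v"
        by (simp add: real_part_functional_def regular_measures_add[OF _ _ X] regular_measures_cnj clinear_on_add[OF lin] field_simps)
    next
      fix c v assume "v \<in> regular_measures X"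
      then show "real_part_functional X \<theta> (\<lambda>s. c * v s) = c * real_part_functional X \<theta> v"
        by (simp add: real_part_functional_def regular_measures_scale regular_measures_cnj clinear_on_scale[OF lin] field_simps)
    qed
  qed (simp add: real_part_functional_def)
qed

lemma real_imaginary_decomposition:
  assumes X: "Hausdorff_space X" and \<theta>: "\<theta> \<in> M_dual X"
  shows "\<theta> = (\<lambda>\<nu>. real_part_functional X \<theta> \<nu> + \<i> * real_part_functional X (\<lambda>s. - \<i> * \<theta> s) \<nu>)"
  by (rule ext) (simp add: real_part_functional_def M_dual_off[OF X \<theta>] field_simps)

section \<open>Positive functionals on the dual\<close>

definition pos_functional :: "'a topology \<Rightarrow> (('a set \<Rightarrow> complex) \<Rightarrow> complex) \<Rightarrow> bool" where
  "pos_functional X \<phi> \<longleftrightarrow> (\<forall>\<nu> \<in> pos_measures X. 0 \<le> \<phi> \<nu>)"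

text \<open>What can be verified of a mean without computing a norm. Boundedness follows from
  positivity, by domination with a multiple of \<open>one\<close>.\<close>

locale pos_functional_on_dual =
  fixes X :: "'a topology" and m :: "(('a set \<Rightarrow> complex) \<Rightarrow> complex) \<Rightarrow> complex"
  assumes Haus: "Hausdorff_space X" and clinear: "clinear_on (M_dual X) m"
    and pos: "\<phi> \<in> M_dual X \<Longrightarrow> pos_functional X \<phi> \<Longrightarrow> 0 \<le> m \<phi>"
begin

abbreviation "one \<equiv> char_functional X (topspace X)"

lemma one_M_dual: "one \<in> M_dual X"
  by (rule char_functional_M_dual[OF Haus borel_sets_topspace])

lemma pos_one: "pos_functional X one"
  using pos_measures_nonneg[of _ X] by (simp add: pos_functional_def char_functional_def)

text \<open>For large B the functional B times \<open>one\<close> plus the real part is positive, so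
  m is real on it. As m is real on \<open>one\<close> as well, it is real on the difference.\<close>

lemma Im_real_part: 
  assumes \<theta>: "\<theta> \<in> M_dual X"
  shows "Im (m (real_part_functional X \<theta>)) = 0"
proof -
  let ?R = "real_part_functional X \<theta>"
  note R = real_part_functional_M_dual[OF Haus \<theta>]
  obtain B where B: "0 \<le> B" "\<And>\<nu>. \<nu> \<in> pos_measures X \<Longrightarrow> cmod (\<theta> \<nu>) \<le> B * Re (\<nu> (topspace X))"
    using M_dual_bound[OF Haus \<theta>] by blast
  note B1 = M_dual_scale[OF Haus one_M_dual, of "complex_of_real B"]
  have "pos_functional X (\<lambda>s. complex_of_real B * one s + ?R s)"
    unfolding pos_functional_def
  proof
    fix \<nu> assume \<nu>: "\<nu> \<in> pos_measures X"
    have "- Re (\<theta> \<nu>) \<le> B * Re (\<nu> (topspace X))"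
      using B(2)[OF \<nu>] abs_Re_le_cmod[of "\<theta> \<nu>"] by linarith
    moreover have "Im (\<nu> (topspace X)) = 0" using pos_measures_nonneg[OF \<nu>, of "topspace X"] by (simp add: less_eq_complex_def)
    ultimately show "0 \<le> complex_of_real B * one \<nu> + ?R \<nu>"
      by (simp add: less_eq_complex_def real_part_functional_pos[OF \<nu>] char_functional_def pos_measures_regular[OF \<nu>])
  qed
  then have "0 \<le> m (\<lambda>s. complex_of_real B * one s + ?R s)"
    by (rule pos[OF M_dual_add[OF Haus B1 R]])
  also have "\<dots> = complex_of_real B * m one + m ?R"
    by (simp add: clinear_on_add[OF clinear B1 R] clinear_on_scale[OF clinear one_M_dual])
  finally show ?thesis
    using pos[OF one_M_dual pos_one] by (simp add: less_eq_complex_def)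
qed

text \<open>After rotation by a unimodular c the value of m on \<theta> is real and non-negative. It
  then equals the value on the real part of c \<theta>, since the imaginary part contributes a
  purely imaginary number, and B \<eta> minus that real part is positive.\<close>

lemma dominated:
  assumes \<theta>: "\<theta> \<in> M_dual X" and \<eta>: "\<eta> \<in> M_dual X" "pos_functional X \<eta>"
    and le: "\<And>\<nu>. \<nu> \<in> pos_measures X \<Longrightarrow> cmod (\<theta> \<nu>) \<le> B * Re (\<eta> \<nu>)"
  shows "cmod (m \<theta>) \<le> B * Re (m \<eta>)"
proof -
  define c where "c = (if m \<theta> = 0 then 1 else cnj (m \<theta>) / complex_of_real (cmod (m \<theta>)))"
  have "m \<theta> * cnj (m \<theta>) = complex_of_real (cmod (m \<theta>)) * complex_of_real (cmod (m \<theta>))"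
    by (metis complex_norm_square power2_eq_square of_real_mult)
  then have c: "cmod c = 1" "c * m \<theta> = complex_of_real (cmod (m \<theta>))"
    by (auto simp: c_def norm_divide field_simps)
  let ?\<theta> = "\<lambda>s. c * \<theta> s"
  have \<theta>': "?\<theta> \<in> M_dual X" by (rule M_dual_scale[OF Haus \<theta>])
  let ?R = "real_part_functional X ?\<theta>" and ?I = "real_part_functional X (\<lambda>s. - \<i> * ?\<theta> s)"
  have i\<theta>: "(\<lambda>s. - \<i> * ?\<theta> s) \<in> M_dual X" by (rule M_dual_scale[OF Haus \<theta>'])
  have R: "?R \<in> M_dual X" and I: "?I \<in> M_dual X"
    by (rule real_part_functional_M_dual[OF Haus \<theta>'], rule real_part_functional_M_dual[OF Haus i\<theta>])
  have "m ?\<theta> = m (\<lambda>s. ?R s + \<i> * ?I s)"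
    by (rule arg_cong[where f = m, OF real_imaginary_decomposition[OF Haus \<theta>']])
  also have "\<dots> = m ?R + \<i> * m ?I"
    by (simp only: clinear_on_add[OF clinear R M_dual_scale[OF Haus I]] clinear_on_scale[OF clinear I])
  finally have mR: "Re (m ?R) = cmod (m \<theta>)"
    using Im_real_part[OF i\<theta>] by (simp add: clinear_on_scale[OF clinear \<theta>] c complex_eq_iff)
  note B\<eta> = M_dual_scale[OF Haus \<eta>(1), of "complex_of_real B"]
  have "pos_functional X (\<lambda>s. complex_of_real B * \<eta> s - ?R s)"
    unfolding pos_functional_def
  proof
    fix \<nu> assume \<nu>: "\<nu> \<in> pos_measures X"
    have "Re (?\<theta> \<nu>) \<le> cmod (?\<theta> \<nu>)" by (rule complex_Re_le_cmod)
    also have "\<dots> \<le> B * Re (\<eta> \<nu>)" using le[OF \<nu>] by (simp add: norm_mult c)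
    finally have "Re (?\<theta> \<nu>) \<le> B * Re (\<eta> \<nu>)" .
    moreover have "Im (\<eta> \<nu>) = 0" using \<eta>(2) \<nu> by (simp add: pos_functional_def less_eq_complex_def)
    ultimately show "0 \<le> complex_of_real B * \<eta> \<nu> - ?R \<nu>"
      unfolding real_part_functional_pos[OF \<nu>] by (simp add: less_eq_complex_def)
  qed
  then have "0 \<le> m (\<lambda>s. complex_of_real B * \<eta> s - ?R s)"
    by (rule pos[OF M_dual_diff[OF Haus B\<eta> R]])
  also have "\<dots> = complex_of_real B * m \<eta> - m ?R"
    by (simp only: clinear_on_diff[OF Haus clinear B\<eta> R] clinear_on_scale[OF clinear \<eta>(1)])
  finally show ?thesis using mR by (simp add: less_eq_complex_def)
qed

end

text \<open>\<open>dual_norm\<close> is a supremum of reals, and its values can be compared with it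
  only when the set is bounded.\<close>

lemma M_dual_norm_bdd:
  assumes X: "Hausdorff_space X" and \<phi>: "\<phi> \<in> M_dual X"
  shows "bdd_above ((\<lambda>v. cmod (\<phi> v)) ` {v \<in> regular_measures X. tv_norm X v \<le> 1})"
proof -
  obtain B where B: "\<forall>v \<in> regular_measures X. cmod (\<phi> v) \<le> B * tv_norm X v"
    using \<phi> unfolding M_dual_def cdual_def by blast
  show ?thesis
  proof (rule bdd_aboveI2)
    fix v assume v: "v \<in> {v \<in> regular_measures X. tv_norm X v \<le> 1}"
    have "cmod (\<phi> v) \<le> B * tv_norm X v" using v by (intro B[rule_format]) simp
    also have "\<dots> \<le> \<bar>B\<bar> * tv_norm X v" by (intro mult_right_mono tv_norm_nonneg) auto
    also have "\<dots> \<le> \<bar>B\<bar> * 1" using v by (intro mult_left_mono) auto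
    finally show "cmod (\<phi> v) \<le> \<bar>B\<bar>" by simp
  qed
qed

lemma cmod_le_M_dual_norm:
  assumes X: "Hausdorff_space X" and \<phi>: "\<phi> \<in> M_dual X" and \<nu>: "\<nu> \<in> pos_measures X"
  shows "cmod (\<phi> \<nu>) \<le> M_dual_norm X \<phi> * Re (\<nu> (topspace X))"
proof (cases "Re (\<nu> (topspace X)) = 0")
  \<comment> \<open>Here \<nu> cannot be normalised, but a bound of \<phi> by some multiple of the
    mass already forces \<phi> \<nu> = 0.\<close>
  case True
  then show ?thesis using M_dual_bound[OF X \<phi>] \<nu> by fastforce
next
  case False
  define t where "t = Re (\<nu> (topspace X))"
  have t: "0 < t" using False pos_measures_Re_nonneg[OF \<nu>, of "topspace X"] by (simp add: t_def)
  let ?v = "\<lambda>s. complex_of_real (1 / t) * \<nu> s"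
  have v: "?v \<in> pos_measures X" using t by (intro pos_measures_scale \<nu>) (simp add: less_eq_complex_def)
  have "tv_norm X ?v \<le> Re (?v (topspace X))" by (rule tv_norm_pos_le[OF v])
  also have "\<dots> = 1" using t by (simp add: t_def)
  finally have "cmod (\<phi> ?v) \<le> M_dual_norm X \<phi>"
    unfolding M_dual_norm_def dual_norm_def
    by (intro cSUP_upper M_dual_norm_bdd[OF X \<phi>]) (simp add: pos_measures_regular[OF v, simplified])
  then have "t * cmod (\<phi> ?v) \<le> t * M_dual_norm X \<phi>" using t by (intro mult_left_mono) auto
  moreover have "cmod (\<phi> ?v) = cmod (\<phi> \<nu>) / t"
    using t by (simp only: clinear_on_scale[OF M_dual_clinear[OF X \<phi>] pos_measures_regular[OF \<nu>]] norm_mult norm_of_real) simp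
  ultimately show ?thesis unfolding t_def[symmetric] using t by (simp only:) (simp add: mult.commute)
qed

lemma M_dual_norm_one:
  assumes X: "Hausdorff_space X"
  shows "M_dual_norm X (char_functional X (topspace X)) \<le> 1"
  unfolding M_dual_norm_def dual_norm_def
proof (rule cSUP_least)
  show "{v \<in> regular_measures X. tv_norm X v \<le> 1} \<noteq> {}" by (auto intro!: exI[of _ "\<lambda>_. 0"] simp: tv_norm_zero)
  fix v assume "v \<in> {v \<in> regular_measures X. tv_norm X v \<le> 1}"
  then show "cmod (char_functional X (topspace X) v) \<le> 1"
    using cmod_le_tv_norm[OF X, of v] by (simp add: char_functional_def)
qed

text \<open>For positive functionals the norm is attained at the constant function \<open>1\<close>.\<close>

lemma means_on_iff:
  assumes X: "Hausdorff_space X"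
  shows "m \<in> means_on X \<longleftrightarrow> (\<forall>\<phi>. \<phi> \<notin> M_dual X \<longrightarrow> m \<phi> = 0) \<and> pos_functional_on_dual X m \<and>
    m (char_functional X (topspace X)) = 1"
proof (intro iffI conjI)
  let ?one = "char_functional X (topspace X)"
  note one = char_functional_M_dual[OF X borel_sets_topspace]
  assume m: "m \<in> means_on X"
  then have bi: "m \<in> M_bidual X" and norm: "M_bidual_norm X m = 1"
    and pos: "\<And>\<phi>. \<phi> \<in> M_dual X \<Longrightarrow> (\<forall>\<nu> \<in> pos_measures X. 0 \<le> \<phi> \<nu>) \<Longrightarrow> 0 \<le> m \<phi>"
    by (auto simp: means_on_def)
  show "\<forall>\<phi>. \<phi> \<notin> M_dual X \<longrightarrow> m \<phi> = 0" using bi unfolding M_bidual_def cdual_def by blast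
  have lin: "clinear_on (M_dual X) m"
    using bi unfolding M_bidual_def cdual_def clinear_on_def by blast
  show p: "pos_functional_on_dual X m"
    by unfold_locales (use X lin pos in \<open>auto simp: pos_functional_def\<close>)
  interpret p: pos_functional_on_dual X m by (rule p)
  obtain B where B: "\<forall>\<phi> \<in> M_dual X. cmod (m \<phi>) \<le> B * M_dual_norm X \<phi>"
    using bi unfolding M_bidual_def cdual_def by blast
  let ?S = "{\<phi> \<in> M_dual X. M_dual_norm X \<phi> \<le> 1}"
  have norm0: "0 \<le> M_dual_norm X \<phi>" if \<phi>: "\<phi> \<in> M_dual X" for \<phi>
  proof -
    have "cmod (\<phi> (\<lambda>_. 0)) \<le> M_dual_norm X \<phi>"
      unfolding M_dual_norm_def dual_norm_def by (intro cSUP_upper M_dual_norm_bdd[OF X \<phi>]) (simp add: tv_norm_zero)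
    then show ?thesis by (rule order_trans[OF norm_ge_zero])
  qed
  have bdd: "bdd_above ((\<lambda>\<phi>. cmod (m \<phi>)) ` ?S)"
  proof (rule bdd_aboveI2)
    fix \<phi> assume \<phi>: "\<phi> \<in> ?S"
    have "cmod (m \<phi>) \<le> B * M_dual_norm X \<phi>" using \<phi> by (intro B[rule_format]) simp
    also have "\<dots> \<le> \<bar>B\<bar> * M_dual_norm X \<phi>" using \<phi> norm0 by (intro mult_right_mono) auto
    also have "\<dots> \<le> \<bar>B\<bar> * 1" using \<phi> by (intro mult_left_mono) auto
    finally show "cmod (m \<phi>) \<le> \<bar>B\<bar>" by simp
  qed
  have oneS: "?one \<in> ?S" using one M_dual_norm_one[OF X] by simp
  have "cmod (m ?one) \<le> 1"
    using cSUP_upper[OF oneS bdd] norm by (simp add: M_bidual_norm_def dual_norm_def)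
  moreover have "1 \<le> Re (m ?one)"
  proof -
    \<comment> \<open>Every functional in the unit ball is dominated on positive measures by the
      constant function 1, so its value under m is at most that of 1.\<close>
    have "(SUP \<phi>\<in>?S. cmod (m \<phi>)) \<le> Re (m ?one)"
    proof (rule cSUP_least)
      show "?S \<noteq> {}" using oneS by blast
      fix \<phi> assume \<phi>: "\<phi> \<in> ?S"
      have "cmod (\<phi> \<nu>) \<le> 1 * Re (?one \<nu>)" if \<nu>: "\<nu> \<in> pos_measures X" for \<nu>
      proof -
        have "cmod (\<phi> \<nu>) \<le> M_dual_norm X \<phi> * Re (\<nu> (topspace X))"
          using \<phi> by (intro cmod_le_M_dual_norm X \<nu>) simp
        also have "\<dots> \<le> 1 * Re (\<nu> (topspace X))"
          using \<phi> by (intro mult_right_mono pos_measures_Re_nonneg[OF \<nu>]) simp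
        finally show ?thesis by (simp add: char_functional_def pos_measures_regular[OF \<nu>])
      qed
      then show "cmod (m \<phi>) \<le> Re (m ?one)"
        using p.dominated[OF _ p.one_M_dual p.pos_one, of \<phi> 1] \<phi> by simp
    qed
    then show ?thesis using norm by (simp add: M_bidual_norm_def dual_norm_def)
  qed
  moreover have "Im (m ?one) = 0" using p.pos[OF p.one_M_dual p.pos_one] by (simp add: less_eq_complex_def)
  ultimately show "m ?one = 1"
    using complex_Re_le_cmod[of "m ?one"] by (simp add: complex_eq_iff)
next
  let ?one = "char_functional X (topspace X)"
  let ?S = "{\<phi> \<in> M_dual X. M_dual_norm X \<phi> \<le> 1}"
  assume *: "(\<forall>\<phi>. \<phi> \<notin> M_dual X \<longrightarrow> m \<phi> = 0) \<and> pos_functional_on_dual X m \<and> m ?one = 1"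
  then interpret p: pos_functional_on_dual X m by simp
  have m1: "m ?one = 1" using * by simp
  have bound: "cmod (m \<phi>) \<le> M_dual_norm X \<phi>" if \<phi>: "\<phi> \<in> M_dual X" for \<phi>
  proof -
    have "cmod (\<phi> \<nu>) \<le> M_dual_norm X \<phi> * Re (?one \<nu>)" if \<nu>: "\<nu> \<in> pos_measures X" for \<nu>
      using cmod_le_M_dual_norm[OF X \<phi> \<nu>] by (simp add: char_functional_def pos_measures_regular[OF \<nu>])
    then show ?thesis using p.dominated[OF \<phi> p.one_M_dual p.pos_one, of "M_dual_norm X \<phi>"] m1 by simp
  qed
  have "m \<in> M_bidual X"
    unfolding M_bidual_def cdual_def mem_Collect_eq
  proof (intro conjI)
    show "\<forall>v. v \<notin> M_dual X \<longrightarrow> m v = 0" using * by simp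
    show "\<forall>u\<in>M_dual X. \<forall>v\<in>M_dual X. m (\<lambda>s. u s + v s) = m u + m v"
      using clinear_on_add[OF p.clinear] by simp
    show "\<forall>c. \<forall>v\<in>M_dual X. m (\<lambda>s. c * v s) = c * m v"
      using clinear_on_scale[OF p.clinear] by simp
    show "\<exists>B. \<forall>v\<in>M_dual X. cmod (m v) \<le> B * M_dual_norm X v"
      using bound by (intro exI[of _ 1]) simp
  qed
  moreover have "M_bidual_norm X m = 1"
    unfolding M_bidual_norm_def dual_norm_def
  proof (rule antisym)
    have oneS: "?one \<in> ?S" using p.one_M_dual M_dual_norm_one[OF X] by simp
    have le: "cmod (m \<phi>) \<le> 1" if "\<phi> \<in> ?S" for \<phi> using bound[of \<phi>] that by simp
    show "(SUP \<phi>\<in>?S. cmod (m \<phi>)) \<le> 1" using oneS le by (intro cSUP_least) blast+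
    have "bdd_above ((\<lambda>\<phi>. cmod (m \<phi>)) ` ?S)" by (rule bdd_aboveI2[where M = 1]) (rule le)
    from cSUP_upper[OF oneS this] show "1 \<le> (SUP \<phi>\<in>?S. cmod (m \<phi>))" by (simp add: m1)
  qed
  ultimately show "m \<in> means_on X"
    unfolding means_on_def using p.pos by (simp add: pos_functional_def)
qed

lemma (in sep_cont_convolution) left_translate_M_dual:
  assumes \<mu>: "\<mu> \<in> pos_measures X" and \<phi>: "\<phi> \<in> M_dual X"
  shows "left_translate X conv \<mu> \<phi> \<in> M_dual X"
proof -
  note \<mu>' = pos_measures_regular[OF \<mu>] and lin = M_dual_clinear[OF Hausdorff \<phi>]
  obtain B where B: "\<And>\<nu>. \<nu> \<in> pos_measures X \<Longrightarrow> cmod (\<phi> \<nu>) \<le> B * Re (\<nu> (topspace X))"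
    using M_dual_bound[OF Hausdorff \<phi>] by blast
  show ?thesis
  proof (rule M_dualI[OF Hausdorff, where B = "B * Re (\<mu> (topspace X))"])
    fix \<nu> assume \<nu>: "\<nu> \<in> pos_measures X"
    have "Re (conv \<mu> \<nu> (topspace X)) = Re (\<mu> (topspace X)) * Re (\<nu> (topspace X))"
      unfolding conv_mass[OF \<mu> \<nu>]
      by (subst pos_measures_of_real[OF \<mu>], subst pos_measures_of_real[OF \<nu>]) simp
    then show "cmod (left_translate X conv \<mu> \<phi> \<nu>) \<le> B * Re (\<mu> (topspace X)) * Re (\<nu> (topspace X))"
      using B[OF conv_pos[OF \<mu> \<nu>]] by (simp add: left_translate_def pos_measures_regular[OF \<nu>] mult.assoc)
  qed (auto intro!: clinear_onI simp: left_translate_def regular_measures_add[OF _ _ Hausdorff] regular_measures_scale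
      conv_add_right conv_scale_right \<mu>' conv_closed clinear_on_add[OF lin] clinear_on_scale[OF lin])
qed

section \<open>Transport of functionals and means between \<open>K\<close> and
  \<open>H\<close>\<close>

context sub_convolution
begin

abbreviation "subconv \<equiv> sub_conv X conv H"

text \<open>The transpose of \<open>ext\<close>: restriction of a functional from M(X) to
  M(H).\<close>

definition pull :: "(('a set \<Rightarrow> complex) \<Rightarrow> complex) \<Rightarrow> ('a set \<Rightarrow> complex) \<Rightarrow> complex" where
  "pull \<phi> = (\<lambda>\<sigma>. if \<sigma> \<in> regular_measures Y then \<phi> (ext \<sigma>) else 0)"

text \<open>The transpose of \<open>res\<close>: a functional on M(H) is extended to M(X) by
  ignoring the mass outside H.\<close>

definition push :: "(('a set \<Rightarrow> complex) \<Rightarrow> complex) \<Rightarrow> ('a set \<Rightarrow> complex) \<Rightarrow> complex" where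
  "push \<psi> = (\<lambda>\<nu>. if \<nu> \<in> regular_measures X then \<psi> (res \<nu>) else 0)"

lemma pull_M_dual:
  assumes \<phi>: "\<phi> \<in> M_dual X" shows "pull \<phi> \<in> M_dual Y"
proof -
  note lin = M_dual_clinear[OF Haus \<phi>]
  obtain B where B: "\<And>\<nu>. \<nu> \<in> pos_measures X \<Longrightarrow> cmod (\<phi> \<nu>) \<le> B * Re (\<nu> (topspace X))"
    using M_dual_bound[OF Haus \<phi>] by blast
  show ?thesis
  proof (rule M_dualI[OF Haus_Y, where B = B])
    fix \<sigma> assume \<sigma>: "\<sigma> \<in> pos_measures Y"
    show "cmod (pull \<phi> \<sigma>) \<le> B * Re (\<sigma> (topspace Y))"
      using B[OF ext_pos[OF \<sigma>]] unfolding topspace_Y by (simp add: pull_def pos_measures_regular[OF \<sigma>] ext_mass)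
  qed (auto intro!: clinear_onI simp: pull_def regular_measures_add[OF _ _ Haus_Y] regular_measures_scale
      ext_measure_add ext_measure_scale ext_regular clinear_on_add[OF lin] clinear_on_scale[OF lin])
qed

lemma push_M_dual:
  assumes \<psi>: "\<psi> \<in> M_dual Y" shows "push \<psi> \<in> M_dual X"
proof -
  note lin = M_dual_clinear[OF Haus_Y \<psi>]
  obtain B where B: "0 \<le> B" "\<And>\<nu>. \<nu> \<in> pos_measures Y \<Longrightarrow> cmod (\<psi> \<nu>) \<le> B * Re (\<nu> (topspace Y))"
    using M_dual_bound[OF Haus_Y \<psi>] by blast
  show ?thesis
  proof (rule M_dualI[OF Haus, where B = B])
    fix \<nu> assume \<nu>: "\<nu> \<in> pos_measures X"
    have "cmod (push \<psi> \<nu>) \<le> B * Re (\<nu> H)"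
      using B(2)[OF res_pos[OF \<nu>]] unfolding topspace_Y by (simp add: push_def pos_measures_regular[OF \<nu>] res_H)
    also have "\<dots> \<le> B * Re (\<nu> (topspace X))"
      by (intro mult_left_mono B(1) pos_measures_mono[OF \<nu>] H_borel borel_sets_topspace H_subset)
    finally show "cmod (push \<psi> \<nu>) \<le> B * Re (\<nu> (topspace X))" .
  qed (auto intro!: clinear_onI simp: push_def regular_measures_add[OF _ _ Haus] regular_measures_scale
      res_measure_add res_measure_scale res_regular clinear_on_add[OF lin] clinear_on_scale[OF lin])
qed

text \<open>The constant 1 and the indicator of H become the same functional on M(H). Hence an
  extended mean is normalised and gives the value 1 to the indicator of H.\<close>

lemma pull_char: "pull (char_functional X (topspace X)) = char_functional Y (topspace Y)"
  "pull (char_functional X H) = char_functional Y (topspace Y)"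
  unfolding topspace_Y by (auto simp: pull_def char_functional_def ext_regular ext_mass ext_H fun_eq_iff)

text \<open>The constant 1 of H is extended to the indicator of H and not to 1. This is why the
  restricted mean has to be divided by m \<chi>, \<chi> being the functional of H.\<close>

lemma push_char: "push (char_functional Y (topspace Y)) = char_functional X H"
  unfolding topspace_Y by (auto simp: push_def char_functional_def res_regular res_H fun_eq_iff)

lemma sub_conv_closed:
  "\<sigma> \<in> regular_measures Y \<Longrightarrow> \<tau> \<in> regular_measures Y \<Longrightarrow> subconv \<sigma> \<tau> \<in> regular_measures Y"
  by (simp add: sub_conv_eq res_regular conv_closed ext_regular)

lemma sub_left_translate_M_dual:
  assumes \<sigma>: "\<sigma> \<in> pos_measures Y" and \<psi>: "\<psi> \<in> M_dual Y"
  shows "left_translate Y subconv \<sigma> \<psi> \<in> M_dual Y"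
proof -
  interpret h: sep_cont_convolution Y hconv by (rule hconv_sep_cont)
  have "left_translate Y subconv \<sigma> \<psi> = left_translate Y hconv \<sigma> \<psi>"
    by (auto simp: left_translate_def sub_conv_eq pos_measures_regular[OF \<sigma>])
  then show ?thesis using h.left_translate_M_dual[OF \<sigma> \<psi>] by simp
qed

lemma invariant_mean_extends:
  assumes mH: "TLIM Y subconv mH"
  shows "\<exists>m. top_left_invariant_under X conv H m \<and> m (char_functional X H) = 1"
proof -
  have mean: "mH \<in> means_on Y" and inv: "\<And>\<nu> \<phi>. \<nu> \<in> prob_measures Y \<Longrightarrow> \<phi> \<in> M_dual Y \<Longrightarrow>
      mH (left_translate Y subconv \<nu> \<phi>) = mH \<phi>"
    using mH by (auto simp: TLIM_def)
  have p: "pos_functional_on_dual Y mH" and one: "mH (char_functional Y (topspace Y)) = 1"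
    using mean unfolding means_on_iff[OF Haus_Y] by blast+
  interpret p: pos_functional_on_dual Y mH by (rule p)
  define m where "m = (\<lambda>\<phi>. if \<phi> \<in> M_dual X then mH (pull \<phi>) else 0)"
  have "pos_functional_on_dual X m"
  proof
    show "Hausdorff_space X" by (rule Haus)
    show "clinear_on (M_dual X) m"
    proof (rule clinear_onI)
      fix u v assume uv: "u \<in> M_dual X" "v \<in> M_dual X"
      have "pull (\<lambda>s. u s + v s) = (\<lambda>s. pull u s + pull v s)" by (auto simp: pull_def)
      then show "m (\<lambda>s. u s + v s) = m u + m v"
        by (simp add: m_def uv M_dual_add[OF Haus] clinear_on_add[OF p.clinear] pull_M_dual)
    next
      fix c v assume v: "v \<in> M_dual X"
      have "pull (\<lambda>s. c * v s) = (\<lambda>s. c * pull v s)" by (auto simp: pull_def)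
      then show "m (\<lambda>s. c * v s) = c * m v"
        by (simp add: m_def v M_dual_scale[OF Haus] clinear_on_scale[OF p.clinear] pull_M_dual)
    qed
    fix \<phi> assume \<phi>: "\<phi> \<in> M_dual X" "pos_functional X \<phi>"
    then have "pos_functional Y (pull \<phi>)"
      by (auto simp: pos_functional_def pull_def ext_pos)
    then show "0 \<le> m \<phi>" using p.pos[OF pull_M_dual[OF \<phi>(1)]] \<phi> by (simp add: m_def)
  qed
  moreover have "m (char_functional X (topspace X)) = 1" "m (char_functional X H) = 1"
    using one by (simp_all add: m_def char_functional_M_dual[OF Haus] H_borel pull_char)
  ultimately have m: "m \<in> means_on X" "m (char_functional X H) = 1"
    by (simp_all add: means_on_iff[OF Haus] m_def)
  have "m (left_translate X conv \<nu> \<phi>) = m \<phi>"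
    if \<nu>: "\<nu> \<in> prob_measures X" and supp: "msupp X \<nu> \<subseteq> H" and \<phi>: "\<phi> \<in> M_dual X" for \<nu> \<phi>
  proof -
    note \<nu>p = prob_measures_pos[OF \<nu>] and \<nu>r = pos_measures_regular[OF prob_measures_pos[OF \<nu>]]
    have z: "\<nu> (topspace X - H) = 0"
      by (rule measure_eq_0_if_msupp_disjoint[OF Haus \<nu>r Hc_borel]) (use supp in auto)
    have "\<nu> H = 1"
      using countably_additive_Diff[OF regular_measures_ca[OF \<nu>r] borel_sets_topspace H_borel H_subset] z \<nu>
      by (simp add: prob_measures_def)
    then have r: "res \<nu> \<in> prob_measures Y"
      unfolding prob_measures_def mem_Collect_eq topspace_Y by (simp add: res_pos[OF \<nu>p] res_H)
    note rr = pos_measures_regular[OF prob_measures_pos[OF r]]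
    \<comment> \<open>In this direction restriction commutes with translation exactly: \<nu> is
      concentrated on H and is therefore the extension of its own restriction.\<close>
    have "pull (left_translate X conv \<nu> \<phi>) = left_translate Y subconv (res \<nu>) (pull \<phi>)"
    proof
      fix \<sigma>
      show "pull (left_translate X conv \<nu> \<phi>) \<sigma> = left_translate Y subconv (res \<nu>) (pull \<phi>) \<sigma>"
        using sub_conv_closed[OF rr, of \<sigma>] ext_hconv[OF rr, of \<sigma>]
        by (auto simp: pull_def left_translate_def ext_regular sub_conv_eq[OF rr] ext_res[OF \<nu>p z])
    qed
    then show ?thesis
      using inv[OF r pull_M_dual[OF \<phi>]] by (simp add: m_def \<phi> left_translate_M_dual[OF \<nu>p \<phi>])
  qed
  then show ?thesis using m by (auto simp: top_left_invariant_under_def)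
qed

text \<open>The mean is restricted to \<open>H\<close> and renormalised. Restriction does not commute with translation
  by \<open>\<mu>\<close>: the error is caused by mass that \<open>\<mu>\<close> moves into \<open>H\<close> from outside. As \<open>\<mu>\<close> keeps the mass
  inside \<open>H\<close> there, the amount moved in is \<open>L\<^sub>\<mu> \<chi>\<^sub>H - \<chi>\<^sub>H\<close>, on which an invariant mean vanishes.\<close>

lemma invariant_mean_restricts:
  assumes inv: "top_left_invariant_under X conv H m" and mH: "0 < m (char_functional X H)"
  shows "\<exists>mH. TLIM Y subconv mH"
proof -
  let ?\<chi> = "char_functional X H"
  have mean: "m \<in> means_on X" and inv: "\<And>\<nu> \<phi>. \<nu> \<in> prob_measures X \<Longrightarrow> msupp X \<nu> \<subseteq> H \<Longrightarrow> \<phi> \<in> M_dual X \<Longrightarrow>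
      m (left_translate X conv \<nu> \<phi>) = m \<phi>"
    using inv by (auto simp: top_left_invariant_under_def)
  have p: "pos_functional_on_dual X m"
    using mean unfolding means_on_iff[OF Haus] by blast
  interpret p: pos_functional_on_dual X m by (rule p)
  obtain r where r: "m ?\<chi> = complex_of_real r" "0 < r"
    using mH by (intro that[of "Re (m ?\<chi>)"]) (auto simp: less_complex_def complex_eq_iff)
  note \<chi> = char_functional_M_dual[OF Haus H_borel]
  define n where "n = (\<lambda>\<psi>. if \<psi> \<in> M_dual Y then m (push \<psi>) / complex_of_real r else 0)"
  have "pos_functional_on_dual Y n"
  proof
    show "Hausdorff_space Y" by (rule Haus_Y)
    show "clinear_on (M_dual Y) n"
    proof (rule clinear_onI)
      fix u v assume uv: "u \<in> M_dual Y" "v \<in> M_dual Y"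
      have "push (\<lambda>s. u s + v s) = (\<lambda>s. push u s + push v s)" by (auto simp: push_def)
      then show "n (\<lambda>s. u s + v s) = n u + n v"
        by (simp add: n_def uv M_dual_add[OF Haus_Y] clinear_on_add[OF p.clinear] push_M_dual add_divide_distrib)
    next
      fix c v assume v: "v \<in> M_dual Y"
      have "push (\<lambda>s. c * v s) = (\<lambda>s. c * push v s)" by (auto simp: push_def)
      then show "n (\<lambda>s. c * v s) = c * n v"
        by (simp add: n_def v M_dual_scale[OF Haus_Y] clinear_on_scale[OF p.clinear] push_M_dual)
    qed
    fix \<psi> assume \<psi>: "\<psi> \<in> M_dual Y" "pos_functional Y \<psi>"
    then have "pos_functional X (push \<psi>)"
      by (auto simp: pos_functional_def push_def res_pos)
    then have "0 \<le> m (push \<psi>)" by (rule p.pos[OF push_M_dual[OF \<psi>(1)]])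
    then show "0 \<le> n \<psi>" using \<psi> r(2) by (simp add: n_def less_eq_complex_def)
  qed
  moreover have "n (char_functional Y (topspace Y)) = 1"
    using r char_functional_M_dual[OF Haus_Y borel_sets_topspace] push_char unfolding n_def by simp
  moreover have "\<forall>\<psi>. \<psi> \<notin> M_dual Y \<longrightarrow> n \<psi> = 0" by (simp add: n_def)
  ultimately have n: "n \<in> means_on Y" unfolding means_on_iff[OF Haus_Y] by blast
  have "n (left_translate Y subconv \<sigma> \<psi>) = n \<psi>"
    if \<sigma>: "\<sigma> \<in> prob_measures Y" and \<psi>: "\<psi> \<in> M_dual Y" for \<sigma> \<psi>
  proof -
    note \<sigma>p = prob_measures_pos[OF \<sigma>] and \<sigma>r = pos_measures_regular[OF prob_measures_pos[OF \<sigma>]]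
    let ?\<mu> = "ext \<sigma>"
    note \<mu>p = ext_pos[OF \<sigma>p] and \<mu>r = ext_regular[OF \<sigma>r]
    have \<sigma>H: "\<sigma> H = 1" using \<sigma> unfolding prob_measures_def mem_Collect_eq topspace_Y by simp
    then have \<mu>: "?\<mu> \<in> prob_measures X" using \<mu>p by (simp add: prob_measures_def ext_mass)
    have supp: "msupp X ?\<mu> \<subseteq> H"
    proof
      fix x assume x: "x \<in> msupp X ?\<mu>"
      have "total_variation X ?\<mu> (topspace X - H) = 0"
        using total_variation_pos[OF \<mu>p, of "topspace X - H"] ext_Hc[OF \<sigma>r] by simp
      then show "x \<in> H" using x closed by (auto simp: msupp_def)
    qed
    obtain B where B: "0 \<le> B" "\<And>\<nu>. \<nu> \<in> pos_measures Y \<Longrightarrow> cmod (\<psi> \<nu>) \<le> B * Re (\<nu> (topspace Y))"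
      using M_dual_bound[OF Haus_Y \<psi>] by blast
    note \<psi>l = M_dual_clinear[OF Haus_Y \<psi>]
    let ?T = "left_translate X conv ?\<mu> (push \<psi>)" and ?S = "push (left_translate Y subconv \<sigma> \<psi>)"
    let ?T1 = "left_translate X conv ?\<mu> ?\<chi>"
    have T: "?T \<in> M_dual X" by (rule left_translate_M_dual[OF \<mu>p push_M_dual[OF \<psi>]])
    have S: "?S \<in> M_dual X" by (rule push_M_dual[OF sub_left_translate_M_dual[OF \<sigma>p \<psi>]])
    have T1: "?T1 \<in> M_dual X" by (rule left_translate_M_dual[OF \<mu>p \<chi>])
    \<comment> \<open>\<nu>' is the part of \<nu> outside H. On the part inside H, restriction
      commutes with translation and all mass stays in H, so both differences depend on \<nu>' only.
      Comparing them on \<nu>' gives the domination used below, with the bound B of \<psi> as its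
      constant.\<close>
    have key: "?T \<nu> - ?S \<nu> = \<psi> (res (conv ?\<mu> \<nu>')) \<and> ?T1 \<nu> - ?\<chi> \<nu> = conv ?\<mu> \<nu>' H \<and> \<nu>' \<in> pos_measures X"
      if \<nu>: "\<nu> \<in> pos_measures X" and \<nu>': "\<nu>' = (\<lambda>E. \<nu> E + (-1) * ext (res \<nu>) E)" for \<nu> \<nu>'
    proof -
      note \<nu>r = pos_measures_regular[OF \<nu>] and rp = res_pos[OF \<nu>] and rr = res_regular[OF pos_measures_regular[OF \<nu>]]
      note er = ext_regular[OF rr]
      have \<nu>'r: "\<nu>' \<in> regular_measures X" unfolding \<nu>' by (intro regular_measures_add regular_measures_scale \<nu>r er Haus)
      have "0 \<le> \<nu>' E" if E: "E \<in> borel_sets X" for E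
      proof -
        have EH: "E \<inter> H \<in> borel_sets X" by (intro borel_sets_Int E H_borel)
        have "\<nu>' E = \<nu> E - \<nu> (E \<inter> H)"
          using E borel_sets_Int_subspace[OF E] by (simp add: \<nu>' ext_measure_def res_measure_def)
        also have "\<dots> = \<nu> (E - E \<inter> H)"
          by (rule countably_additive_Diff[symmetric, OF regular_measures_ca[OF \<nu>r] E EH]) simp
        finally show ?thesis using pos_measures_nonneg[OF \<nu>] by simp
      qed
      then have \<nu>'p: "\<nu>' \<in> pos_measures X" using \<nu>'r by (simp add: pos_measures_def)
      have "\<nu> = (\<lambda>E. ext (res \<nu>) E + \<nu>' E)" by (simp add: \<nu>')
      then have conv: "conv ?\<mu> \<nu> = (\<lambda>E. conv ?\<mu> (ext (res \<nu>)) E + conv ?\<mu> \<nu>' E)"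
        using conv_add_right[OF er \<nu>'r \<mu>r] by simp
      have c1: "conv ?\<mu> (ext (res \<nu>)) \<in> regular_measures X" and c2: "conv ?\<mu> \<nu>' \<in> regular_measures X"
        by (intro conv_closed \<mu>r er \<nu>'r)+
      have "?T \<nu> = \<psi> (hconv \<sigma> (res \<nu>)) + \<psi> (res (conv ?\<mu> \<nu>'))"
        using clinear_on_add[OF \<psi>l res_regular[OF c1] res_regular[OF c2]]
        by (simp add: left_translate_def push_def \<nu>r conv_closed[OF \<mu>r \<nu>r] conv res_measure_add regular_measures_add[OF c1 c2 Haus])
      moreover have "?S \<nu> = \<psi> (hconv \<sigma> (res \<nu>))"
        by (simp add: push_def left_translate_def \<nu>r rr sub_conv_eq[OF \<sigma>r rr])
      moreover have "conv ?\<mu> (ext (res \<nu>)) H = \<nu> H"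
      proof -
        have "conv ?\<mu> (ext (res \<nu>)) H = conv ?\<mu> (ext (res \<nu>)) (topspace X)"
          using countably_additive_Diff[OF regular_measures_ca[OF c1] borel_sets_topspace H_borel H_subset]
            conv_ext_Hc[OF \<sigma>p rp] by simp
        also have "\<dots> = \<nu> H" by (simp add: conv_mass[OF \<mu>p ext_pos[OF rp]] ext_mass \<sigma>H res_H)
        finally show ?thesis .
      qed
      then have "?T1 \<nu> - ?\<chi> \<nu> = conv ?\<mu> \<nu>' H"
        by (simp add: left_translate_def char_functional_def \<nu>r conv regular_measures_add[OF c1 c2 Haus])
      ultimately show ?thesis using \<nu>'p by simp
    qed
    let ?\<eta> = "\<lambda>\<nu>. ?T1 \<nu> - ?\<chi> \<nu>" and ?\<theta> = "\<lambda>\<nu>. ?T \<nu> - ?S \<nu>"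
    have \<eta>: "?\<eta> \<in> M_dual X" by (rule M_dual_diff[OF Haus T1 \<chi>])
    have \<theta>: "?\<theta> \<in> M_dual X" by (rule M_dual_diff[OF Haus T S])
    have \<eta>pos: "pos_functional X ?\<eta>"
      unfolding pos_functional_def
    proof
      fix \<nu> assume \<nu>: "\<nu> \<in> pos_measures X"
      show "0 \<le> ?\<eta> \<nu>"
        using key[OF \<nu> refl] pos_measures_nonneg[OF conv_pos[OF \<mu>p]] by simp
    qed
    have m\<eta>: "m ?\<eta> = 0" using inv[OF \<mu> supp \<chi>] by (simp only: clinear_on_diff[OF Haus p.clinear T1 \<chi>]) simp
    have "cmod (?\<theta> \<nu>) \<le> B * Re (?\<eta> \<nu>)" if \<nu>: "\<nu> \<in> pos_measures X" for \<nu>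
    proof -
      let ?\<nu>' = "\<lambda>E. \<nu> E + (-1) * ext (res \<nu>) E"
      note k = key[OF \<nu> refl]
      have c: "conv ?\<mu> ?\<nu>' \<in> pos_measures X" using k by (intro conv_pos \<mu>p) simp
      have "cmod (\<psi> (res (conv ?\<mu> ?\<nu>'))) \<le> B * Re (conv ?\<mu> ?\<nu>' H)"
        using B(2)[OF res_pos[OF c]] unfolding topspace_Y res_H .
      then show ?thesis using k by (simp only:)
    qed
    then have "cmod (m ?\<theta>) \<le> B * Re (m ?\<eta>)" by (rule p.dominated[OF \<theta> \<eta> \<eta>pos])
    then have "m ?T = m ?S" using m\<eta> by (simp add: clinear_on_diff[OF Haus p.clinear T S])
    then show ?thesis
      using inv[OF \<mu> supp push_M_dual[OF \<psi>]] by (simp add: n_def \<psi> sub_left_translate_M_dual[OF \<sigma>p \<psi>])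
  qed
  then show ?thesis using n by (auto simp: TLIM_def)
qed

end

text \<open>H * H \<subseteq> H says that the support of p_x * p_y misses the complement of H for x
  and y in H, and a regular measure vanishes on Borel sets that miss its support.\<close>

lemma sub_convolution_of_sub_semihypergroup:
  assumes K: "semitopological_semihypergroup K conv" and H: "sub_semihypergroup K conv H"
  shows "sub_convolution K conv H"
proof -
  note K' = K[unfolded semitopological_semihypergroup_def]
  have Haus: "Hausdorff_space K" and lc: "locally_compact_space K"
    and alg: "assoc_algebra (regular_measures K) conv"
    and pos: "\<forall>\<mu> \<in> pos_measures K. \<forall>\<nu> \<in> pos_measures K. conv \<mu> \<nu> \<in> pos_measures K"
    and cont: "\<forall>\<mu> \<in> pos_measures K.
        continuous_map (cone_topology K) (cone_topology K) (\<lambda>\<nu>. conv \<mu> \<nu>) \<and>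
        continuous_map (cone_topology K) (cone_topology K) (\<lambda>\<nu>. conv \<nu> \<mu>)"
    and dir: "\<forall>x \<in> topspace K. \<forall>y \<in> topspace K. conv (dirac K x) (dirac K y) \<in> prob_measures K \<and>
        compactin K (msupp K (conv (dirac K x) (dirac K y)))"
    using K' by simp_all
  have closed: "closedin K H" and sub: "set_conv K conv H H \<subseteq> H"
    using H by (auto simp: sub_semihypergroup_def)
  have HK: "H \<subseteq> topspace K" using closed closedin_subset by blast
  show ?thesis
  proof
    show "conv (dirac K x) (dirac K y) (topspace K - H) = 0" if xy: "x \<in> H" "y \<in> H" for x y
    proof (rule measure_eq_0_if_msupp_disjoint[OF Haus])
      show "conv (dirac K x) (dirac K y) \<in> regular_measures K"
        using dir xy HK by (blast intro: pos_measures_regular prob_measures_pos)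
      show "topspace K - H \<in> borel_sets K"
        by (intro borel_sets_Diff borel_sets_topspace borel_sets_closedin closed)
      show "msupp K (conv (dirac K x) (dirac K y)) \<inter> (topspace K - H) = {}"
        using sub xy unfolding set_conv_def by blast
    qed
  qed (use Haus lc alg pos cont dir closed in \<open>auto simp: assoc_algebra_def intro!: clinear_onI\<close>)
qed

theorem theorem3p5:
  fixes K :: "'a topology" and conv :: "'a convolution" and H :: "'a set"
  assumes "semitopological_semihypergroup K conv"
    and "sub_semihypergroup K conv H"
  shows "((\<exists>m. TLIM (subtopology K H) (sub_conv K conv H) m) \<longleftrightarrow>
          (\<exists>m. top_left_invariant_under K conv H m \<and> m (char_functional K H) = 1))
       \<and> (type_L K conv H \<longrightarrow>
           ((\<exists>m. TLIM (subtopology K H) (sub_conv K conv H) m) \<longleftrightarrow>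
            (\<exists>m. top_left_invariant_under K conv H m \<and> 0 < m (char_functional K H)))
         \<and> ((\<exists>m. top_left_invariant_under K conv H m \<and> m (char_functional K H) = 1) \<longleftrightarrow>
            (\<exists>m. top_left_invariant_under K conv H m \<and> 0 < m (char_functional K H))))"
proof -
  interpret sub_convolution K conv H
    by (rule sub_convolution_of_sub_semihypergroup[OF assms])
  let ?P1 = "\<exists>m. TLIM (subtopology K H) (sub_conv K conv H) m"
  let ?P2 = "\<exists>m. top_left_invariant_under K conv H m \<and> m (char_functional K H) = 1"
  let ?P3 = "\<exists>m. top_left_invariant_under K conv H m \<and> 0 < m (char_functional K H)"
  \<comment> \<open>The properties are linked in a cycle: extension of a mean, then 1 > 0, then
    restriction with renormalisation.\<close>
  have "?P1 \<Longrightarrow> ?P2" using invariant_mean_extends by blast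
  moreover have ?P3 if ?P2
  proof -
    from that obtain m where "top_left_invariant_under K conv H m" "m (char_functional K H) = 1" by blast
    then have "top_left_invariant_under K conv H m \<and> 0 < m (char_functional K H)"
      by (simp add: less_complex_def)
    then show ?thesis by blast
  qed
  moreover have "?P3 \<Longrightarrow> ?P1" using invariant_mean_restricts by blast
  ultimately show ?thesis by blast
qed

end
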